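(* Let $M_1$ and $M_2$ be isospectral spherical space forms with fundamental groups $G_1$ and $G_2$ respectively. If $G_1$ is of Type I, say $G_1\simeq \Gamma_d(m,n,r_1)$, then $G_2$ is also of Type I, with $G_2\simeq \Gamma_d(m,n,r_2)$ for some $r_2$ (with the same $m$, $n$, $d$), and $$\gcd(r_1^c-1,m)=\gcd(r_2^c-1,m)\qquad\text{for every positive divisor } c \text{ of } d.$$
   Context: A spherical space form is a Riemannian manifold of the form $S^q/G$, where $q\geq 2$, $S^q$ is the unit sphere in $\mathbb{R}^{q+1}$ with its round metric of constant sectional curvature $1$, and $G$ is a finite subgroup of the orthogonal group $\mathrm{O}(q+1)$ acting freely on $S^q$. (Its fundamental group is isomorphic to $G$.) For a compact Riemannian manifold $(M,g)$, $\mathrm{Spec}(M,g)$ is the collection of eigenvalues, counted with multiplicity, of the Laplace–Beltrami operator on functions. Two compact Riemannian manifolds are isospectral if their spectra coincide. A finite group is of Type I if all its Sylow subgroups are cyclic. Notation: let $m,n,r$ be positive integers satisfying $\gcd((r-1)n,m)=1$ and $r^n\equiv 1\pmod m$, and let $d$ be the order of the class of $r$ in the multiplicative group $\mathbb{Z}_m^\times$ of integers modulo $m$. Then $\Gamma_d(m,n,r)$ denotes the group with generators $A,B$ and relations $A^m=B^n=1$, $BAB^{-1}=A^r$. It has order $mn$ and is of Type I, and every Type I group is isomorphic to one of this form (Burnside). Whenever $\Gamma_d(m,n,r)$ is written, it is understood that $m,n,r,d$ satisfy these conditions. *)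

theory Defs
  imports
    "HOL-Analysis.Analysis"
    "HOL-Library.Function_Algebras"
    "HOL-Number_Theory.Number_Theory"
    "HOL-Algebra.Group_Action"
    "HOL-Algebra.Elementary_Groups"
begin

section \<open>Spherical space forms\<close>

text \<open>The sphere $S^q$ is \<^term>\<open>sphere 0 1\<close> in \<open>real ^ 'n\<close> with \<open>CARD('n) = q + 1\<close>.\<close>

definition orthogonal_group :: "(real ^ 'n ^ 'n) monoid" where
  "orthogonal_group = \<lparr>carrier = {A. orthogonal_matrix A}, mult = (**), one = mat 1\<rparr>"

abbreviation as_group :: "(real ^ 'n ^ 'n) set \<Rightarrow> (real ^ 'n ^ 'n) monoid" where
  "as_group G \<equiv> orthogonal_group\<lparr>carrier := G\<rparr>"

text \<open>The finite groups \<open>G\<close> for which $S^q/G$ is a spherical space form.\<close>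

definition space_form_group :: "(real ^ 'n ^ 'n) set \<Rightarrow> bool" where
  "space_form_group G \<longleftrightarrow>
     CARD('n) \<ge> 3 \<and> finite G \<and> subgroup G orthogonal_group \<and>
     (\<forall>A\<in>G. A \<noteq> mat 1 \<longrightarrow> (\<forall>x\<in>sphere 0 1. A *v x \<noteq> x))"

definition orbit_proj :: "(real ^ 'n ^ 'n) set \<Rightarrow> real ^ 'n \<Rightarrow> (real ^ 'n) set" where
  "orbit_proj G x = orbit (as_group G) (*v) x"

definition space_form :: "(real ^ 'n ^ 'n) set \<Rightarrow> (real ^ 'n) set set" where
  "space_form G = orbits (as_group G) (sphere 0 1) (*v)"

section \<open>The Laplace--Beltrami operator\<close>

text \<open>On an open set \<open>U\<close>, \<open>Ck_on k f U\<close> says that \<open>f\<close> is \<open>k\<close> times continuously differentiable.\<close>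

fun Ck_on :: "nat \<Rightarrow> (real ^ 'n \<Rightarrow> real) \<Rightarrow> (real ^ 'n) set \<Rightarrow> bool" where
  "Ck_on 0 f U \<longleftrightarrow> continuous_on U f"
| "Ck_on (Suc k) f U \<longleftrightarrow>
     (\<forall>x\<in>U. f differentiable at x) \<and>
     (\<forall>v. Ck_on k (\<lambda>x. frechet_derivative f (at x) v) U)"

definition smooth_on_sphere :: "(real ^ 'n \<Rightarrow> real) \<Rightarrow> bool" where
  "smooth_on_sphere f \<longleftrightarrow>
     (\<forall>x\<in>sphere 0 1. \<exists>U F. open U \<and> x \<in> U \<and> (\<forall>k. Ck_on k F U) \<and>
        (\<forall>y\<in>U \<inter> sphere 0 1. F y = f y))"

text \<open>
  Orthogonal projection onto the tangent space of the sphere at \<open>x\<close>, which is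
  $x^\perp$. The derivatives below are taken \<open>within\<close> the sphere; such a derivative is determined
  only on tangent vectors, and it is only evaluated there.
\<close>

definition tangent_proj :: "real ^ 'n \<Rightarrow> real ^ 'n \<Rightarrow> real ^ 'n" where
  "tangent_proj x v = v - (v \<bullet> x) *\<^sub>R x"

definition sphere_grad :: "(real ^ 'n \<Rightarrow> real) \<Rightarrow> real ^ 'n \<Rightarrow> real ^ 'n" where
  "sphere_grad f x =
     (THE v. v \<bullet> x = 0 \<and>
        (\<forall>w. w \<bullet> x = 0 \<longrightarrow> v \<bullet> w = frechet_derivative f (at x within sphere 0 1) w))"

text \<open>
  The Levi-Civita connection of the round metric is the tangential part of the ambient derivative.
  The divergence of a tangent field \<open>X\<close> is the trace over the tangent space of its
  covariant derivative, here extended by \<open>0\<close> in the normal direction so that \<^const>\<open>trace\<close> applies.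
\<close>

definition sphere_div :: "(real ^ 'n \<Rightarrow> real ^ 'n) \<Rightarrow> real ^ 'n \<Rightarrow> real" where
  "sphere_div X x =
     trace (matrix (\<lambda>v.
       tangent_proj x (frechet_derivative X (at x within sphere 0 1) (tangent_proj x v))))"

text \<open>With this sign, the eigenvalues are nonnegative.\<close>

definition sphere_laplacian :: "(real ^ 'n \<Rightarrow> real) \<Rightarrow> real ^ 'n \<Rightarrow> real" where
  "sphere_laplacian f x = - sphere_div (sphere_grad f) x"

section \<open>The spectrum\<close>

text \<open>
  The Riemannian structure of $S^q/G$ is the one for which the projection from $S^q$ is a local
  isometry, so smoothness and the Laplace--Beltrami operator of a function on $S^q/G$ are those of
  its lift to $S^q$. Functions on $S^q/G$ are total functions on sets of vectors that vanish
  outside \<^term>\<open>space_form G\<close>.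
\<close>

definition eigenspace :: "(real ^ 'n ^ 'n) set \<Rightarrow> real \<Rightarrow> ((real ^ 'n) set \<Rightarrow> real) set" where
  "eigenspace G \<mu> =
     {f. (\<forall>p. p \<notin> space_form G \<longrightarrow> f p = 0) \<and>
         smooth_on_sphere (f \<circ> orbit_proj G) \<and>
         (\<forall>x\<in>sphere 0 1. sphere_laplacian (f \<circ> orbit_proj G) x = \<mu> * f (orbit_proj G x))}"

global_interpretation fun_space: vector_space "\<lambda>(c::real) (f :: 'a \<Rightarrow> real) x. c * f x"
  defines fun_dim = fun_space.dim
  by unfold_locales (auto simp: fun_eq_iff algebra_simps)

text \<open>
  The spectrum as a multiset of reals, given by its multiplicity function (which is \<open>0\<close> at
  non-eigenvalues). Eigenspaces are finite-dimensional because $S^q/G$ is compact, so the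
  convention that infinite dimensions are \<open>0\<close> plays no role.
\<close>

definition spectrum :: "(real ^ 'n ^ 'n) set \<Rightarrow> real \<Rightarrow> nat" where
  "spectrum G \<mu> = fun_dim (eigenspace G \<mu>)"

definition isospectral :: "(real ^ 'n1 ^ 'n1) set \<Rightarrow> (real ^ 'n2 ^ 'n2) set \<Rightarrow> bool" where
  "isospectral G1 G2 \<longleftrightarrow> spectrum G1 = spectrum G2"

section \<open>Groups of Type I\<close>

definition sylow_subgroup :: "nat \<Rightarrow> 'a set \<Rightarrow> ('a, 'b) monoid_scheme \<Rightarrow> bool" where
  "sylow_subgroup p P G \<longleftrightarrow> subgroup P G \<and> card P = p ^ multiplicity p (order G)"

definition type_I :: "('a, 'b) monoid_scheme \<Rightarrow> bool" where
  "type_I G \<longleftrightarrow> group G \<and> finite (carrier G) \<and>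
     (\<forall>p P. Factorial_Ring.prime p \<longrightarrow> sylow_subgroup p P G \<longrightarrow> cyclic_group (G\<lparr>carrier := P\<rparr>))"

text \<open>
  Group presentations. A letter \<open>(x, True)\<close> stands for the generator \<open>x\<close> and \<open>(x, False)\<close> for its
  inverse; a relation is a pair of words.
\<close>

type_synonym 'x word = "('x \<times> bool) list"

inductive word_eq :: "('x word \<times> 'x word) set \<Rightarrow> 'x word \<Rightarrow> 'x word \<Rightarrow> bool"
  for R where
  rel: "(u, v) \<in> R \<Longrightarrow> word_eq R u v"
| cancel: "word_eq R [(x, b), (x, \<not> b)] []"
| refl: "word_eq R u u"
| sym: "word_eq R u v \<Longrightarrow> word_eq R v u"
| trans: "word_eq R u v \<Longrightarrow> word_eq R v w \<Longrightarrow> word_eq R u w"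
| append: "word_eq R u u' \<Longrightarrow> word_eq R v v' \<Longrightarrow> word_eq R (u @ v) (u' @ v')"

definition presented_group :: "('x word \<times> 'x word) set \<Rightarrow> 'x word set monoid" where
  "presented_group R =
     \<lparr>carrier = range (\<lambda>u. Collect (word_eq R u)),
      mult = (\<lambda>X Y. {w. \<exists>u\<in>X. \<exists>v\<in>Y. word_eq R (u @ v) w}),
      one = Collect (word_eq R [])\<rparr>"

lemma presented_group_mult:
  "Collect (word_eq R u) \<otimes>\<^bsub>presented_group R\<^esub> Collect (word_eq R v) = Collect (word_eq R (u @ v))"
  unfolding presented_group_def
  by (auto intro: word_eq.intros)

lemma word_eq_inverse: "word_eq R (map (\<lambda>(x, b). (x, \<not> b)) (rev u) @ u) []"
proof (induction u)
  case (Cons a u)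
  obtain x b where a: "a = (x, b)" by force
  let ?v = "map (\<lambda>(x, b). (x, \<not> b)) (rev u)"
  have "word_eq R [(x, \<not> b), (x, b)] []"
    using word_eq.cancel[of R x "\<not> b"] by simp
  then have "word_eq R (?v @ ([(x, \<not> b), (x, b)] @ u)) (?v @ ([] @ u))"
    by (intro word_eq.append word_eq.refl)
  then show ?case
    using Cons a by (auto intro: word_eq.trans)
qed (simp add: word_eq.refl)

lemma group_presented_group: "group (presented_group R)"
proof (rule groupI)
  let ?c = "\<lambda>u. Collect (word_eq R u)"
  have carr: "carrier (presented_group R) = range ?c" and one: "\<one>\<^bsub>presented_group R\<^esub> = ?c []"
    by (auto simp: presented_group_def)
  fix X assume X: "X \<in> carrier (presented_group R)"
  then obtain u where u: "X = ?c u" using carr by auto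
  show "\<one>\<^bsub>presented_group R\<^esub> \<otimes>\<^bsub>presented_group R\<^esub> X = X"
    by (simp add: one u presented_group_mult)
  have "?c (map (\<lambda>(x, b). (x, \<not> b)) (rev u) @ u) = ?c []"
    using word_eq_inverse[of R u] by (auto intro: word_eq.trans word_eq.sym)
  then show "\<exists>Y\<in>carrier (presented_group R). Y \<otimes>\<^bsub>presented_group R\<^esub> X = \<one>\<^bsub>presented_group R\<^esub>"
    unfolding carr one u by (metis presented_group_mult rangeI)
  fix Y assume "Y \<in> carrier (presented_group R)"
  then obtain v where v: "Y = ?c v" using carr by auto
  show "X \<otimes>\<^bsub>presented_group R\<^esub> Y \<in> carrier (presented_group R)"
    by (simp add: u v carr presented_group_mult)
  fix Z assume "Z \<in> carrier (presented_group R)"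
  then obtain w where w: "Z = ?c w" using carr by auto
  show "X \<otimes>\<^bsub>presented_group R\<^esub> Y \<otimes>\<^bsub>presented_group R\<^esub> Z =
        X \<otimes>\<^bsub>presented_group R\<^esub> (Y \<otimes>\<^bsub>presented_group R\<^esub> Z)"
    by (simp add: u v w presented_group_mult)
qed (auto simp: presented_group_def)

datatype gamma_gen = Gen_A | Gen_B

definition Gamma_group :: "nat \<Rightarrow> nat \<Rightarrow> nat \<Rightarrow> gamma_gen word set monoid" where
  "Gamma_group m n r = presented_group
     {(replicate m (Gen_A, True), []),
      (replicate n (Gen_B, True), []),
      ([(Gen_B, True), (Gen_A, True), (Gen_B, False)], replicate r (Gen_A, True))}"

text \<open>The standing conditions on the parameters of $\Gamma_d(m,n,r)$.\<close>

definition Gamma_params :: "nat \<Rightarrow> nat \<Rightarrow> nat \<Rightarrow> nat \<Rightarrow> bool" where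
  "Gamma_params d m n r \<longleftrightarrow>
     m > 0 \<and> n > 0 \<and> r > 0 \<and> gcd ((r - 1) * n) m = 1 \<and> [r ^ n = 1] (mod m) \<and>
     d = ord m r"

end

theory Submission
  imports Defs
    "HOL-Computational_Algebra.Polynomial_Factorial"
    "HOL-Computational_Algebra.Field_as_Ring"
begin

text \<open>
  Let $a_k$ be the dimension of the space of $G$-invariant homogeneous polynomials of degree $k$.
  Every eigenfunction on $S^q$ is the restriction of a harmonic polynomial, because the Laplacian is
  self-adjoint and polynomials are dense; hence the multiplicity of $k (k + q - 1)$ is $a_k - a_{k-2}$
  and the spectrum determines $q$ and all $a_k$. By Molien's formula, $\sum_k a_k z^k$ is the
  average over $g \in G$ of $\det(1 - z g)^{-1}$. As $G$ acts freely, all eigenvalues of an element of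
  order $e$ are primitive $e$-th roots of unity, so that elements of different orders contribute
  different poles. Uniqueness of partial fractions, evaluated at $z = 0$, shows that $G_1$ and $G_2$
  have the same number of elements of each order.

  In $\Gamma_d(m,n,r)$ the elements of order dividing $m$ are the powers of $A$. So in $G_2$ an element
  of order $m$ generates a normal subgroup, an element of order $n$ generates a complement, and
  $G_2$ is of the required form. Finally, for $e \mid m$ and $c \mid n$ there is an element of order
  $e n / c$ if and only if $r^c \equiv 1$ modulo $e$, so the greatest common divisors can be read off
  the set of element orders.
\<close>

section \<open>Split metacyclic groups\<close>

text \<open>The rational functions in Molien's sum are not reduced. All elements of order e get the
  same denominator, the N-th power of the product of 1 - w X over all primitive e-th roots of unity
  w, where N = q + 1. The numerator then has smaller degree and constant coefficient 1, so constant
  coefficients count elements, weighted by 1/|G|. The weights agree because each group has exactly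
  one element of order 1.

  Self-adjointness is obtained without charts: up to sign, the Laplacian is half the sum of the
  squares of the rotation fields x_i d_j - x_j d_i over ordered pairs, and each such field is skew
  for an integral invariant under rotations. Harmonic forms of degree k are introduced as the forms
  orthogonal, on the sphere, to all forms of degree k - 2; self-adjointness then shows that they are
  eigenfunctions.

  Spheres of different dimensions can share eigenvalues, so q is not visible from a single one. Two
  dimensions share only finitely many, whereas every quotient has infinitely many: powers of an
  invariant form that is not constant on the sphere make a_k unbounded.\<close>

locale power_conjugation = group G for G (structure) +
  fixes r :: nat and a b :: 'a
  assumes a: "a \<in> carrier G" and b: "b \<in> carrier G"
    and conj: "b \<otimes> a \<otimes> inv b = a [^] r"
begin

lemma b_pow_a_pow: "b [^] (j::nat) \<otimes> a [^] (i::nat) = a [^] (i * r ^ j) \<otimes> b [^] j"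
proof -
  have ba: "b \<otimes> a = a [^] r \<otimes> b"
    using conj a b by (metis inv_closed inv_solve_right m_closed nat_pow_closed)
  have one: "b \<otimes> a [^] (i::nat) = a [^] (i * r) \<otimes> b" for i
  proof (induction i)
    case (Suc i)
    have "b \<otimes> a [^] Suc i = (b \<otimes> a [^] i) \<otimes> a"
      using a b by (simp add: m_assoc)
    also have "\<dots> = a [^] (i * r) \<otimes> (b \<otimes> a)"
      using a b Suc by (simp add: m_assoc)
    also have "\<dots> = a [^] (Suc i * r) \<otimes> b"
      using a b by (simp add: ba m_assoc[symmetric] nat_pow_mult add.commute)
    finally show ?case .
  qed (use a b in simp)
  show ?thesis
  proof (induction j arbitrary: i)
    case (Suc j)
    have "b [^] Suc j \<otimes> a [^] i = b [^] j \<otimes> (b \<otimes> a [^] i)"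
      using a b by (simp add: m_assoc)
    also have "\<dots> = (b [^] j \<otimes> a [^] (i * r)) \<otimes> b"
      using a b by (simp add: one m_assoc)
    also have "\<dots> = a [^] (i * r ^ Suc j) \<otimes> b [^] Suc j"
      using a b Suc[of "i * r"] by (simp add: m_assoc algebra_simps)
    finally show ?case .
  qed (use a b in simp)
qed

lemma mult_normal_form:
  "(a [^] (i::nat) \<otimes> b [^] (j::nat)) \<otimes> (a [^] (k::nat) \<otimes> b [^] (l::nat)) =
    a [^] (i + k * r ^ j) \<otimes> b [^] (j + l)"
proof -
  have "(a [^] i \<otimes> b [^] j) \<otimes> (a [^] k \<otimes> b [^] l) = a [^] i \<otimes> (b [^] j \<otimes> a [^] k) \<otimes> b [^] l"
    using a b by (simp add: m_assoc)
  also have "\<dots> = (a [^] i \<otimes> a [^] (k * r ^ j)) \<otimes> (b [^] j \<otimes> b [^] l)"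
    using a b by (simp add: m_assoc b_pow_a_pow)
  also have "\<dots> = a [^] (i + k * r ^ j) \<otimes> b [^] (j + l)"
    using a b by (simp only: nat_pow_mult)
  finally show ?thesis .
qed

text \<open>The exponent of \<open>a\<close> is a geometric sum in \<open>r ^ j\<close> and is left
  unspecified; the exponent of \<open>b\<close> is the one that gets compared with
  \<open>n\<close>.\<close>

lemma pow_normal_form:
  "\<exists>s. (a [^] (i::nat) \<otimes> b [^] (j::nat)) [^] (t::nat) = a [^] (s::nat) \<otimes> b [^] (j * t)"
proof (induction t)
  case 0
  show ?case by (rule exI[of _ 0]) simp
next
  case (Suc t)
  then obtain s where s: "(a [^] i \<otimes> b [^] j) [^] t = a [^] (s::nat) \<otimes> b [^] (j * t)" by blast
  show ?case
    using s by (auto simp: mult_normal_form algebra_simps)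
qed

end

text \<open>The orders of \<open>a\<close> and \<open>b\<close> are assumed only at this stage:
  \<open>power_conjugation\<close> is also instantiated with the presented group, where at first
  nothing but the relations is known.\<close>

locale metacyclic = power_conjugation G r a b for G (structure) and m n r :: nat and a b :: 'a +
  assumes ord_a: "ord a = m" and ord_b: "ord b = n"
    and order_G: "order G = m * n"
    and coprime_mn: "coprime m n"
    and m_pos: "m > 0" and n_pos: "n > 0"
begin

lemma finite_G: "finite (carrier G)"
  using order_G m_pos n_pos order_gt_0_iff_finite by force

lemma a_pow_eq_iff: "a [^] (i::nat) = a [^] (k::nat) \<longleftrightarrow> [i = k] (mod m)"
  by (metis a cong_int_iff int_pow_eq int_pow_int mod_eq_dvd_iff_nat ord_a cong_iff_dvd_diff cong_sym)

text \<open>The subgroups generated by \<open>a\<close> and \<open>b\<close> have coprime orders and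
  so meet trivially: the m-th power of b^j = a^(-i) is 1, and \<open>n\<close> is coprime to
  \<open>m\<close>.\<close>

lemma a_pow_b_pow_one:
  assumes "a [^] (i::nat) \<otimes> b [^] (j::nat) = \<one>" shows "m dvd i" "n dvd j"
proof -
  have "b [^] j = inv (a [^] i)"
    using assms a b by (metis inv_equality inv_inv nat_pow_closed)
  then have "(b [^] j) [^] m = inv ((a [^] i) [^] m)"
    using a b by (simp add: nat_pow_inv)
  also have "\<dots> = \<one>"
    using a by (simp add: nat_pow_pow pow_eq_id ord_a)
  finally have "n dvd j * m"
    using b by (simp add: nat_pow_pow pow_eq_id ord_b)
  then show n: "n dvd j"
    using coprime_mn by (simp add: coprime_commute coprime_dvd_mult_left_iff)
  then have "b [^] j = \<one>" using b by (simp add: pow_eq_id ord_b)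
  with assms have "a [^] i = \<one>" using a by simp
  then show "m dvd i" using a by (simp add: pow_eq_id ord_a)
qed

text \<open>Trivial intersection makes the \<open>m * n\<close> products distinct, and by
  \<open>order_G\<close> they fill the group.\<close>

lemma carrier_normal_form:
  assumes "x \<in> carrier G"
  obtains i j :: nat where "i < m" "j < n" "x = a [^] i \<otimes> b [^] j"
proof -
  let ?f = "\<lambda>(i::nat, j::nat). a [^] i \<otimes> b [^] j"
  have "inj_on ?f ({..<m} \<times> {..<n})"
  proof (rule inj_onI, clarify)
    fix i j k l :: nat
    assume lt: "i < m" "k < m" "j < n" "l < n" and eq: "a [^] i \<otimes> b [^] j = a [^] k \<otimes> b [^] l"
    have b1: "b [^] l \<otimes> b [^] (n - l) = \<one>"
      using lt b by (simp add: nat_pow_mult pow_eq_id ord_b)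
    have a1: "a [^] (m - k) \<otimes> a [^] k = \<one>"
      using lt a by (simp add: nat_pow_mult pow_eq_id ord_a)
    \<comment> \<open>The factors \<open>a [^] (m - k)\<close> and \<open>b [^] (n - l)\<close>
      stand in for inverses, so that all exponents stay natural.\<close>
    have "a [^] (m - k + i) \<otimes> b [^] (j + (n - l)) = a [^] (m - k) \<otimes> (a [^] i \<otimes> b [^] j) \<otimes> b [^] (n - l)"
      using a b by (simp add: nat_pow_mult[symmetric] m_assoc)
    also have "\<dots> = (a [^] (m - k) \<otimes> a [^] k) \<otimes> (b [^] l \<otimes> b [^] (n - l))"
      using a b eq by (simp add: m_assoc)
    finally have "a [^] (m - k + i) \<otimes> b [^] (j + (n - l)) = \<one>"
      by (simp add: a1 b1)
    from a_pow_b_pow_one[OF this] have "m dvd m + i - k" "n dvd n + j - l"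
      using lt by (auto simp: algebra_simps)
    then have "[m + i = k] (mod m)" "[n + j = l] (mod n)"
      using lt by (auto simp: cong_altdef_nat)
    then show "i = k \<and> j = l"
      using lt by (auto simp: cong_def)
  qed
  then have "card (?f ` ({..<m} \<times> {..<n})) = card (carrier G)"
    using order_G by (simp add: card_image order_def)
  moreover have "?f ` ({..<m} \<times> {..<n}) \<subseteq> carrier G"
    using a b by auto
  ultimately have "?f ` ({..<m} \<times> {..<n}) = carrier G"
    using finite_G by (simp add: card_subset_eq)
  with assms that show thesis by fastforce
qed

text \<open>The powers of \<open>a\<close> form a normal subgroup of index \<open>n\<close>, and
  \<open>n\<close> is coprime to \<open>m\<close>, so an element killed by \<open>m\<close> is
  trivial in the quotient. This subgroup can therefore be recognised from element orders
  alone.\<close>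

lemma pow_m_eq_one_iff:
  assumes "x \<in> carrier G"
  shows "x [^] m = \<one> \<longleftrightarrow> (\<exists>i<m. x = a [^] i)"
proof
  assume *: "x [^] m = \<one>"
  obtain i j where ij: "i < m" "j < n" "x = a [^] i \<otimes> b [^] j"
    using carrier_normal_form[OF assms] .
  obtain s where "x [^] m = a [^] (s::nat) \<otimes> b [^] (j * m)"
    using pow_normal_form[of i j m] ij by auto
  with * have "n dvd j * m" using a_pow_b_pow_one(2) by simp
  then have "n dvd j"
    using coprime_mn by (simp add: coprime_commute coprime_dvd_mult_left_iff)
  then have "j = 0" using ij(2) by (auto dest: dvd_imp_le)
  then show "\<exists>i<m. x = a [^] i" using ij a by auto
qed (use a in \<open>auto simp: nat_pow_pow pow_eq_id ord_a\<close>)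

lemma card_pow_m_eq_one: "card {x \<in> carrier G. x [^] m = \<one>} = m"
proof -
  have "{x \<in> carrier G. x [^] m = \<one>} = (\<lambda>i::nat. a [^] i) ` {..<m}"
    using pow_m_eq_one_iff a by auto
  moreover have "inj_on (\<lambda>i::nat. a [^] i) {..<m}"
    by (auto simp: inj_on_def a_pow_eq_iff cong_def)
  ultimately show ?thesis by (simp add: card_image)
qed

lemma r_pow_n: "[r ^ n = 1] (mod m)"
proof -
  have "a [^] (1 * r ^ n) \<otimes> b [^] n = a [^] (1::nat)"
    using b_pow_a_pow[of n 1] a b pow_ord_eq_1[of b, unfolded ord_b] by simp
  moreover have "b [^] n = \<one>" using b by (simp add: pow_eq_id ord_b)
  ultimately have "a [^] (r ^ n) = a [^] (1::nat)" using a by simp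
  then show ?thesis by (simp only: a_pow_eq_iff)
qed

lemma ord_a_pow:
  assumes "e dvd m" "e > 0" shows "ord (a [^] (m div e)) = e"
  using assms a ord_a m_pos ord_pow[of a "m div e"]
  by (metis div_dvd_div div_div_eq_right dvd_div_eq_0_iff dvd_refl div_self dvd_div_mult_self mult.commute nat_mult_1_right nonzero_mult_div_cancel_left not_gr_zero dvd_mult_div_cancel dvd_triv_right)

lemma ord_b_pow:
  assumes "c dvd n" shows "ord (b [^] c) = n div c"
  using assms b ord_b n_pos ord_pow[of b c] by (metis dvd_0_left_iff not_gr_zero)

text \<open>With q = n / c, the powers y = x^q and z = x^e commute and have orders e and q. Since y
  = a^i has order e, commuting with z = a^k b^l means r^l = 1 modulo e. As z has order q modulo the
  powers of \<open>a\<close>, gcd(l, n) divides c, and r^c = 1 modulo e follows from r^l = 1 and r^n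
  = 1.\<close>

lemma dvd_pow_diff_if:
  assumes "x \<in> carrier G" "ord x = e * (n div c)" "e dvd m" "c dvd n"
  shows "[r ^ c = 1] (mod e)"
proof -
  define q where "q = n div c"
  have q: "q * c = n" "q > 0" using assms(4) n_pos by (auto simp: q_def)
  have e: "e > 0" using assms(3) m_pos by (auto intro: Nat.gr0I)
  have eq: "coprime e q"
    using coprime_mn assms(3) q by (metis coprime_divisors dvd_triv_left)
  define y where "y = x [^] q"
  define z where "z = x [^] e"
  have ordx: "ord x = e * q" by (simp add: assms(2) q_def)
  have y: "y \<in> carrier G" "ord y = e" and z: "z \<in> carrier G" "ord z = q"
    using ord_pow[OF assms(1), of q] ord_pow[OF assms(1), of e] assms(1) ordx e q
    by (auto simp: y_def z_def)
  have comm: "z \<otimes> y = y \<otimes> z"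
    unfolding y_def z_def using assms(1) by (simp add: nat_pow_mult add.commute)
  have "y [^] m = \<one>" using y assms(3) by (simp add: pow_eq_id)
  then obtain i where i: "y = a [^] (i::nat)" using pow_m_eq_one_iff y by blast
  obtain k l where kl: "z = a [^] (k::nat) \<otimes> b [^] (l::nat)"
    using carrier_normal_form[OF z(1)] by metis
  have "a [^] (k + i * r ^ l) \<otimes> b [^] l = a [^] (k + i) \<otimes> b [^] l"
    using comm mult_normal_form[of k l i 0] mult_normal_form[of i 0 k l] a b
    unfolding i kl by (simp add: add.commute)
  then have "a [^] (k + i * r ^ l) = a [^] (k + i)"
    using a b by simp
  then have "[k + i * r ^ l = k + i * 1] (mod m)" by (simp only: a_pow_eq_iff mult_1_right)
  then have cong: "[i * r ^ l = i * 1] (mod m)" using cong_add_lcancel_nat by blast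
  have rl: "[r ^ l = 1] (mod e)"
  proof -
    have em: "m dvd i * e" using y i a by (metis nat_pow_pow ord_a pow_eq_id pow_ord_eq_1)
    have "m dvd i * t \<Longrightarrow> e dvd t" for t
      using y i a by (metis nat_pow_pow ord_a pow_eq_id nat_pow_closed)
    \<comment> \<open>The difference is taken in the integers, since \<open>r\<close> may be 0 here;
      an absolute value brings it back to \<open>nat\<close>.\<close>
    moreover have "int m dvd int (i * r ^ l) - int (i * 1)"
      using cong by (metis cong_iff_dvd_diff cong_int_iff)
    ultimately have "int e dvd int (r ^ l) - int 1"
    proof -
      assume 1: "\<And>t. m dvd i * t \<Longrightarrow> e dvd t" and 2: "int m dvd int (i * r ^ l) - int (i * 1)"
      have "int m dvd int i * (int (r ^ l) - int 1)"
        using 2 by (simp add: algebra_simps)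
      then have "int m dvd int i * \<bar>int (r ^ l) - int 1\<bar>"
        by (metis abs_mult dvd_abs_iff abs_of_nat)
      then have "int m dvd int (i * nat \<bar>int (r ^ l) - int 1\<bar>)"
        by simp
      then have "e dvd nat \<bar>int (r ^ l) - int 1\<bar>"
        using 1 int_dvd_int_iff by blast
      then show ?thesis by auto
    qed
    then show ?thesis by (metis cong_iff_dvd_diff cong_int_iff)
  qed
  have rn: "[r ^ n = 1] (mod e)"
    using r_pow_n assms(3) by (rule cong_dvd_modulus_nat)
  \<comment> \<open>For g = gcd l n, the number \<open>n\<close> divides l (n / g), so z^(n/g) is a
    power of \<open>a\<close> and its m-th power is 1. As ord z = q is coprime to m, this gives q |
    n / g, that is q g | n = q c. The order of \<open>r\<close> modulo \<open>e\<close> divides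
    g.\<close>
  have "ord_e dvd c" if "ord_e = Pocklington.ord e r" for ord_e
  proof -
    have d: "ord_e dvd l" "ord_e dvd n" using rl rn ord_divides that by blast+
    define g where "g = gcd l n"
    have "g dvd n" by (simp add: g_def)
    have "l * (n div g) = (l div g) * n" by (simp add: g_def div_mult_swap dvd_div_mult)
    then have "n dvd l * (n div g)" by simp
    obtain s where s: "z [^] (n div g) = a [^] (s::nat) \<otimes> b [^] (l * (n div g))"
      using pow_normal_form[of k l "n div g"] kl by auto
    have "b [^] (l * (n div g)) = \<one>" using \<open>n dvd l * (n div g)\<close> b by (simp add: pow_eq_id ord_b)
    then have za: "z [^] (n div g) = a [^] s" using s a by simp
    then have "(z [^] (n div g)) [^] m = \<one>" using a by (simp add: nat_pow_pow pow_eq_id ord_a)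
    then have "q dvd (n div g) * m" using z by (simp add: nat_pow_pow pow_eq_id)
    moreover have "coprime q m" using coprime_mn q by (metis coprime_commute coprime_divisors dvd_refl dvd_triv_left)
    ultimately have "q dvd n div g" by (simp add: coprime_dvd_mult_left_iff)
    then have "q * g dvd n" using \<open>g dvd n\<close> by (metis dvd_div_mult_self mult_dvd_mono dvd_refl)
    then have "q * g dvd q * c" by (simp only: q(1))
    then have "g dvd c" using q(2) by simp
    with d show ?thesis unfolding g_def by (meson dvd_trans gcd_greatest)
  qed
  then show ?thesis using ord_divides by blast
qed

text \<open>The witness is the product of y = a^(m/e) and z = b^c, of coprime orders e and n / c.
  Multiplying the congruence modulo e by m / e gives one modulo m, which says that z and y
  commute.\<close>

lemma exists_ord_if:
  assumes "e dvd m" "c dvd n" "[r ^ c = 1] (mod e)"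
  shows "\<exists>x\<in>carrier G. ord x = e * (n div c)"
proof -
  have e: "e > 0" using assms(1) m_pos by (auto intro: Nat.gr0I)
  define y where "y = a [^] (m div e)"
  define z where "z = b [^] c"
  have y: "y \<in> carrier G" "ord y = e" using a ord_a_pow[OF assms(1) e] by (auto simp: y_def)
  have z: "z \<in> carrier G" "ord z = n div c" using b ord_b_pow[OF assms(2)] by (auto simp: z_def)
  have "[(m div e) * r ^ c = m div e] (mod m)"
  proof -
    have "[(m div e) * r ^ c = (m div e) * 1] (mod (m div e) * e)"
      using assms(3) unfolding cong_def mult_mod_right[symmetric] by argo
    then show ?thesis using assms(1) by simp
  qed
  then have comm: "z \<otimes> y = y \<otimes> z"
    using b_pow_a_pow[of c "m div e"] unfolding y_def z_def by (metis a_pow_eq_iff)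
  have cop: "coprime e (n div c)"
    using coprime_mn assms coprime_divisors[of e m "n div c" n] by (metis dvd_div_mult_self dvd_triv_left)
  have "ord (y \<otimes> z) = e * (n div c)"
  proof (rule dvd_antisym)
    show "ord (y \<otimes> z) dvd e * (n div c)"
      using ord_mul_divides[of y z] y z comm by simp
    define k where "k = ord (y \<otimes> z)"
    have yz: "y \<otimes> z \<in> carrier G" using y z by simp
    have k1: "y [^] k \<otimes> z [^] k = \<one>"
      using yz y z comm by (metis k_def pow_mult_distrib pow_ord_eq_1)
    have *: "a [^] ((m div e) * k) \<otimes> b [^] (c * k) = \<one>"
      using k1 a b by (simp add: y_def z_def nat_pow_pow)
    have "m dvd (m div e) * k" "n dvd c * k" using a_pow_b_pow_one[OF *] .
    then have "y [^] k = \<one>" "z [^] k = \<one>"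
      using a b by (auto simp: y_def z_def nat_pow_pow pow_eq_id ord_a ord_b)
    then have "e dvd k" "n div c dvd k" using y z by (auto simp: pow_eq_id)
    then show "e * (n div c) dvd k" using cop by (simp add: divides_mult)
  qed
  then show ?thesis using y z by blast
qed

lemma cong_one_iff_exists_ord:
  assumes "e dvd m" "c dvd n"
  shows "[r ^ c = 1] (mod e) \<longleftrightarrow> (\<exists>x\<in>carrier G. ord x = e * (n div c))"
  using assms dvd_pow_diff_if exists_ord_if by metis

end

section \<open>Cyclic Sylow subgroups\<close>

lemma (in group) cyclic_subgroup_if_ord_eq_card:
  assumes "subgroup P G" "finite P" "x \<in> P" "ord x = card P"
  shows "cyclic_group (G\<lparr>carrier := P\<rparr>)"
proof -
  interpret P: group "G\<lparr>carrier := P\<rparr>"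
    using assms(1) by (rule subgroup_imp_group)
  have x: "x \<in> carrier G" using subgroup.mem_carrier[OF assms(1,3)] .
  have pow: "x [^]\<^bsub>G\<lparr>carrier := P\<rparr>\<^esub> (i::int) = x [^] i" for i
    using int_pow_consistent[OF assms(1,3)] by simp
  have pos: "ord x > 0" using assms by (metis card_gt_0_iff empty_iff)
  have inj: "inj_on (\<lambda>i::int. x [^] i) (int ` {..<card P})"
  proof (rule inj_onI)
    fix i j assume ij: "i \<in> int ` {..<card P}" "j \<in> int ` {..<card P}" "x [^] i = x [^] j"
    then have "int (ord x) dvd i - j" using int_pow_eq[OF x] by (metis dvd_diff_commute)
    then have "i mod int (card P) = j mod int (card P)" using assms(4) by (simp add: mod_eq_dvd_iff)
    then show "i = j" using ij by auto
  qed
  have sub: "range (\<lambda>i::int. x [^] i) \<subseteq> P"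
    using assms by (auto intro: subgroup_int_pow_closed)
  have "card ((\<lambda>i::int. x [^] i) ` (int ` {..<card P})) = card P"
    using inj by (simp add: card_image)
  then have "(\<lambda>i::int. x [^] i) ` (int ` {..<card P}) = P"
    using sub assms(2) by (intro card_subset_eq) auto
  then have "range (\<lambda>i::int. x [^] i) = P"
    using sub by blast
  then have "carrier (G\<lparr>carrier := P\<rparr>) = range (\<lambda>i::int. x [^]\<^bsub>G\<lparr>carrier := P\<rparr>\<^esub> i)"
    by (simp add: pow)
  then show ?thesis
    unfolding P.cyclic_group using assms(3) by (intro bexI[of _ x]) simp_all
qed

text \<open>A Sylow subgroup P of order p^v without an element of order p^v has exponent dividing q
  = p^(v-1). By coprimality p^v divides \<open>m\<close> or \<open>n\<close>. In the first case P
  consists of solutions of x^q = 1 among the powers of \<open>a\<close>, in the second the exponent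
  of \<open>b\<close> is injective on P and a multiple of n / q. Either way P has at most q
  elements, a contradiction.\<close>

lemma (in metacyclic) type_I: "type_I G"
  unfolding type_I_def
proof (intro conjI allI impI)
  show "group G" by (rule is_group)
  show "finite (carrier G)" by (rule finite_G)
  fix p :: nat and P assume p: "Factorial_Ring.prime p" and "sylow_subgroup p P G"
  define v where "v = multiplicity p (order G)"
  have P: "subgroup P G" "card P = p ^ v"
    using \<open>sylow_subgroup p P G\<close> by (auto simp: sylow_subgroup_def v_def)
  interpret P: group "G\<lparr>carrier := P\<rparr>"
    using P(1) by (rule subgroup_imp_group)
  have sub: "P \<subseteq> carrier G" using P(1) by (rule subgroup.subset)
  have finP: "finite P" using sub finite_G finite_subset by blast
  have ordP: "ord x dvd p ^ v" if "x \<in> P" for x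
  proof -
    have "x [^]\<^bsub>G\<lparr>carrier := P\<rparr>\<^esub> order (G\<lparr>carrier := P\<rparr>) = \<one>\<^bsub>G\<lparr>carrier := P\<rparr>\<^esub>"
      using that by (intro P.pow_order_eq_1) auto
    then have "x [^] card P = \<one>"
      by (simp add: order_def nat_pow_consistent[symmetric])
    then show ?thesis using that sub P by (auto simp: pow_eq_id)
  qed
  show "cyclic_group (G\<lparr>carrier := P\<rparr>)"
  proof (cases "\<exists>x\<in>P. ord x = p ^ v")
    case True
    then show ?thesis using cyclic_subgroup_if_ord_eq_card P finP by metis
  next
    case False
    \<comment> \<open>For v = 0 the identity already has order p^v.\<close>
    have v0: "v > 0"
      using False ordP subgroup.one_closed[OF P(1)] by (auto intro!: Nat.gr0I)
    define q where "q = p ^ (v - 1)"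
    have pv: "p ^ v = p * q" using v0 by (simp add: q_def power_eq_if)
    have q0: "q > 0" using p by (simp add: q_def prime_gt_0_nat)
    have xq: "x [^] q = \<one>" if x: "x \<in> P" for x
    proof -
      obtain k where k: "k \<le> v" "ord x = p ^ k"
        using ordP[OF x] p divides_primepow_nat by blast
      then have "k \<noteq> v" using False that by auto
      then have "ord x dvd q" using k by (auto simp: q_def intro: le_imp_power_dvd)
      then show ?thesis using that sub by (auto simp: pow_eq_id)
    qed
    have "p ^ v dvd m * n" using order_G multiplicity_dvd[of p "order G"] by (simp add: v_def)
    then have "p ^ v dvd m \<or> p ^ v dvd n"
    proof (cases "p dvd m")
      case True
      then have "\<not> p dvd n" using coprime_mn p coprime_common_divisor[of m n p] by auto
      then have "coprime (p ^ v) n" using p by (simp add: prime_imp_coprime)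
      then show ?thesis using \<open>p ^ v dvd m * n\<close> coprime_dvd_mult_left_iff by blast
    next
      case False
      then have "coprime (p ^ v) m" using p by (simp add: prime_imp_coprime)
      then show ?thesis using \<open>p ^ v dvd m * n\<close> coprime_dvd_mult_right_iff by blast
    qed
    then have "card P \<le> q"
    proof
      assume "p ^ v dvd m"
      then have qm: "q dvd m" using pv by (metis dvd_mult_right)
      have "P \<subseteq> (\<lambda>t. a [^] ((m div q) * t)) ` {..<q}"
      proof
        fix x assume x: "x \<in> P"
        then have "x [^] m = \<one>" using xq[OF x] qm x sub by (meson dvd_trans pow_eq_id subsetD)
        then obtain i where i: "i < m" "x = a [^] i" using pow_m_eq_one_iff x sub by blast
        have "m dvd i * q" using xq[OF x] i a by (simp add: nat_pow_pow pow_eq_id ord_a)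
        then have "(m div q) dvd i" using qm q0 by (auto elim!: dvdE)
        then obtain t where t: "i = (m div q) * t" by (elim dvdE)
        have "t < q" using i(1) t qm by (metis dvd_mult_div_cancel mult.commute nat_mult_less_cancel_disj)
        then show "x \<in> (\<lambda>t. a [^] ((m div q) * t)) ` {..<q}" using i t by auto
      qed
      then show ?thesis using card_mono[of "(\<lambda>t. a [^] ((m div q) * t)) ` {..<q}" P]
          card_image_le[of "{..<q}" "\<lambda>t. a [^] ((m div q) * t)"] by auto
    next
      assume pn: "p ^ v dvd n"
      then have qn: "q dvd n" using pv by (metis dvd_mult_right)
      have cop: "coprime m (p ^ v)" using coprime_mn pn by (meson coprime_divisors dvd_refl)
      have "\<exists>t<q. \<exists>i. x = a [^] (i::nat) \<otimes> b [^] ((n div q) * t)" if x: "x \<in> P" for x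
      proof -
        obtain i j where ij: "i < m" "j < n" "x = a [^] i \<otimes> b [^] j"
          using carrier_normal_form x sub by blast
        obtain s where "x [^] q = a [^] (s::nat) \<otimes> b [^] (j * q)"
          using pow_normal_form[of i j q] ij by auto
        then have "n dvd j * q" using xq[OF x] a_pow_b_pow_one(2) by simp
        then have "(n div q) dvd j" using qn q0 by (auto elim!: dvdE)
        then obtain t where t: "j = (n div q) * t" by (elim dvdE)
        have "t < q" using ij(2) t qn by (metis dvd_mult_div_cancel mult.commute nat_mult_less_cancel_disj)
        then show ?thesis using ij t by blast
      qed
      then obtain f where f: "\<And>x. x \<in> P \<Longrightarrow> f x < q \<and> (\<exists>i. x = a [^] (i::nat) \<otimes> b [^] ((n div q) * f x))"
        by metis
      \<comment> \<open>Two elements of \<open>P\<close> with the same \<open>b\<close>-part differ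
        by a power of \<open>a\<close>, whose order divides both \<open>m\<close> and p^v; these are
        coprime in this case.\<close>
      have "inj_on f P"
      proof (rule inj_onI)
        fix x y assume xy: "x \<in> P" "y \<in> P" "f x = f y"
        obtain i k where i: "x = a [^] (i::nat) \<otimes> b [^] ((n div q) * f x)"
           and k: "y = a [^] (k::nat) \<otimes> b [^] ((n div q) * f x)"
          using f[OF xy(1)] f[OF xy(2)] xy(3) by metis
        have cl: "x \<in> carrier G" "y \<in> carrier G" using xy sub by auto
        define c where "c = b [^] ((n div q) * f x)"
        have c: "c \<in> carrier G" using b by (simp add: c_def)
        have "x \<otimes> inv y = a [^] i \<otimes> inv (a [^] k)"
          using i k a c unfolding c_def[symmetric] by (simp add: inv_mult_group m_assoc inv_solve_left)
             (metis inv_closed l_inv m_assoc nat_pow_closed r_inv l_one)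
        also have "\<dots> = a [^] (int i - int k)"
          using a by (simp add: int_pow_diff int_pow_int)
        finally have *: "x \<otimes> inv y = a [^] (int i - int k)" .
        then have "(x \<otimes> inv y) [^] m = \<one>"
          using a ord_a by (metis int_pow_int int_pow_pow int_pow_closed int_pow_eq_id dvd_triv_right)
        moreover have xyP: "x \<otimes> inv y \<in> P" using xy P(1) by (simp add: subgroup.m_closed subgroup.m_inv_closed)
        ultimately have "ord (x \<otimes> inv y) dvd m" using sub by (metis pow_eq_id subsetD)
        then have "ord (x \<otimes> inv y) = 1" using ordP[OF xyP] cop by (metis coprime_common_divisor_nat)
        then have "x \<otimes> inv y = \<one>" using ord_eq_1 xyP sub by blast
        then show "x = y" using cl by (metis inv_closed inv_equality inv_inv)
      qed
      then have "card P = card (f ` P)" by (simp add: card_image)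
      also have "\<dots> \<le> card {..<q}" using f by (intro card_mono) auto
      finally show ?thesis by simp
    qed
    then have "p * q \<le> q" using P pv by simp
    then have False using q0 p prime_gt_1_nat[of p] by simp
    then show ?thesis ..
  qed
qed

section \<open>Transfer of the structure to other groups\<close>

lemma metacyclic_iso:
  assumes "metacyclic G m n r a b" "h \<in> iso G H" "group H"
  shows "metacyclic H m n r (h a) (h b)"
proof -
  interpret G: metacyclic G m n r a b by fact
  interpret H: group H by fact
  have hom: "h \<in> hom G H" and bij: "bij_betw h (carrier G) (carrier H)"
    using assms(2) by (auto simp: iso_def)
  interpret h: group_hom G H h
    by unfold_locales (use hom in \<open>auto simp: hom_def\<close>)
  have inj: "inj_on h (carrier G)" using bij by (simp add: bij_betw_def)
  have ord: "H.ord (h x) = G.ord x" if "x \<in> carrier G" for x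
  proof -
    have "h x [^]\<^bsub>H\<^esub> k = \<one>\<^bsub>H\<^esub> \<longleftrightarrow> x [^]\<^bsub>G\<^esub> k = \<one>\<^bsub>G\<^esub>" for k :: nat
      using that inj by (metis G.nat_pow_closed G.one_closed h.hom_nat_pow h.hom_one inj_onD)
    then show ?thesis using that by (metis G.pow_eq_id H.ord_unique h.hom_closed)
  qed
  show ?thesis
  proof unfold_locales
    show "h a \<in> carrier H" "h b \<in> carrier H" using G.a G.b by auto
    show "h b \<otimes>\<^bsub>H\<^esub> h a \<otimes>\<^bsub>H\<^esub> inv\<^bsub>H\<^esub> h b = h a [^]\<^bsub>H\<^esub> r"
      using G.a G.b G.conj by (metis G.inv_closed G.m_closed h.hom_inv h.hom_mult h.hom_nat_pow)
    show "H.ord (h a) = m" "H.ord (h b) = n" using ord G.a G.b G.ord_a G.ord_b by auto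
    show "order H = m * n" using G.order_G bij_betw_same_card[OF bij] by (simp add: order_def)
  qed (use G.coprime_mn G.m_pos G.n_pos in auto)
qed

text \<open>The subgroup generated by \<open>a\<close> is characteristic: it consists of the solutions of $x^m = 1$, so
  its counterpart in a group with the same order statistics is normal as well.\<close>

lemma metacyclic_if_same_ord_counts:
  assumes "metacyclic G m n r a b" "group H" "finite (carrier H)" "order H = order G"
    and cnt: "\<And>e. card {x \<in> carrier H. group.ord H x = e} = card {x \<in> carrier G. group.ord G x = e}"
  shows "\<exists>s a' b'. s > 0 \<and> metacyclic H m n s a' b'"
proof -
  interpret G: metacyclic G m n r a b by fact
  interpret H: group H by fact
  have ex: "\<exists>y\<in>carrier H. H.ord y = G.ord x" if "x \<in> carrier G" for x
  proof -
    have "card {y \<in> carrier G. G.ord y = G.ord x} > 0"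
      using that G.finite_G by (subst card_gt_0_iff) auto
    then have "card {y \<in> carrier H. H.ord y = G.ord x} > 0" by (simp add: cnt)
    then show ?thesis by (auto simp: card_gt_0_iff)
  qed
  obtain a' where a': "a' \<in> carrier H" "H.ord a' = m" using ex[OF G.a] G.ord_a by auto
  obtain b' where b': "b' \<in> carrier H" "H.ord b' = n" using ex[OF G.b] G.ord_b by auto
  \<comment> \<open>Stated for an arbitrary group so as to apply to \<open>G\<close> and to
    \<open>H\<close>: the number of solutions of x^m = 1 depends only on the order counts.\<close>
  have sols: "card {x \<in> carrier K. x [^]\<^bsub>K\<^esub> m = \<one>\<^bsub>K\<^esub>} = (\<Sum>e | e dvd m. card {x \<in> carrier K. group.ord K x = e})"
    if "group K" "finite (carrier K)" for K :: "('z, 'w) monoid_scheme"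
  proof -
    interpret K: group K by fact
    have "{x \<in> carrier K. x [^]\<^bsub>K\<^esub> m = \<one>\<^bsub>K\<^esub>} = (\<Union>e\<in>{e. e dvd m}. {x \<in> carrier K. K.ord x = e})"
      by (auto simp: K.pow_eq_id)
    then show ?thesis
      using that G.m_pos by (simp add: card_UN_disjoint disjoint_iff)
  qed
  have cardm: "card {x \<in> carrier H. x [^]\<^bsub>H\<^esub> m = \<one>\<^bsub>H\<^esub>} = m"
    using sols[OF H.is_group assms(3)] sols[OF G.is_group G.finite_G] G.card_pow_m_eq_one cnt by simp
  have "(\<lambda>i::nat. a' [^]\<^bsub>H\<^esub> i) ` {..<m} = {x \<in> carrier H. x [^]\<^bsub>H\<^esub> m = \<one>\<^bsub>H\<^esub>}"
  proof (rule card_subset_eq)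
    show "finite {x \<in> carrier H. x [^]\<^bsub>H\<^esub> m = \<one>\<^bsub>H\<^esub>}" using assms(3) by simp
    show "(\<lambda>i::nat. a' [^]\<^bsub>H\<^esub> i) ` {..<m} \<subseteq> {x \<in> carrier H. x [^]\<^bsub>H\<^esub> m = \<one>\<^bsub>H\<^esub>}"
      using a' by (auto simp: H.nat_pow_pow H.pow_eq_id)
    have "inj_on (\<lambda>i::nat. a' [^]\<^bsub>H\<^esub> i) {0..H.ord a' - 1}" using H.ord_inj assms(3) a' by blast
    moreover have "{0..H.ord a' - 1} = {..<m}" using a' G.m_pos by auto
    ultimately show "card ((\<lambda>i::nat. a' [^]\<^bsub>H\<^esub> i) ` {..<m}) = card {x \<in> carrier H. x [^]\<^bsub>H\<^esub> m = \<one>\<^bsub>H\<^esub>}"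
      by (simp add: cardm card_image)
  qed
  moreover
  let ?c = "b' \<otimes>\<^bsub>H\<^esub> a' \<otimes>\<^bsub>H\<^esub> inv\<^bsub>H\<^esub> b'"
  have "?c [^]\<^bsub>H\<^esub> k = b' \<otimes>\<^bsub>H\<^esub> a' [^]\<^bsub>H\<^esub> k \<otimes>\<^bsub>H\<^esub> inv\<^bsub>H\<^esub> b'" for k :: nat
  proof (induction k)
    case (Suc k)
    then show ?case using a' b'
      by (simp add: H.m_assoc) (metis H.inv_closed H.l_inv H.l_one H.m_assoc H.m_closed H.nat_pow_closed)
  qed (use a' b' in simp)
  then have "?c [^]\<^bsub>H\<^esub> m = \<one>\<^bsub>H\<^esub>" using a' b' H.pow_ord_eq_1[OF a'(1)] by simp
  ultimately obtain i :: nat where i: "?c = a' [^]\<^bsub>H\<^esub> i" using a' b' by blast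
  \<comment> \<open>Adding \<open>m\<close> to the exponent does not change the power of a' and
    makes the parameter positive even if \<open>i\<close> is 0.\<close>
  have "metacyclic H m n (i + m) a' b'"
  proof unfold_locales
    show "?c = a' [^]\<^bsub>H\<^esub> (i + m)"
      using i a' H.pow_ord_eq_1[OF a'(1)] by (simp add: H.nat_pow_mult[symmetric])
  qed (use a' b' assms(4) G.order_G G.coprime_mn G.m_pos G.n_pos in auto)
  then show ?thesis using G.m_pos by (intro exI[of _ "i + m"]) auto
qed

section \<open>The presentation\<close>

primrec word_eval :: "('g, 'z) monoid_scheme \<Rightarrow> ('x \<Rightarrow> 'g) \<Rightarrow> 'x word \<Rightarrow> 'g" where
  "word_eval G f [] = \<one>\<^bsub>G\<^esub>"
| "word_eval G f (l # w) = (if snd l then f (fst l) else inv\<^bsub>G\<^esub> f (fst l)) \<otimes>\<^bsub>G\<^esub> word_eval G f w"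

lemma (in group) word_eval_closed:
  "(\<And>x. f x \<in> carrier G) \<Longrightarrow> word_eval G f w \<in> carrier G"
  by (induction w) auto

lemma (in group) word_eval_append:
  "(\<And>x. f x \<in> carrier G) \<Longrightarrow> word_eval G f (v @ w) = word_eval G f v \<otimes> word_eval G f w"
  by (induction v) (auto simp: word_eval_closed m_assoc)

lemma (in group) word_eval_replicate:
  "f x \<in> carrier G \<Longrightarrow> word_eval G f (replicate k (x, True)) = f x [^] k"
  by (induction k) (simp_all only: replicate_0 replicate_Suc word_eval.simps nat_pow_0 nat_pow_Suc2
      fst_conv snd_conv if_True)

text \<open>The universal property of the presentation: evaluation descends to classes of words as
  soon as the relations hold in \<open>G\<close>.\<close>

lemma (in group) word_eval_word_eq:
  assumes "word_eq R u v" "\<And>x. f x \<in> carrier G"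
    and "\<And>u v. (u, v) \<in> R \<Longrightarrow> word_eval G f u = word_eval G f v"
  shows "word_eval G f u = word_eval G f v"
  using assms(1)
proof induction
  case (cancel x b)
  then show ?case using assms(2)[of x] by (cases b) auto
qed (use assms in \<open>auto simp: word_eval_append\<close>)

text \<open>The relations bring every word to the form \<alpha>^i \<beta>^j, so the presented group
  has at most \<open>m * n\<close> elements. Evaluation of words maps it onto \<open>G\<close>,
  which has exactly that many, and is therefore bijective.\<close>

lemma metacyclic_iso_Gamma_group:
  assumes "metacyclic G m n r a b"
  shows "Gamma_group m n r \<cong> G"
proof -
  interpret metacyclic G m n r a b by fact
  define R where "R = {(replicate m (Gen_A, True), []), (replicate n (Gen_B, True), []),
      ([(Gen_B, True), (Gen_A, True), (Gen_B, False)], replicate r (Gen_A, True))}"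
  define P where "P = presented_group R"
  define cl where "cl u = Collect (word_eq R u)" for u
  have P_Gamma: "Gamma_group m n r = P" by (simp add: Gamma_group_def P_def R_def)
  interpret P: group P unfolding P_def by (rule group_presented_group)
  have carr: "carrier P = range cl" and one: "\<one>\<^bsub>P\<^esub> = cl []"
    by (auto simp: P_def presented_group_def cl_def)
  have mult: "cl u \<otimes>\<^bsub>P\<^esub> cl v = cl (u @ v)" for u v
    by (simp add: P_def cl_def presented_group_mult)
  have cl_eq: "cl u = cl v" if "word_eq R u v" for u v
    using that by (auto simp: cl_def intro: word_eq.trans word_eq.sym)
  define \<alpha> where "\<alpha> = cl [(Gen_A, True)]"
  define \<beta> where "\<beta> = cl [(Gen_B, True)]"
  have \<alpha>: "\<alpha> \<in> carrier P" and \<beta>: "\<beta> \<in> carrier P" by (auto simp: \<alpha>_def \<beta>_def carr)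
  have inv_cl: "inv\<^bsub>P\<^esub> cl [(x, True)] = cl [(x, False)]" for x
  proof (rule P.inv_equality)
    show "cl [(x, False)] \<otimes>\<^bsub>P\<^esub> cl [(x, True)] = \<one>\<^bsub>P\<^esub>"
      using word_eq.cancel[of R x False] by (simp add: mult one cl_eq)
  qed (auto simp: carr)
  have rep: "cl (replicate k (x, True)) = cl [(x, True)] [^]\<^bsub>P\<^esub> k" for k x
  proof (induction k)
    case (Suc k)
    have "cl (replicate (Suc k) (x, True)) = cl [(x, True)] \<otimes>\<^bsub>P\<^esub> cl (replicate k (x, True))"
      by (simp add: mult)
    then show ?case using Suc P.nat_pow_Suc2[of "cl [(x, True)]" k] carr by auto
  qed (simp add: one)
  have \<alpha>m: "\<alpha> [^]\<^bsub>P\<^esub> m = \<one>\<^bsub>P\<^esub>" and \<beta>n: "\<beta> [^]\<^bsub>P\<^esub> n = \<one>\<^bsub>P\<^esub>"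
    unfolding \<alpha>_def \<beta>_def rep[symmetric] one by (auto intro!: cl_eq word_eq.rel simp: R_def)
  have conjP: "\<beta> \<otimes>\<^bsub>P\<^esub> \<alpha> \<otimes>\<^bsub>P\<^esub> inv\<^bsub>P\<^esub> \<beta> = \<alpha> [^]\<^bsub>P\<^esub> r"
    unfolding \<alpha>_def \<beta>_def rep[symmetric] inv_cl mult by (auto intro!: cl_eq word_eq.rel simp: R_def)
  interpret P: power_conjugation P r \<alpha> \<beta>
    by unfold_locales (use \<alpha> \<beta> conjP in auto)
  have modA: "\<alpha> [^]\<^bsub>P\<^esub> (i::nat) = \<alpha> [^]\<^bsub>P\<^esub> (i mod m)" for i
  proof -
    have "\<alpha> [^]\<^bsub>P\<^esub> (m * (i div m) + i mod m) = (\<alpha> [^]\<^bsub>P\<^esub> m) [^]\<^bsub>P\<^esub> (i div m) \<otimes>\<^bsub>P\<^esub> \<alpha> [^]\<^bsub>P\<^esub> (i mod m)"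
      using \<alpha> by (simp only: P.nat_pow_pow P.nat_pow_mult)
    then show ?thesis using \<alpha> \<alpha>m by simp
  qed
  have modB: "\<beta> [^]\<^bsub>P\<^esub> (i::nat) = \<beta> [^]\<^bsub>P\<^esub> (i mod n)" for i
  proof -
    have "\<beta> [^]\<^bsub>P\<^esub> (n * (i div n) + i mod n) = (\<beta> [^]\<^bsub>P\<^esub> n) [^]\<^bsub>P\<^esub> (i div n) \<otimes>\<^bsub>P\<^esub> \<beta> [^]\<^bsub>P\<^esub> (i mod n)"
      using \<beta> by (simp only: P.nat_pow_pow P.nat_pow_mult)
    then show ?thesis using \<beta> \<beta>n by simp
  qed
  define S where "S = (\<lambda>(i::nat, j::nat). \<alpha> [^]\<^bsub>P\<^esub> i \<otimes>\<^bsub>P\<^esub> \<beta> [^]\<^bsub>P\<^esub> j) ` ({..<m} \<times> {..<n})"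
  have S: "\<alpha> [^]\<^bsub>P\<^esub> (i::nat) \<otimes>\<^bsub>P\<^esub> \<beta> [^]\<^bsub>P\<^esub> (j::nat) \<in> S" for i j
    unfolding S_def using modA[of i] modB[of j] m_pos n_pos
    by (intro image_eqI[of _ _ "(i mod m, j mod n)"]) auto
  \<comment> \<open>Inverse letters are positive powers because the generators have finite order;
    natural exponents therefore suffice for all words.\<close>
  have invA: "inv\<^bsub>P\<^esub> \<alpha> = \<alpha> [^]\<^bsub>P\<^esub> (m - 1) \<otimes>\<^bsub>P\<^esub> \<beta> [^]\<^bsub>P\<^esub> (0::nat)"
    using \<alpha> \<alpha>m m_pos P.nat_pow_Suc[of \<alpha> "m - 1"] by (intro P.inv_equality) auto
  have invB: "inv\<^bsub>P\<^esub> \<beta> = \<alpha> [^]\<^bsub>P\<^esub> (0::nat) \<otimes>\<^bsub>P\<^esub> \<beta> [^]\<^bsub>P\<^esub> (n - 1)"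
    using \<beta> \<beta>n n_pos P.nat_pow_Suc[of \<beta> "n - 1"] by (intro P.inv_equality) auto
  have letter: "\<exists>i j. cl [l] = \<alpha> [^]\<^bsub>P\<^esub> (i::nat) \<otimes>\<^bsub>P\<^esub> \<beta> [^]\<^bsub>P\<^esub> (j::nat)" for l
  proof -
    have 1: "\<alpha> = \<alpha> [^]\<^bsub>P\<^esub> (1::nat) \<otimes>\<^bsub>P\<^esub> \<beta> [^]\<^bsub>P\<^esub> (0::nat)" using \<alpha> by simp
    have 2: "\<beta> = \<alpha> [^]\<^bsub>P\<^esub> (0::nat) \<otimes>\<^bsub>P\<^esub> \<beta> [^]\<^bsub>P\<^esub> (1::nat)" using \<beta> by simp
    obtain x s where l: "l = (x, s)" by force
    show ?thesis
    proof (cases x; cases s)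
      assume "x = Gen_A" "s" then show ?thesis using 1 l \<alpha>_def by metis
    next
      assume "x = Gen_B" "s" then show ?thesis using 2 l \<beta>_def by metis
    next
      assume "x = Gen_A" "\<not> s" then show ?thesis using invA l inv_cl[of Gen_A] \<alpha>_def by metis
    next
      assume "x = Gen_B" "\<not> s" then show ?thesis using invB l inv_cl[of Gen_B] \<beta>_def by metis
    qed
  qed
  have nf: "\<exists>i j. cl w = \<alpha> [^]\<^bsub>P\<^esub> (i::nat) \<otimes>\<^bsub>P\<^esub> \<beta> [^]\<^bsub>P\<^esub> (j::nat)" for w
  proof (induction w)
    case Nil
    have "cl [] = \<alpha> [^]\<^bsub>P\<^esub> (0::nat) \<otimes>\<^bsub>P\<^esub> \<beta> [^]\<^bsub>P\<^esub> (0::nat)" by (simp add: one mult)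
    then show ?case by metis
  next
    case (Cons l w)
    then obtain i j where ij: "cl w = \<alpha> [^]\<^bsub>P\<^esub> (i::nat) \<otimes>\<^bsub>P\<^esub> \<beta> [^]\<^bsub>P\<^esub> (j::nat)" by metis
    obtain i' j' where l: "cl [l] = \<alpha> [^]\<^bsub>P\<^esub> (i'::nat) \<otimes>\<^bsub>P\<^esub> \<beta> [^]\<^bsub>P\<^esub> (j'::nat)" using letter by metis
    have "cl (l # w) = cl [l] \<otimes>\<^bsub>P\<^esub> cl w" by (simp add: mult)
    then show ?case unfolding ij l P.mult_normal_form by metis
  qed
  have "carrier P \<subseteq> S" using nf S unfolding carr by (metis image_subsetI)
  moreover have "finite S" by (simp add: S_def)
  moreover have "card S \<le> m * n"
    unfolding S_def using card_image_le[of "{..<m} \<times> {..<n}"] by simp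
  ultimately have cardP: "finite (carrier P)" "card (carrier P) \<le> m * n"
    by (auto intro: finite_subset dest: card_mono)
  define f where "f = case_gamma_gen a b"
  have f: "f x \<in> carrier G" for x using a b by (cases x) (auto simp: f_def)
  have rels: "word_eval G f u = word_eval G f v" if "(u, v) \<in> R" for u v
    using that a b conj pow_ord_eq_1[OF a] pow_ord_eq_1[OF b] word_eval_replicate[of f, OF f]
    by (auto simp: R_def f_def ord_a ord_b m_assoc)
  \<comment> \<open>A representative is chosen; evaluation does not depend on it because it respects
    the relations.\<close>
  define h where "h X = word_eval G f (SOME u. u \<in> X)" for X
  have h: "h (cl u) = word_eval G f u" for u
  proof -
    have "u \<in> cl u" by (simp add: cl_def word_eq.refl)
    then have "(SOME v. v \<in> cl u) \<in> cl u" by (rule someI)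
    then show ?thesis
      using word_eval_word_eq[of R u _ f, OF _ f rels] by (simp add: h_def cl_def)
  qed
  have hom: "h \<in> hom P G"
    by (auto simp: hom_def carr h mult word_eval_closed f word_eval_append)
  have surj: "h ` carrier P = carrier G"
  proof
    show "h ` carrier P \<subseteq> carrier G" using hom by (auto simp: hom_def)
    show "carrier G \<subseteq> h ` carrier P"
    proof
      fix x assume "x \<in> carrier G"
      then obtain i j where x: "x = a [^]\<^bsub>G\<^esub> (i::nat) \<otimes>\<^bsub>G\<^esub> b [^]\<^bsub>G\<^esub> (j::nat)" using carrier_normal_form by metis
      have "x = h (cl (replicate i (Gen_A, True) @ replicate j (Gen_B, True)))"
        using f[of Gen_A] f[of Gen_B]
        by (simp add: h x word_eval_append f word_eval_replicate) (simp add: f_def)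
      then show "x \<in> h ` carrier P" using carr by blast
    qed
  qed
  have "card (carrier P) = m * n"
    using surj cardP card_image_le[OF cardP(1), of h] order_G by (simp add: order_def)
  then have "inj_on h (carrier P)"
    using surj cardP order_G by (intro eq_card_imp_inj_on) (auto simp: order_def)
  then have "h \<in> iso P G" using hom surj by (simp add: iso_def bij_betw_def)
  then show ?thesis unfolding P_Gamma is_iso_def by blast
qed

text \<open>The semidirect product of Z/m by Z/n in which the generator of Z/n acts as
  multiplication by \<open>r\<close>. It guarantees that the relations do not collapse the presented
  group below \<open>m * n\<close> elements.\<close>

lemma exists_metacyclic:
  assumes "m > 0" "n > 0" "coprime m n" "[r ^ n = 1] (mod m)"
  shows "\<exists>(G::(nat \<times> nat) monoid) a b. metacyclic G m n r a b"
proof -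
  define G :: "(nat \<times> nat) monoid" where
    "G = \<lparr>carrier = {..<m} \<times> {..<n},
          mult = (\<lambda>(i, j) (k, l). ((i + r ^ j * k) mod m, (j + l) mod n)), one = (0, 0)\<rparr>"
  have rmod: "[r ^ (j mod n) = r ^ j] (mod m)" for j
  proof -
    have "[(r ^ n) ^ (j div n) * r ^ (j mod n) = 1 ^ (j div n) * r ^ (j mod n)] (mod m)"
      using assms(4) by (intro cong_mult cong_pow) auto
    then have "[r ^ j = r ^ (j mod n)] (mod m)"
      by (simp add: power_mult[symmetric] power_add[symmetric])
    then show ?thesis by (rule cong_sym)
  qed
  have "group G"
  proof (rule groupI)
    fix x assume "x \<in> carrier G"
    then obtain i j where x: "x = (i, j)" "i < m" "j < n" by (auto simp: G_def)
    show "\<exists>y\<in>carrier G. y \<otimes>\<^bsub>G\<^esub> x = \<one>\<^bsub>G\<^esub>"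
    proof
      \<comment> \<open>The inverse of (i, j) has second entry -j and first entry -(r^(-j) i). The
        outer reductions cover \<open>j = 0\<close> and \<open>k mod m = 0\<close>, where the
        differences are \<open>n\<close> and \<open>m\<close> themselves.\<close>
      define k where "k = r ^ ((n - j) mod n) * i"
      let ?y = "((m - k mod m) mod m, (n - j) mod n)"
      show "?y \<in> carrier G" using assms by (simp add: G_def)
      have "((m - k mod m) mod m + k) mod m = ((m - k mod m) + k mod m) mod m"
        by (metis mod_add_left_eq mod_add_right_eq)
      also have "\<dots> = 0" using assms(1) by (simp add: less_imp_le)
      finally show "?y \<otimes>\<^bsub>G\<^esub> x = \<one>\<^bsub>G\<^esub>"
        using x by (simp add: G_def k_def mod_add_left_eq)
    qed
    fix y assume "y \<in> carrier G"
    then obtain k l where y: "y = (k, l)" "k < m" "l < n" by (auto simp: G_def)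
    show "x \<otimes>\<^bsub>G\<^esub> y \<in> carrier G" using x y assms by (simp add: G_def)
    fix z assume "z \<in> carrier G"
    then obtain p q where z: "z = (p, q)" "p < m" "q < n" by (auto simp: G_def)
    have "[i + r ^ j * k + r ^ ((j + l) mod n) * p = i + r ^ j * k + r ^ (j + l) * p] (mod m)"
      by (intro cong_add cong_mult rmod cong_refl)
    moreover have "i + r ^ j * k + r ^ (j + l) * p = i + r ^ j * (k + r ^ l * p)"
      by (simp add: algebra_simps power_add)
    ultimately have "(i + r ^ j * k + r ^ ((j + l) mod n) * p) mod m = (i + r ^ j * (k + r ^ l * p)) mod m"
      by (simp only: cong_def)
    also have "\<dots> = (i + r ^ j * ((k + r ^ l * p) mod m)) mod m"
      by (metis mod_add_right_eq mod_mult_right_eq)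
    finally have "((i + r ^ j * k) mod m + r ^ ((j + l) mod n) * p) mod m
        = (i + r ^ j * ((k + r ^ l * p) mod m)) mod m"
      by (simp only: mod_add_left_eq)
    then show "x \<otimes>\<^bsub>G\<^esub> y \<otimes>\<^bsub>G\<^esub> z = x \<otimes>\<^bsub>G\<^esub> (y \<otimes>\<^bsub>G\<^esub> z)"
      using x y z by (simp add: G_def mod_add_left_eq mod_add_right_eq add.assoc)
  qed (use assms in \<open>auto simp: G_def\<close>)
  then interpret group G .
  \<comment> \<open>The entries are reduced because \<open>m\<close> or \<open>n\<close> may be
    1.\<close>
  define a where "a = (1 mod m, 0::nat)"
  define b where "b = (0::nat, 1 mod n)"
  have a: "a \<in> carrier G" and b: "b \<in> carrier G" using assms by (auto simp: a_def b_def G_def)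
  have apow: "a [^]\<^bsub>G\<^esub> k = (k mod m, 0)" for k :: nat
    by (induction k) (auto simp: a_def G_def mod_simps)
  have bpow: "b [^]\<^bsub>G\<^esub> k = (0, k mod n)" for k :: nat
    by (induction k) (auto simp: b_def G_def mod_simps)
  have ba: "b \<otimes>\<^bsub>G\<^esub> a = a [^]\<^bsub>G\<^esub> r \<otimes>\<^bsub>G\<^esub> b"
    using rmod[of 1] unfolding apow by (auto simp: a_def b_def G_def mod_simps cong_def)
  have "metacyclic G m n r a b"
  proof unfold_locales
    show "b \<otimes>\<^bsub>G\<^esub> a \<otimes>\<^bsub>G\<^esub> inv\<^bsub>G\<^esub> b = a [^]\<^bsub>G\<^esub> r"
      unfolding ba using a b by (simp add: m_assoc)
    have one: "\<one>\<^bsub>G\<^esub> = (0, 0)" by (simp add: G_def)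
    show "ord a = m" using ord_unique[OF a, of m] by (simp add: apow one dvd_eq_mod_eq_0)
    show "ord b = n" using ord_unique[OF b, of n] by (simp add: bpow one dvd_eq_mod_eq_0)
    show "order G = m * n" by (simp add: order_def G_def)
  qed (use assms a b in auto)
  then show ?thesis by blast
qed

text \<open>The conjugation exponent \<open>s\<close> found in \<open>H\<close> is only known to be
  positive. Its standing conditions come from the comparison with \<open>r\<close>: equality of the
  greatest common divisors for c = 1 gives gcd (s - 1) m = 1, and congruences modulo
  \<open>m\<close> itself give the same multiplicative order \<open>d\<close>.\<close>

theorem Gamma_group_order_statistics:
  assumes "group G" "group H" "finite (carrier H)" "order H = order G"
    and cnt: "\<And>e. card {x \<in> carrier H. group.ord H x = e} = card {x \<in> carrier G. group.ord G x = e}"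
    and params: "Gamma_params d m n r" and iso: "G \<cong> Gamma_group m n r"
  shows "type_I H \<and> (\<exists>s. Gamma_params d m n s \<and> H \<cong> Gamma_group m n s \<and>
    (\<forall>c. c > 0 \<and> c dvd d \<longrightarrow> gcd (r ^ c - 1) m = gcd (s ^ c - 1) m))"
proof -
  have p: "m > 0" "n > 0" "r > 0" "[r ^ n = 1] (mod m)" "d = Pocklington.ord m r"
    and g1: "gcd ((r - 1) * n) m = 1"
    using params by (auto simp: Gamma_params_def)
  have cop: "coprime m n" using g1
    by (metis coprime_commute coprime_iff_gcd_eq_1 coprime_mult_left_iff)
  \<comment> \<open>The orders of the generators cannot be read off the relations directly. The
    concrete model \<open>K\<close> has them by construction, and its generators are carried over to
    \<open>G\<close>.\<close>
  obtain K :: "(nat \<times> nat) monoid" and a0 b0 where K: "metacyclic K m n r a0 b0"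
    using exists_metacyclic[OF p(1,2) cop p(4)] by blast
  interpret K: metacyclic K m n r a0 b0 by (rule K)
  have "Gamma_group m n r \<cong> K" using metacyclic_iso_Gamma_group[OF K] .
  then have "G \<cong> K" using iso iso_trans by blast
  then have "K \<cong> G" using group.iso_sym assms(1) by blast
  then obtain h where "h \<in> iso K G" by (auto simp: is_iso_def)
  then have G: "metacyclic G m n r (h a0) (h b0)" using metacyclic_iso[OF K] assms(1) by blast
  interpret G: metacyclic G m n r "h a0" "h b0" by (rule G)
  obtain s a b where s: "s > 0" and H: "metacyclic H m n s a b"
    using metacyclic_if_same_ord_counts[OF G assms(2,3,4) cnt] by blast
  interpret H: metacyclic H m n s a b by (rule H)
  have ex: "(\<exists>x\<in>carrier H. H.ord x = e) \<longleftrightarrow> (\<exists>x\<in>carrier G. G.ord x = e)" for e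
  proof -
    have "{x \<in> carrier H. H.ord x = e} = {} \<longleftrightarrow> {x \<in> carrier G. G.ord x = e} = {}"
      using cnt[of e] assms(3) G.finite_G card_0_eq[of "{x \<in> carrier H. H.ord x = e}"]
        card_0_eq[of "{x \<in> carrier G. G.ord x = e}"] by simp
    then show ?thesis by blast
  qed
  have key: "[s ^ c = 1] (mod e) \<longleftrightarrow> [r ^ c = 1] (mod e)" if "e dvd m" "c dvd n" for e c
    using that H.cong_one_iff_exists_ord G.cong_one_iff_exists_ord ex by simp
  have cong_dvd: "[t ^ c = 1] (mod e) \<longleftrightarrow> e dvd t ^ c - 1" if "t > 0" for t c e :: nat
    using that by (simp add: cong_altdef_nat)
  \<comment> \<open>Each of the two divisors is itself used as the modulus \<open>e\<close> in
    \<open>key\<close>. Positivity of \<open>r\<close> and \<open>s\<close> turns congruences into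
    divisibility of natural differences.\<close>
  have gcd_eq: "gcd (r ^ c - 1) m = gcd (s ^ c - 1) m" if "c dvd n" for c
  proof (rule dvd_antisym)
    show "gcd (r ^ c - 1) m dvd gcd (s ^ c - 1) m"
      using key[OF _ that, of "gcd (r ^ c - 1) m"] cong_dvd[OF p(3)] cong_dvd[OF s] by simp
    show "gcd (s ^ c - 1) m dvd gcd (r ^ c - 1) m"
      using key[OF _ that, of "gcd (s ^ c - 1) m"] cong_dvd[OF p(3)] cong_dvd[OF s] by simp
  qed
  have "gcd (r - 1) m = 1"
    using g1 by (metis coprime_iff_gcd_eq_1 coprime_mult_left_iff)
  then have "gcd (s - 1) m = 1"
    using gcd_eq[of 1] by simp
  then have "gcd ((s - 1) * n) m = 1"
    using cop by (metis coprime_iff_gcd_eq_1 coprime_mult_left_iff coprime_commute)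
  have dn: "d dvd n" using p by (simp add: ord_divides[symmetric])
  have sn: "[s ^ n = 1] (mod m)" by (rule H.r_pow_n)
  have "Pocklington.ord m s = d"
  proof (rule dvd_antisym)
    have "[r ^ d = 1] (mod m)" using p(5) by (simp only: ord_divides dvd_refl)
    then have "[s ^ d = 1] (mod m)" using key[OF dvd_refl dn] by simp
    then show "Pocklington.ord m s dvd d" by (simp only: ord_divides)
    have "Pocklington.ord m s dvd n" using sn by (simp only: ord_divides)
    moreover have "[s ^ Pocklington.ord m s = 1] (mod m)" by (simp only: ord_divides dvd_refl)
    ultimately have "[r ^ Pocklington.ord m s = 1] (mod m)" using key[OF dvd_refl] by simp
    then show "d dvd Pocklington.ord m s" by (simp only: ord_divides p(5))
  qed
  then have "Gamma_params d m n s"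
    unfolding Gamma_params_def using p s sn \<open>gcd ((s - 1) * n) m = 1\<close> by auto
  moreover have "H \<cong> Gamma_group m n s"
    using metacyclic_iso_Gamma_group[OF H] group_presented_group group.iso_sym
    unfolding Gamma_group_def by blast
  moreover have "\<forall>c. c > 0 \<and> c dvd d \<longrightarrow> gcd (r ^ c - 1) m = gcd (s ^ c - 1) m"
    using gcd_eq dn dvd_trans by blast
  ultimately show ?thesis using H.type_I by blast
qed

section \<open>Homogeneous polynomials in a family of functions\<close>

definition multi_indices :: "nat \<Rightarrow> ('n::finite \<Rightarrow> nat) set" where
  "multi_indices k = {\<alpha>. sum \<alpha> UNIV = k}"

definition monomial :: "('n::finite \<Rightarrow> 'x \<Rightarrow> 'f::field) \<Rightarrow> ('n \<Rightarrow> nat) \<Rightarrow> 'x \<Rightarrow> 'f" where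
  "monomial l \<alpha> x = (\<Prod>i\<in>UNIV. l i x ^ \<alpha> i)"

text \<open>Forms of degree k in the functions \<open>l i\<close>. Keeping \<open>l\<close> variable
  treats real coordinates, complex coordinates and the eigenforms of a group element alike.\<close>

definition hom_polys :: "('n::finite \<Rightarrow> 'x \<Rightarrow> 'f::field) \<Rightarrow> nat \<Rightarrow> ('x \<Rightarrow> 'f) set" where
  "hom_polys l k = {p. \<exists>u. \<forall>x. p x = (\<Sum>\<alpha>\<in>multi_indices k. u \<alpha> * monomial l \<alpha> x)}"

lemma finite_multi_indices [simp]: "finite (multi_indices k :: ('n::finite \<Rightarrow> nat) set)"
proof -
  have "\<alpha> i \<le> k" if "\<alpha> \<in> multi_indices k" for \<alpha> :: "'n \<Rightarrow> nat" and i
    using that member_le_sum[of i UNIV \<alpha>] by (simp add: multi_indices_def)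
  then have "multi_indices k \<subseteq> PiE UNIV (\<lambda>_::'n. {..k})" by auto
  then show ?thesis by (rule finite_subset) (intro finite_PiE, auto)
qed

lemma hom_polys_monomial:
  assumes "\<alpha> \<in> multi_indices k" shows "monomial l \<alpha> \<in> hom_polys l k"
proof -
  have "monomial l \<alpha> x = (\<Sum>\<beta>\<in>multi_indices k. (if \<beta> = \<alpha> then 1 else 0) * monomial l \<beta> x)" for x
    using assms by (simp add: if_distrib [of "\<lambda>c. c * _"] cong: if_cong)
  then show ?thesis unfolding hom_polys_def by (intro CollectI exI[of _ "\<lambda>\<beta>. if \<beta> = \<alpha> then 1 else 0"]) blast
qed

lemma hom_polys_zero [simp]: "(\<lambda>x. 0) \<in> hom_polys l k"
  unfolding hom_polys_def by (auto intro!: exI[of _ "\<lambda>_. 0"])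

lemma hom_polys_add:
  assumes "p \<in> hom_polys l k" "q \<in> hom_polys l k" shows "(\<lambda>x. p x + q x) \<in> hom_polys l k"
proof -
  obtain u v where "\<And>x. p x = (\<Sum>\<alpha>\<in>multi_indices k. u \<alpha> * monomial l \<alpha> x)"
     "\<And>x. q x = (\<Sum>\<alpha>\<in>multi_indices k. v \<alpha> * monomial l \<alpha> x)"
    using assms unfolding hom_polys_def by auto
  then show ?thesis unfolding hom_polys_def
    by (auto simp: sum.distrib algebra_simps intro!: exI[of _ "\<lambda>\<alpha>. u \<alpha> + v \<alpha>"])
qed

lemma hom_polys_scale:
  assumes "p \<in> hom_polys l k" shows "(\<lambda>x. c * p x) \<in> hom_polys l k"
proof -
  obtain u where "\<And>x. p x = (\<Sum>\<alpha>\<in>multi_indices k. u \<alpha> * monomial l \<alpha> x)"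
    using assms unfolding hom_polys_def by auto
  then show ?thesis unfolding hom_polys_def
    by (auto simp: sum_distrib_left algebra_simps intro!: exI[of _ "\<lambda>\<alpha>. c * u \<alpha>"])
qed

lemma hom_polys_diff:
  assumes "p \<in> hom_polys l k" "q \<in> hom_polys l k" shows "(\<lambda>x. p x - q x) \<in> hom_polys l k"
  using hom_polys_add[OF assms(1) hom_polys_scale[OF assms(2), of "-1"]] by simp

lemma hom_polys_sum:
  assumes "\<And>i. i \<in> I \<Longrightarrow> p i \<in> hom_polys l k" shows "(\<lambda>x. \<Sum>i\<in>I. p i x) \<in> hom_polys l k"
  using assms by (induction I rule: infinite_finite_induct) (auto intro: hom_polys_add)

lemma hom_polys_induct [consumes 1, case_names monomial add scale zero]:
  assumes "p \<in> hom_polys l k"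
    and "\<And>\<alpha>. \<alpha> \<in> multi_indices k \<Longrightarrow> P (monomial l \<alpha>)"
    and "\<And>p q. P p \<Longrightarrow> P q \<Longrightarrow> P (\<lambda>x. p x + q x)"
    and "\<And>c p. P p \<Longrightarrow> P (\<lambda>x. c * p x)"
    and "P (\<lambda>x. 0)"
  shows "P p"
proof -
  obtain u where u: "p = (\<lambda>x. \<Sum>\<alpha>\<in>multi_indices k. u \<alpha> * monomial l \<alpha> x)"
    using assms unfolding hom_polys_def by fastforce
  have "P (\<lambda>x. \<Sum>\<alpha>\<in>I. u \<alpha> * monomial l \<alpha> x)" if "finite I" "I \<subseteq> multi_indices k" for I
    using that
  proof (induction I rule: finite_induct)
    case (insert \<alpha> I)
    then show ?case by (simp add: assms(3)[OF assms(4)[OF assms(2)]])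
  qed (simp add: assms)
  then show ?thesis unfolding u by simp
qed

lemma monomial_mult: "monomial l \<alpha> x * monomial l \<beta> x = monomial l (\<lambda>i. \<alpha> i + \<beta> i) x"
  by (simp add: monomial_def prod.distrib power_add)

lemma hom_polys_mult:
  assumes "p \<in> hom_polys l j" "q \<in> hom_polys l k" shows "(\<lambda>x. p x * q x) \<in> hom_polys l (j + k)"
  using assms(1)
proof (induction rule: hom_polys_induct)
  case (monomial \<alpha>)
  from assms(2) show ?case
  proof (induction rule: hom_polys_induct)
    case (monomial \<beta>)
    have "(\<lambda>i. \<alpha> i + \<beta> i) \<in> multi_indices (j + k)"
      using monomial \<open>\<alpha> \<in> multi_indices j\<close> by (simp add: multi_indices_def sum.distrib)
    then show ?case by (simp add: monomial_mult hom_polys_monomial)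
  next
    case (add p q) then show ?case using hom_polys_add[OF add] by (simp add: algebra_simps)
  next
    case (scale c p) then show ?case using hom_polys_scale[OF scale] by (simp add: algebra_simps)
  qed simp
next
  case (add p q) then show ?case using hom_polys_add[OF add] by (simp add: algebra_simps)
next
  case (scale c p) then show ?case using hom_polys_scale[OF scale] by (simp add: algebra_simps)
qed simp

lemma multi_indices_0: "multi_indices 0 = {\<lambda>_. 0}"
  by (auto simp: multi_indices_def)

lemma hom_polys_one: "(\<lambda>x. 1) \<in> hom_polys l 0"
proof -
  have "monomial l (\<lambda>_. 0) = (\<lambda>x. 1)" by (simp add: monomial_def fun_eq_iff)
  then show ?thesis using hom_polys_monomial[of "\<lambda>_. 0" 0 l] by (simp add: multi_indices_0)
qed

lemma hom_polys_power: "p \<in> hom_polys l 1 \<Longrightarrow> (\<lambda>x. p x ^ k) \<in> hom_polys l k"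
  by (induction k) (use hom_polys_mult[of p l 1] in \<open>auto simp: hom_polys_one\<close>)

lemma hom_polys_prod:
  assumes "finite I" "\<And>i. i \<in> I \<Longrightarrow> p i \<in> hom_polys l (d i)"
  shows "(\<lambda>x. \<Prod>i\<in>I. p i x) \<in> hom_polys l (\<Sum>i\<in>I. d i)"
  using assms by (induction I rule: finite_induct) (auto simp: hom_polys_one intro: hom_polys_mult)

lemma hom_polys_base: "l i \<in> hom_polys l 1"
proof -
  have "monomial l (\<lambda>j. if j = i then 1 else 0) x = (\<Prod>j\<in>UNIV. if j = i then l j x else 1)" for x
    unfolding monomial_def by (intro prod.cong HOL.refl) auto
  then have "monomial l (\<lambda>j. if j = i then 1 else 0) = l i" by (simp add: fun_eq_iff)
  moreover have "(\<lambda>j. if j = i then 1 else 0) \<in> multi_indices 1" by (simp add: multi_indices_def)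
  ultimately show ?thesis by (metis hom_polys_monomial)
qed

lemma hom_polys_subset:
  assumes "\<And>i. l' i \<in> hom_polys l 1" shows "hom_polys l' k \<subseteq> hom_polys l k"
proof
  fix p assume "p \<in> hom_polys l' k"
  then show "p \<in> hom_polys l k"
  proof (induction rule: hom_polys_induct)
    case (monomial \<alpha>)
    have "(\<lambda>x. \<Prod>i\<in>UNIV. l' i x ^ \<alpha> i) \<in> hom_polys l (\<Sum>i\<in>UNIV. \<alpha> i)"
      by (intro hom_polys_prod hom_polys_power assms) auto
    then show ?case using monomial by (simp add: monomial_def[abs_def] multi_indices_def)
  qed (auto intro: hom_polys_add hom_polys_scale)
qed

lemma hom_polys_compose:
  assumes "\<And>i. (\<lambda>x. l i (f x)) \<in> hom_polys l 1" "p \<in> hom_polys l k"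
  shows "(\<lambda>x. p (f x)) \<in> hom_polys l k"
proof -
  have "(\<lambda>x. p (f x)) \<in> hom_polys (\<lambda>i x. l i (f x)) k"
    using assms(2) unfolding hom_polys_def monomial_def by auto
  then show ?thesis using hom_polys_subset[of "\<lambda>i x. l i (f x)"] assms(1) by blast
qed

text \<open>Induction on the set of variables that occur: with the others frozen, the sum is a
  polynomial in one variable, and its coefficients are again vanishing sums in fewer
  variables.\<close>

lemma monomials_independent:
  fixes A :: "('n::finite \<Rightarrow> nat) set" and u :: "('n \<Rightarrow> nat) \<Rightarrow> real"
  assumes "finite A" "\<And>x. (\<Sum>\<alpha>\<in>A. u \<alpha> * (\<Prod>i\<in>UNIV. x i ^ \<alpha> i)) = 0" "\<alpha> \<in> A"
  shows "u \<alpha> = 0"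
proof -
  have "u \<alpha> = 0"
    if "finite J" "finite A" "\<And>\<alpha> i. \<alpha> \<in> A \<Longrightarrow> i \<notin> J \<Longrightarrow> \<alpha> i = 0"
      "\<And>x. (\<Sum>\<alpha>\<in>A. u \<alpha> * (\<Prod>i\<in>J. x i ^ \<alpha> i)) = 0" "\<alpha> \<in> A"
    for J and A :: "('n::finite \<Rightarrow> nat) set" and u :: "('n \<Rightarrow> nat) \<Rightarrow> real" and \<alpha>
    using that
  proof (induction J arbitrary: A u \<alpha> rule: finite_induct)
    case empty
    then have "A = {\<lambda>_. 0}" by fastforce
    then show ?case using empty by auto
  next
    case (insert j J)
    define A' where "A' d = {\<beta> \<in> A. \<beta> j = d}" for d
    have inj: "inj_on (\<lambda>\<beta>. \<beta>(j := 0)) (A' d)" for d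
      by (rule inj_onI) (metis (mono_tags, lifting) A'_def fun_upd_triv fun_upd_upd mem_Collect_eq)
    have coeff: "(\<Sum>\<beta>\<in>A' d. u \<beta> * (\<Prod>i\<in>J. x i ^ \<beta> i)) = 0" for d x
    proof -
      define p where "p = (\<Sum>\<beta>\<in>A. Polynomial.monom (u \<beta> * (\<Prod>i\<in>J. x i ^ \<beta> i)) (\<beta> j))"
      have "poly p t = 0" for t
      proof -
        have "poly p t = (\<Sum>\<beta>\<in>A. u \<beta> * (\<Prod>i\<in>insert j J. (x(j := t)) i ^ \<beta> i))"
          unfolding p_def poly_sum poly_monom
        proof (intro sum.cong HOL.refl)
          fix \<beta>
          have "(\<Prod>i\<in>J. (x(j := t)) i ^ \<beta> i) = (\<Prod>i\<in>J. x i ^ \<beta> i)"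
            using insert.hyps by (intro prod.cong) auto
          then show "u \<beta> * (\<Prod>i\<in>J. x i ^ \<beta> i) * t ^ \<beta> j = u \<beta> * (\<Prod>i\<in>insert j J. (x(j := t)) i ^ \<beta> i)"
            using insert.hyps by (simp add: algebra_simps)
        qed
        then show ?thesis using insert.prems(3) by simp
      qed
      then have "p = 0" using poly_all_0_iff_0 by blast
      then have "Polynomial.coeff p d = 0" by simp
      moreover have "Polynomial.coeff p d = (\<Sum>\<beta>\<in>A. if \<beta> j = d then u \<beta> * (\<Prod>i\<in>J. x i ^ \<beta> i) else 0)"
        by (simp add: p_def coeff_sum)
      ultimately show ?thesis
        using insert.prems(1) by (simp add: A'_def sum.inter_filter)
    qed
    \<comment> \<open>Within \<open>A' d\<close> the exponent of \<open>j\<close> is constant, so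
      resetting it to 0 is injective; \<open>v\<close> looks up the coefficient of the original
      multi-index.\<close>
    define d where "d = \<alpha> j"
    define v where "v \<gamma> = u (\<gamma>(j := d))" for \<gamma>
    have "v (\<alpha>(j := 0)) = 0"
    proof (rule insert.IH[of "(\<lambda>\<beta>. \<beta>(j := 0)) ` A' d" v "\<alpha>(j := 0)"])
      show "finite ((\<lambda>\<beta>. \<beta>(j := 0)) ` A' d)" using insert.prems by (simp add: A'_def)
      show "\<gamma> i = 0" if "\<gamma> \<in> (\<lambda>\<beta>. \<beta>(j := 0)) ` A' d" "i \<notin> J" for \<gamma> i
        using that insert.prems(2) by (auto simp: A'_def)
      show "\<alpha>(j := 0) \<in> (\<lambda>\<beta>. \<beta>(j := 0)) ` A' d"
        using insert.prems by (auto simp: A'_def d_def)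
      fix x
      have "(\<Sum>\<gamma>\<in>(\<lambda>\<beta>. \<beta>(j := 0)) ` A' d. v \<gamma> * (\<Prod>i\<in>J. x i ^ \<gamma> i)) =
          (\<Sum>\<beta>\<in>A' d. v (\<beta>(j := 0)) * (\<Prod>i\<in>J. x i ^ (\<beta>(j := 0)) i))"
        using inj by (simp add: sum.reindex)
      also have "\<dots> = (\<Sum>\<beta>\<in>A' d. u \<beta> * (\<Prod>i\<in>J. x i ^ \<beta> i))"
      proof (intro sum.cong HOL.refl)
        fix \<beta> assume "\<beta> \<in> A' d"
        then have "v (\<beta>(j := 0)) = u \<beta>" by (auto simp: v_def A'_def)
        moreover have "(\<Prod>i\<in>J. x i ^ (\<beta>(j := 0)) i) = (\<Prod>i\<in>J. x i ^ \<beta> i)"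
          using insert.hyps by (intro prod.cong) auto
        ultimately show "v (\<beta>(j := 0)) * (\<Prod>i\<in>J. x i ^ (\<beta>(j := 0)) i) = u \<beta> * (\<Prod>i\<in>J. x i ^ \<beta> i)" by simp
      qed
      finally show "(\<Sum>\<gamma>\<in>(\<lambda>\<beta>. \<beta>(j := 0)) ` A' d. v \<gamma> * (\<Prod>i\<in>J. x i ^ \<gamma> i)) = 0"
        by (simp add: coeff)
    qed
    then show ?case by (simp add: v_def d_def)
  qed
  from this[of UNIV A u \<alpha>] assms show ?thesis by simp
qed

text \<open>A multi-index splits into its entry at \<open>j\<close> and the rest, which matches the
  Cauchy product. Finiteness is carried through the induction because merging the double sum relies
  on it.\<close>

lemma prod_fps_nth:
  fixes F :: "'n \<Rightarrow> 'f::field fps"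
  assumes "finite J"
  shows "finite {\<alpha>::'n \<Rightarrow> nat. (\<forall>i. i \<notin> J \<longrightarrow> \<alpha> i = 0) \<and> sum \<alpha> J = k} \<and>
    fps_nth (\<Prod>i\<in>J. F i) k =
     (\<Sum>\<alpha> | (\<forall>i. i \<notin> J \<longrightarrow> \<alpha> i = 0) \<and> sum \<alpha> J = k. \<Prod>i\<in>J. fps_nth (F i) (\<alpha> i))"
  using assms
proof (induction J arbitrary: k rule: finite_induct)
  case empty
  have "{\<alpha>::'n \<Rightarrow> nat. \<forall>i. \<alpha> i = 0} = {\<lambda>_. 0}" by auto
  then show ?case by auto
next
  case (insert j J)
  let ?A = "\<lambda>J k. {\<alpha>::'n \<Rightarrow> nat. (\<forall>i. i \<notin> J \<longrightarrow> \<alpha> i = 0) \<and> sum \<alpha> J = k}"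
  let ?f = "\<lambda>(d, \<alpha>::'n \<Rightarrow> nat). \<alpha>(j := d)"
  have upd: "(\<Sum>i\<in>J. if i = j then d else \<alpha> i) = sum \<alpha> J" for \<alpha> :: "'n \<Rightarrow> nat" and d
    using insert.hyps by (intro sum.cong) auto
  have bij: "bij_betw ?f (SIGMA d:{0..k}. ?A J (k - d)) (?A (insert j J) k)"
  proof (rule bij_betw_byWitness[where f' = "\<lambda>\<alpha>. (\<alpha> j, \<alpha>(j := 0))"])
    show "\<forall>a\<in>SIGMA d:{0..k}. ?A J (k - d). (\<lambda>\<alpha>. (\<alpha> j, \<alpha>(j := 0))) (?f a) = a"
      using insert.hyps by (auto simp: fun_eq_iff)
    show "\<forall>a'\<in>?A (insert j J) k. ?f ((\<lambda>\<alpha>. (\<alpha> j, \<alpha>(j := 0))) a') = a'" by auto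
    show "?f ` (SIGMA d:{0..k}. ?A J (k - d)) \<subseteq> ?A (insert j J) k"
      using insert.hyps by (auto simp: upd)
    show "(\<lambda>\<alpha>. (\<alpha> j, \<alpha>(j := 0))) ` ?A (insert j J) k \<subseteq> (SIGMA d:{0..k}. ?A J (k - d))"
      using insert.hyps by (auto simp: upd)
  qed
  have "finite (SIGMA d:{0..k}. ?A J (k - d))" using insert.IH by (intro finite_SigmaI) auto
  then have fin: "finite (?A (insert j J) k)" using bij bij_betw_finite by blast
  have "fps_nth (\<Prod>i\<in>insert j J. F i) k =
      (\<Sum>d = 0..k. fps_nth (F j) d * (\<Sum>\<alpha>\<in>?A J (k - d). \<Prod>i\<in>J. fps_nth (F i) (\<alpha> i)))"
    using insert by (simp add: fps_mult_nth)
  also have "\<dots> = (\<Sum>(d, \<alpha>)\<in>(SIGMA d:{0..k}. ?A J (k - d)). fps_nth (F j) d * (\<Prod>i\<in>J. fps_nth (F i) (\<alpha> i)))"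
    using insert.IH by (simp add: sum_distrib_left sum.Sigma)
  also have "\<dots> = (\<Sum>a\<in>(SIGMA d:{0..k}. ?A J (k - d)). \<Prod>i\<in>insert j J. fps_nth (F i) (?f a i))"
  proof (intro sum.cong HOL.refl, clarify)
    fix d and \<alpha> :: "'n \<Rightarrow> nat"
    have "(\<Prod>i\<in>J. fps_nth (F i) ((\<alpha>(j := d)) i)) = (\<Prod>i\<in>J. fps_nth (F i) (\<alpha> i))"
      using insert.hyps by (intro prod.cong) auto
    then show "fps_nth (F j) d * (\<Prod>i\<in>J. fps_nth (F i) (\<alpha> i)) = (\<Prod>i\<in>insert j J. fps_nth (F i) ((\<alpha>(j := d)) i))"
      using insert.hyps by simp
  qed
  also have "\<dots> = (\<Sum>\<alpha>\<in>?A (insert j J) k. \<Prod>i\<in>insert j J. fps_nth (F i) (\<alpha> i))"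
    using sum.reindex_bij_betw[OF bij, of "\<lambda>\<alpha>. \<Prod>i\<in>insert j J. fps_nth (F i) (\<alpha> i)"] by simp
  finally show ?case using fin by blast
qed

text \<open>On the left stands the complete homogeneous symmetric polynomial, the trace on forms of
  degree k of a diagonal map with entries \<open>z i\<close>; on the right is its generating
  function, the reciprocal determinant in Molien's formula.\<close>

lemma sum_monomials_eq_fps_nth:
  fixes z :: "'n::finite \<Rightarrow> 'f::field"
  shows "(\<Sum>\<alpha>\<in>multi_indices k. \<Prod>i\<in>UNIV. z i ^ \<alpha> i) = fps_nth (\<Prod>i\<in>UNIV. Abs_fps (\<lambda>k. z i ^ k)) k"
  using prod_fps_nth[where J = UNIV and F = "\<lambda>i. Abs_fps (\<lambda>k. z i ^ k)" and k = k] by (simp add: multi_indices_def)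

section \<open>Partial fractions with cyclotomic denominators\<close>

text \<open>All summands but the one at \<open>e\<close> contain the factor \<open>Q e\<close>, so
  \<open>Q e\<close> divides that one too. Being coprime to the cofactor it divides
  \<open>C e\<close>, which has smaller degree.\<close>

lemma partial_fractions_zero:
  fixes C Q :: "'i \<Rightarrow> 'a::field_gcd poly"
  assumes "finite S" and deg: "\<And>e. e \<in> S \<Longrightarrow> degree (C e) < degree (Q e)"
    and cop: "\<And>e e'. e \<in> S \<Longrightarrow> e' \<in> S \<Longrightarrow> e \<noteq> e' \<Longrightarrow> coprime (Q e) (Q e')"
    and zero: "(\<Sum>e\<in>S. C e * (\<Prod>e'\<in>S - {e}. Q e')) = 0"
    and e: "e \<in> S"
  shows "C e = 0"
proof -
  have "(\<Sum>e\<in>S. C e * (\<Prod>e'\<in>S - {e}. Q e')) =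
      C e * (\<Prod>e'\<in>S - {e}. Q e') + (\<Sum>f\<in>S - {e}. C f * (\<Prod>e'\<in>S - {f}. Q e'))"
    using assms(1) e by (simp add: sum.remove)
  moreover have "Q e dvd (\<Sum>f\<in>S - {e}. C f * (\<Prod>e'\<in>S - {f}. Q e'))"
    using assms(1) e by (intro dvd_sum dvd_mult dvd_prodI) auto
  ultimately have "Q e dvd C e * (\<Prod>e'\<in>S - {e}. Q e')"
    using zero dvd_add_left_iff[of "Q e" "\<Sum>f\<in>S - {e}. C f * (\<Prod>e'\<in>S - {f}. Q e')"
        "C e * (\<Prod>e'\<in>S - {e}. Q e')"] by simp
  moreover have "coprime (Q e) (\<Prod>e'\<in>S - {e}. Q e')"
    using cop e by (intro prod_coprime_right) auto
  ultimately have "Q e dvd C e"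
    by (simp add: coprime_dvd_mult_left_iff)
  then show ?thesis
    using deg[OF e] dvd_imp_degree_le by force
qed

definition primitive_roots :: "nat \<Rightarrow> complex set" where
  "primitive_roots e = {z. \<forall>j. z ^ j = 1 \<longleftrightarrow> e dvd j}"

text \<open>A common denominator for all elements of order \<open>e\<close>, whichever primitive
  roots occur as their eigenvalues: none can have multiplicity above \<open>N\<close>, the
  dimension. The factors are 1 - z X, so the constant coefficient is 1.\<close>

definition cyclo_denom :: "nat \<Rightarrow> nat \<Rightarrow> complex poly" where
  "cyclo_denom N e = (\<Prod>z\<in>primitive_roots e. [:1, -z:]) ^ N"

lemma finite_primitive_roots: "e > 0 \<Longrightarrow> finite (primitive_roots e)"
proof (rule finite_subset[OF subsetI])
  fix z assume "z \<in> primitive_roots e"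
  then have "z ^ e = 1 \<longleftrightarrow> e dvd e" unfolding primitive_roots_def by blast
  then show "z \<in> {z. z ^ e = 1}" by simp
qed (rule finite_roots_unity, simp)

lemma coprime_linear_factors:
  fixes w z :: complex
  assumes "w \<noteq> z"
  shows "coprime [:1, -w:] [:1, -z:]"
proof (rule coprimeI)
  fix c assume "c dvd [:1, -w:]" "c dvd [:1, -z:]"
  then have "c dvd Polynomial.smult z [:1, -w:] - Polynomial.smult w [:1, -z:]"
    by (rule dvd_diff[OF dvd_smult dvd_smult])
  moreover have "Polynomial.smult z [:1, -w:] - Polynomial.smult w [:1, -z:] = [:z - w:]" by simp
  ultimately have "c dvd [:z - w:]" by metis
  moreover have "is_unit [:z - w:]" using assms by (simp add: is_unit_pCons_iff)
  ultimately show "is_unit c" using dvd_trans by blast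
qed

lemma coprime_cyclo_denom:
  assumes "e \<noteq> f"
  shows "coprime (cyclo_denom N e) (cyclo_denom N f)"
proof -
  have "e = f" if "z \<in> primitive_roots e" "z \<in> primitive_roots f" for z
  proof (rule dvd_antisym)
    have *: "z ^ j = 1 \<longleftrightarrow> e dvd j" "z ^ j = 1 \<longleftrightarrow> f dvd j" for j
      using that by (simp_all add: primitive_roots_def)
    show "e dvd f" "f dvd e" using *[of e] *[of f] by simp_all
  qed
  then have "w \<noteq> z" if "w \<in> primitive_roots e" "z \<in> primitive_roots f" for w z
    using that assms by blast
  then show ?thesis
    unfolding cyclo_denom_def
    by (auto simp: coprime_power_left_iff coprime_power_right_iff
        intro!: prod_coprime_left prod_coprime_right coprime_linear_factors)
qed

text \<open>The strict degree bound is what makes partial fractions unique; the constant coefficient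
  1 makes every such series contribute exactly one to a count.\<close>

definition has_cyclo_denom :: "nat \<Rightarrow> nat \<Rightarrow> complex fps \<Rightarrow> bool" where
  "has_cyclo_denom N e F \<longleftrightarrow> (\<exists>A. degree A < degree (cyclo_denom N e) \<and> Polynomial.coeff A 0 = 1 \<and>
     F * fps_of_poly (cyclo_denom N e) = fps_of_poly A)"

text \<open>The exponent \<open>card I\<close> provides one full set of primitive roots for each
  \<open>i\<close>. The factor belonging to \<open>l i\<close> cancels the geometric series, the
  remaining ones form the numerator, and the degree drops by \<open>card I\<close>.\<close>

lemma has_cyclo_denom_prod:
  fixes l :: "'i \<Rightarrow> complex"
  assumes "finite I" "I \<noteq> {}" "e > 0" "\<And>i. i \<in> I \<Longrightarrow> l i \<in> primitive_roots e"
  shows "has_cyclo_denom (card I) e (\<Prod>i\<in>I. Abs_fps (\<lambda>k. l i ^ k))"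
  unfolding has_cyclo_denom_def
proof (intro exI conjI)
  let ?A = "\<Prod>i\<in>I. \<Prod>z\<in>primitive_roots e - {l i}. [:1, -z:]"
  have Q: "cyclo_denom (card I) e = (\<Prod>i\<in>I. [:1, -l i:]) * ?A"
    unfolding cyclo_denom_def prod_constant[symmetric] prod.distrib[symmetric]
    using assms finite_primitive_roots by (intro prod.cong[OF HOL.refl] prod.remove) auto
  have "\<And>i. degree (\<Prod>z\<in>primitive_roots e - {l i}. [:1, -z:]) = (\<Sum>z\<in>primitive_roots e - {l i}. degree [:1, -z:])"
    by (intro degree_prod_eq_sum_degree) auto
  have A0: "?A \<noteq> 0" using assms(1) finite_primitive_roots[OF assms(3)] by (auto simp: prod_zero_iff)
  have P0: "(\<Prod>i\<in>I. [:1, -l i:]) \<noteq> 0" using assms(1) by (auto simp: prod_zero_iff)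
  \<comment> \<open>Each cancelled factor has degree 1 only if \<open>l i\<close> is
    nonzero.\<close>
  have l0: "l i \<noteq> 0" if "i \<in> I" for i
  proof
    assume "l i = 0"
    moreover have "l i ^ e = 1" using assms(4)[OF that] by (simp add: primitive_roots_def)
    ultimately show False using assms(3) by (simp add: power_0_left)
  qed
  have "degree (\<Prod>i\<in>I. [:1, -l i:]) = (\<Sum>i\<in>I. degree [:1, -l i:])"
    by (intro degree_prod_eq_sum_degree) auto
  also have "\<dots> = card I" using l0 by simp
  finally have "degree (\<Prod>i\<in>I. [:1, -l i:]) = card I" .
  then show "degree ?A < degree (cyclo_denom (card I) e)"
    unfolding Q using assms(1,2) A0 P0 by (simp add: degree_mult_eq card_gt_0_iff)
  have "poly ?A 0 = 1" by (simp add: poly_prod)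
  then show "Polynomial.coeff ?A 0 = 1" by (simp add: poly_0_coeff_0)
  have geo: "Abs_fps (\<lambda>k. z ^ k) * fps_of_poly [:1, -z:] = 1" for z :: complex
  proof (rule fps_ext)
    fix k show "fps_nth (Abs_fps (\<lambda>k. z ^ k) * fps_of_poly [:1, -z:]) k = fps_nth 1 k"
    proof -
      have "Abs_fps (\<lambda>k. z ^ k) * fps_of_poly [:1, -z:]
          = Abs_fps (\<lambda>k. z ^ k) - fps_X * (fps_const z * Abs_fps (\<lambda>k. z ^ k))"
        by (simp add: fps_of_poly_pCons algebra_simps flip: fps_const_neg)
      then show ?thesis by (cases k) simp_all
    qed
  qed
  have *: "(\<Prod>i\<in>I. Abs_fps (\<lambda>k. l i ^ k)) * fps_of_poly (\<Prod>i\<in>I. [:1, -l i:]) = 1"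
    by (simp add: fps_of_poly_prod prod.distrib[symmetric] geo)
  show "(\<Prod>i\<in>I. Abs_fps (\<lambda>k. l i ^ k)) * fps_of_poly (cyclo_denom (card I) e) = fps_of_poly ?A"
    unfolding Q fps_of_poly_mult mult.assoc[symmetric] * mult_1_left ..
qed

text \<open>Collecting numerators by order gives one partial fraction for each order. The difference
  of the two sides vanishes, hence so does each numerator, and its constant coefficient is the
  difference of the weighted counts. The scalars \<open>c\<close> and \<open>d\<close> will be the
  averaging factors.\<close>

lemma sum_has_cyclo_denom_unique:
  fixes F :: "'i \<Rightarrow> complex fps" and G :: "'j \<Rightarrow> complex fps"
  assumes fin: "finite I" "finite J"
    and F: "\<And>i. i \<in> I \<Longrightarrow> has_cyclo_denom N (ord_I i) (F i)"
    and G: "\<And>j. j \<in> J \<Longrightarrow> has_cyclo_denom N (ord_J j) (G j)"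
    and eq: "fps_const c * (\<Sum>i\<in>I. F i) = fps_const d * (\<Sum>j\<in>J. G j)"
  shows "c * of_nat (card {i\<in>I. ord_I i = e}) = d * of_nat (card {j\<in>J. ord_J j = e})"
proof -
  define Q where "Q = cyclo_denom N"
  obtain A where A: "\<And>i. i \<in> I \<Longrightarrow> degree (A i) < degree (Q (ord_I i)) \<and> Polynomial.coeff (A i) 0 = 1 \<and>
     F i * fps_of_poly (Q (ord_I i)) = fps_of_poly (A i)"
    using F unfolding has_cyclo_denom_def Q_def by metis
  obtain B where B: "\<And>j. j \<in> J \<Longrightarrow> degree (B j) < degree (Q (ord_J j)) \<and> Polynomial.coeff (B j) 0 = 1 \<and>
     G j * fps_of_poly (Q (ord_J j)) = fps_of_poly (B j)"
    using G unfolding has_cyclo_denom_def Q_def by metis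
  define S where "S = ord_I ` I \<union> ord_J ` J"
  have S: "finite S" using fin by (simp add: S_def)
  define C where "C e = [:c:] * (\<Sum>i | i \<in> I \<and> ord_I i = e. A i) - [:d:] * (\<Sum>j | j \<in> J \<and> ord_J j = e. B j)" for e
  define R where "R e = (\<Prod>e'\<in>S - {e}. Q e')" for e
  have QR: "Q e * R e = prod Q S" if "e \<in> S" for e
    using S that by (simp add: R_def prod.remove)
  have I: "(\<Sum>i\<in>I. F i) * fps_of_poly (prod Q S) = fps_of_poly (\<Sum>e\<in>S. (\<Sum>i | i \<in> I \<and> ord_I i = e. A i) * R e)"
  proof -
    have "(\<Sum>i\<in>I. F i) * fps_of_poly (prod Q S) = (\<Sum>i\<in>I. fps_of_poly (A i * R (ord_I i)))"
      unfolding sum_distrib_right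
    proof (intro sum.cong HOL.refl)
      fix i assume i: "i \<in> I"
      then have "prod Q S = Q (ord_I i) * R (ord_I i)" by (simp add: QR S_def)
      then show "F i * fps_of_poly (prod Q S) = fps_of_poly (A i * R (ord_I i))"
        using A[OF i] by (simp add: fps_of_poly_mult mult.assoc[symmetric])
    qed
    also have "\<dots> = (\<Sum>e\<in>S. \<Sum>i | i \<in> I \<and> ord_I i = e. fps_of_poly (A i * R (ord_I i)))"
      using fin S by (intro sum.group[symmetric]) (auto simp: S_def)
    finally show ?thesis by (simp add: fps_of_poly_sum sum_distrib_right)
  qed
  have J: "(\<Sum>j\<in>J. G j) * fps_of_poly (prod Q S) = fps_of_poly (\<Sum>e\<in>S. (\<Sum>j | j \<in> J \<and> ord_J j = e. B j) * R e)"
  proof -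
    have "(\<Sum>j\<in>J. G j) * fps_of_poly (prod Q S) = (\<Sum>j\<in>J. fps_of_poly (B j * R (ord_J j)))"
      unfolding sum_distrib_right
    proof (intro sum.cong HOL.refl)
      fix j assume j: "j \<in> J"
      then have "prod Q S = Q (ord_J j) * R (ord_J j)" by (simp add: QR S_def)
      then show "G j * fps_of_poly (prod Q S) = fps_of_poly (B j * R (ord_J j))"
        using B[OF j] by (simp add: fps_of_poly_mult mult.assoc[symmetric])
    qed
    also have "\<dots> = (\<Sum>e\<in>S. \<Sum>j | j \<in> J \<and> ord_J j = e. fps_of_poly (B j * R (ord_J j)))"
      using fin S by (intro sum.group[symmetric]) (auto simp: S_def)
    finally show ?thesis by (simp add: fps_of_poly_sum sum_distrib_right)
  qed
  have "fps_of_poly (\<Sum>e\<in>S. C e * R e) =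
     fps_const c * ((\<Sum>i\<in>I. F i) * fps_of_poly (prod Q S)) - fps_const d * ((\<Sum>j\<in>J. G j) * fps_of_poly (prod Q S))"
    unfolding I J C_def left_diff_distrib sum_subtractf fps_of_poly_diff mult.assoc
      sum_distrib_left[symmetric] fps_of_poly_mult fps_of_poly_const ..
  also have "\<dots> = 0" using eq by (simp add: mult.assoc[symmetric])
  finally have "fps_of_poly (\<Sum>e\<in>S. C e * R e) = fps_of_poly 0" by simp
  then have zero: "(\<Sum>e\<in>S. C e * R e) = 0" by (simp only: fps_of_poly_eq_iff)
  show ?thesis
  proof (cases "e \<in> S")
    case True
    have deg: "degree (C f) < degree (Q f)" if "f \<in> S" for f
    proof -
      \<comment> \<open>Positivity of the degree covers orders that occur in only one of the two
        families, where the other sum of numerators is empty.\<close>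
      have pos: "degree (Q f) > 0" using that A B unfolding S_def by fastforce
      have "degree (\<Sum>i | i \<in> I \<and> ord_I i = f. A i) < degree (Q f)"
        using A pos by (intro degree_sum_less) auto
      moreover have "degree (\<Sum>j | j \<in> J \<and> ord_J j = f. B j) < degree (Q f)"
        using B pos by (intro degree_sum_less) auto
      ultimately show ?thesis unfolding C_def
        by (intro degree_diff_less) (simp_all add: le_less_trans[OF degree_smult_le])
    qed
    have "C e = 0"
      by (rule partial_fractions_zero[OF S deg _ zero[unfolded R_def] True])
         (auto simp: Q_def intro: coprime_cyclo_denom)
    then have "Polynomial.coeff (C e) 0 = 0" by simp
    then show ?thesis using A B by (simp add: C_def coeff_sum)
  next
    case False
    then have "{i\<in>I. ord_I i = e} = {}" "{j\<in>J. ord_J j = e} = {}" by (auto simp: S_def)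
    then show ?thesis by (simp only: card.empty of_nat_0 mult_zero_right)
  qed
qed

section \<open>Traces and Molien's formula\<close>

text \<open>Independence of an indexed family over an arbitrary field: a real basis and its
  complexification share their labels, and coefficients can be compared label by label.\<close>

definition fam_independent :: "'a set \<Rightarrow> ('a \<Rightarrow> 'x \<Rightarrow> 'f::field) \<Rightarrow> bool" where
  "fam_independent A e \<longleftrightarrow> (\<forall>u. (\<forall>x. (\<Sum>a\<in>A. u a * e a x) = 0) \<longrightarrow> (\<forall>a\<in>A. u a = 0))"

lemma fam_independentD:
  assumes "fam_independent A e" "\<And>x. (\<Sum>a\<in>A. u a * e a x) = (\<Sum>a\<in>A. v a * e a x)" "a \<in> A"
  shows "u a = v a"
proof -
  have "(\<Sum>a\<in>A. (u a - v a) * e a x) = 0" for x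
    using assms(2)[of x] by (simp add: left_diff_distrib sum_subtractf)
  then show ?thesis using assms(1,3) unfolding fam_independent_def by fastforce
qed

text \<open>The transition matrices \<open>p\<close> and \<open>q\<close> are inverse to each other
  and satisfy c p = p d, whence tr c = tr (c p q) = tr (p d q) = tr (d q p) = tr d.\<close>

lemma trace_unique:
  fixes e :: "'a \<Rightarrow> 'x \<Rightarrow> 'f::field" and f :: "'b \<Rightarrow> 'x \<Rightarrow> 'f" and g :: "'x \<Rightarrow> 'x"
  assumes fin: "finite A" "finite B"
    and e: "fam_independent A e" and f: "fam_independent B f"
    and c: "\<And>a x. a \<in> A \<Longrightarrow> e a (g x) = (\<Sum>a'\<in>A. c a a' * e a' x)"
    and d: "\<And>b x. b \<in> B \<Longrightarrow> f b (g x) = (\<Sum>b'\<in>B. d b b' * f b' x)"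
    and p: "\<And>a x. a \<in> A \<Longrightarrow> e a x = (\<Sum>b\<in>B. p a b * f b x)"
    and q: "\<And>b x. b \<in> B \<Longrightarrow> f b x = (\<Sum>a\<in>A. q b a * e a x)"
  shows "(\<Sum>a\<in>A. c a a) = (\<Sum>b\<in>B. d b b)"
proof -
  have pq: "(\<Sum>b\<in>B. p a b * q b a') = (if a' = a then 1 else 0)" if "a \<in> A" "a' \<in> A" for a a'
  proof (rule fam_independentD[OF e _ that(2)])
    fix x
    have "(\<Sum>a'\<in>A. (\<Sum>b\<in>B. p a b * q b a') * e a' x) = (\<Sum>a'\<in>A. \<Sum>b\<in>B. p a b * (q b a' * e a' x))"
      by (simp add: sum_distrib_right mult.assoc)
    also have "\<dots> = (\<Sum>b\<in>B. p a b * f b x)"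
      by (subst sum.swap) (simp add: q sum_distrib_left)
    also have "\<dots> = e a x" using p[OF that(1)] by simp
    also have "\<dots> = (\<Sum>a'\<in>A. (if a' = a then 1 else 0) * e a' x)"
      using fin that by (simp add: if_distrib[of "\<lambda>t. t * _"] cong: if_cong)
    finally show "(\<Sum>a'\<in>A. (\<Sum>b\<in>B. p a b * q b a') * e a' x) = (\<Sum>a'\<in>A. (if a' = a then 1 else 0) * e a' x)" .
  qed
  have qp: "(\<Sum>a\<in>A. q b a * p a b') = (if b' = b then 1 else 0)" if "b \<in> B" "b' \<in> B" for b b'
  proof (rule fam_independentD[OF f _ that(2)])
    fix x
    have "(\<Sum>b'\<in>B. (\<Sum>a\<in>A. q b a * p a b') * f b' x) = (\<Sum>b'\<in>B. \<Sum>a\<in>A. q b a * (p a b' * f b' x))"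
      by (simp add: sum_distrib_right mult.assoc)
    also have "\<dots> = (\<Sum>a\<in>A. q b a * e a x)"
      by (subst sum.swap) (simp add: p sum_distrib_left)
    also have "\<dots> = f b x" using q[OF that(1)] by simp
    also have "\<dots> = (\<Sum>b'\<in>B. (if b' = b then 1 else 0) * f b' x)"
      using fin that by (simp add: if_distrib[of "\<lambda>t. t * _"] cong: if_cong)
    finally show "(\<Sum>b'\<in>B. (\<Sum>a\<in>A. q b a * p a b') * f b' x) = (\<Sum>b'\<in>B. (if b' = b then 1 else 0) * f b' x)" .
  qed
  have cp: "(\<Sum>a'\<in>A. c a a' * p a' b) = (\<Sum>b'\<in>B. p a b' * d b' b)" if "a \<in> A" "b \<in> B" for a b
  proof (rule fam_independentD[OF f _ that(2)])
    fix x
    have "(\<Sum>b\<in>B. (\<Sum>a'\<in>A. c a a' * p a' b) * f b x) = (\<Sum>b\<in>B. \<Sum>a'\<in>A. c a a' * (p a' b * f b x))"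
      by (simp add: sum_distrib_right mult.assoc)
    also have "\<dots> = (\<Sum>a'\<in>A. c a a' * e a' x)"
      by (subst sum.swap) (simp add: p sum_distrib_left)
    also have "\<dots> = e a (g x)" using c that by simp
    also have "\<dots> = (\<Sum>b'\<in>B. \<Sum>b\<in>B. p a b' * (d b' b * f b x))"
      using p[OF that(1), of "g x"] by (simp add: d sum_distrib_left)
    also have "\<dots> = (\<Sum>b\<in>B. (\<Sum>b'\<in>B. p a b' * d b' b) * f b x)"
      by (subst sum.swap) (simp add: sum_distrib_right mult.assoc)
    finally show "(\<Sum>b\<in>B. (\<Sum>a'\<in>A. c a a' * p a' b) * f b x) = (\<Sum>b\<in>B. (\<Sum>b'\<in>B. p a b' * d b' b) * f b x)" .
  qed
  have "(\<Sum>a\<in>A. c a a) = (\<Sum>a\<in>A. \<Sum>a'\<in>A. c a a' * (if a = a' then 1 else 0))"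
    using fin by (simp add: if_distrib[of "\<lambda>t. _ * t"] cong: if_cong)
  also have "\<dots> = (\<Sum>a\<in>A. \<Sum>a'\<in>A. \<Sum>b\<in>B. c a a' * (p a' b * q b a))"
    by (intro sum.cong HOL.refl) (simp add: pq[symmetric] sum_distrib_left)
  also have "\<dots> = (\<Sum>a\<in>A. \<Sum>b\<in>B. (\<Sum>a'\<in>A. c a a' * p a' b) * q b a)"
    by (intro sum.cong HOL.refl, subst sum.swap) (simp add: sum_distrib_right mult.assoc)
  also have "\<dots> = (\<Sum>a\<in>A. \<Sum>b\<in>B. (\<Sum>b'\<in>B. p a b' * d b' b) * q b a)"
    by (intro sum.cong HOL.refl) (simp add: cp)
  also have "\<dots> = (\<Sum>a\<in>A. \<Sum>b\<in>B. \<Sum>b'\<in>B. d b' b * (q b a * p a b'))"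
    by (simp add: sum_distrib_right sum_distrib_left mult_ac)
  also have "\<dots> = (\<Sum>b\<in>B. \<Sum>a\<in>A. \<Sum>b'\<in>B. d b' b * (q b a * p a b'))"
    by (rule sum.swap)
  also have "\<dots> = (\<Sum>b\<in>B. \<Sum>b'\<in>B. \<Sum>a\<in>A. d b' b * (q b a * p a b'))"
    by (intro sum.cong HOL.refl, rule sum.swap)
  also have "\<dots> = (\<Sum>b\<in>B. \<Sum>b'\<in>B. d b' b * (if b' = b then 1 else 0))"
    by (intro sum.cong HOL.refl) (simp add: qp[symmetric] sum_distrib_left)
  also have "\<dots> = (\<Sum>b\<in>B. d b b)"
    using fin by (simp add: if_distrib[of "\<lambda>t. _ * t"] cong: if_cong)
  finally show ?thesis .
qed

lemma vector_space_fun: "vector_space (\<lambda>(c::'f::field) (p::'x \<Rightarrow> 'f) x. c * p x)"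
  by unfold_locales (auto simp: fun_eq_iff algebra_simps)

lemma sum_fun_apply: "(\<Sum>a\<in>A. F a) x = (\<Sum>a\<in>A. F a x)"
  for F :: "'a \<Rightarrow> 'x \<Rightarrow> 'f::comm_monoid_add"
  by (induction A rule: infinite_finite_induct) auto

lemma fam_independent_imp:
  fixes e :: "'a \<Rightarrow> 'x \<Rightarrow> 'f::field"
  assumes fin: "finite A" and e: "fam_independent A e"
  shows inj_on_if_fam_independent: "inj_on e A"
    and independent_if_fam_independent: "\<not> module.dependent (\<lambda>(c::'f) (p::'x \<Rightarrow> 'f) x. c * p x) (e ` A)"
proof -
  interpret V: vector_space "\<lambda>(c::'f::field) (p::'x \<Rightarrow> 'f) x. c * p x"
    by (rule vector_space_fun)
  show inj: "inj_on e A"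
  proof (rule inj_onI)
    fix a b assume ab: "a \<in> A" "b \<in> A" "e a = e b"
    have "(\<Sum>c\<in>A. (if c = a then 1 else 0) * e c x) = (\<Sum>c\<in>A. (if c = b then 1 else 0) * e c x)" for x
      using fin ab by (simp add: if_distrib[of "\<lambda>t. t * _"] cong: if_cong)
    from fam_independentD[OF e this ab(1)] show "a = b" by (simp split: if_splits)
  qed
  show "V.independent (e ` A)"
  proof (rule V.independent_if_scalars_zero)
    fix u y assume "(\<Sum>y\<in>e ` A. (\<lambda>x. u y * y x)) = 0" "y \<in> e ` A"
    then have "(\<Sum>a\<in>A. u (e a) * e a x) = 0" for x
      using inj by (simp add: sum.reindex fun_eq_iff sum_fun_apply)
    then show "u y = 0" using e \<open>y \<in> e ` A\<close> unfolding fam_independent_def by force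
  qed (use fin in simp)
qed

text \<open>If the spanning family were dependent, one member could be dropped, leaving fewer
  spanning vectors than there are independent ones.\<close>

lemma fam_independent_if_spanning:
  fixes e :: "'a \<Rightarrow> 'x \<Rightarrow> 'f::field" and f :: "'b \<Rightarrow> 'x \<Rightarrow> 'f"
  assumes fin: "finite A" "finite B" and card: "card B = card A"
    and e: "fam_independent A e"
    and sp: "\<And>a. a \<in> A \<Longrightarrow> \<exists>p. \<forall>x. e a x = (\<Sum>b\<in>B. p b * f b x)"
  shows "fam_independent B f"
proof -
  interpret V: vector_space "\<lambda>(c::'f::field) (p::'x \<Rightarrow> 'f) x. c * p x"
    by (rule vector_space_fun)
  note inj = inj_on_if_fam_independent[OF fin(1) e] and ind = independent_if_fam_independent[OF fin(1) e]
  have E: "e ` A \<subseteq> V.span (f ` B)"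
  proof clarify
    fix a assume "a \<in> A"
    then obtain p where p: "\<And>x. e a x = (\<Sum>b\<in>B. p b * f b x)" using sp by blast
    have "e a = (\<Sum>b\<in>B. (\<lambda>x. p b * f b x))" by (simp add: fun_eq_iff p sum_fun_apply)
    also have "\<dots> \<in> V.span (f ` B)" by (intro V.span_sum V.span_scale V.span_base) auto
    finally show "e a \<in> V.span (f ` B)" .
  qed
  show ?thesis unfolding fam_independent_def
  proof (intro allI impI ballI, rule ccontr)
    fix u b assume u: "\<forall>x. (\<Sum>b\<in>B. u b * f b x) = 0" and b: "b \<in> B" and nz: "u b \<noteq> 0"
    have "f b = (\<Sum>b'\<in>B - {b}. (\<lambda>x. (- u b' / u b) * f b' x))"
    proof
      fix x
      have "u b * f b x + (\<Sum>b'\<in>B - {b}. u b' * f b' x) = 0"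
        using u sum.remove[OF fin(2) b, of "\<lambda>b. u b * f b x"] by simp
      then have "u b * f b x = (\<Sum>b'\<in>B - {b}. - u b' * f b' x)"
        by (simp add: sum_negf add_eq_0_iff)
      then have "f b x = (\<Sum>b'\<in>B - {b}. - u b' * f b' x) / u b"
        using nz by (metis nonzero_mult_div_cancel_left)
      then show "f b x = (\<Sum>b'\<in>B - {b}. (\<lambda>x. (- u b' / u b) * f b' x)) x"
        by (simp add: sum_fun_apply sum_divide_distrib)
    qed
    also have "\<dots> \<in> V.span (f ` (B - {b}))"
      by (intro V.span_sum V.span_scale V.span_base) auto
    finally have fb: "f b \<in> V.span (f ` (B - {b}))" .
    have "f ` B \<subseteq> V.span (f ` (B - {b}))"
    proof clarify
      fix c assume "c \<in> B"
      then show "f c \<in> V.span (f ` (B - {b}))" using fb by (cases "c = b") (auto intro: V.span_base)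
    qed
    then have "V.span (f ` B) \<subseteq> V.span (f ` (B - {b}))" by (simp add: V.span_minimal)
    then have "e ` A \<subseteq> V.span (f ` (B - {b}))" using E by blast
    then have "card (e ` A) \<le> card (f ` (B - {b}))"
      using V.independent_span_bound[of "f ` (B - {b})" "e ` A"] ind fin by auto
    also have "\<dots> \<le> card (B - {b})" using fin by (intro card_image_le) auto
    also have "\<dots> < card B" using fin b by (meson card_Diff1_less)
    finally show False using card inj by (simp add: card_image)
  qed
qed

text \<open>Discrete Fourier transform: the vectors v_m = \<Sum>_j \<omega>^(m j) M^j w are
  eigenvectors for \<omega>^(-m), and their sum over m is e w. Hence eigenvectors span, and a basis
  can be chosen among them.\<close>

lemma root_of_unity_eigenbasis:
  fixes M :: "complex ^ 'n ^ 'n"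
  assumes pow: "\<And>w. ((*v) M ^^ e) w = w" and e: "e > 0"
  obtains b :: "'n \<Rightarrow> complex ^ 'n" and z :: "'n \<Rightarrow> complex"
  where "\<And>i. M *v b i = z i *s b i" "\<And>i. b i \<noteq> 0" "vec.span (range b) = UNIV"
proof -
  define E where "E = {v. \<exists>z. M *v v = z *s v}"
  define \<omega> where "\<omega> = cis (2 * pi / e)"
  have \<omega>e: "\<omega> ^ e = 1" using e by (simp add: \<omega>_def Complex.DeMoivre)
  have \<omega>0: "\<omega> \<noteq> 0" by (simp add: \<omega>_def)
  have \<omega>j: "\<omega> ^ j \<noteq> 1" if "0 < j" "j < e" for j
  proof
    assume "\<omega> ^ j = 1"
    then have "cis (2 * pi * real j / e) = cis (2 * pi * real 0 / e)"
      by (simp add: \<omega>_def Complex.DeMoivre mult.commute)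
    moreover have "inj_on (\<lambda>k. cis (2 * pi * real k / real e)) {..<e}"
      using Complex.bij_betw_roots_unity[OF e] by (rule bij_betw_imp_inj_on)
    ultimately have "j = 0" using that e inj_onD[of "\<lambda>k. cis (2 * pi * real k / real e)" "{..<e}" j 0] by simp
    then show False using that by simp
  qed
  have geo: "(\<Sum>m<e. (\<omega> ^ j) ^ m) = (if j = 0 then of_nat e else 0)" if "j < e" for j
  proof (cases "j = 0")
    case False
    have "(\<omega> ^ j - 1) * (\<Sum>m<e. (\<omega> ^ j) ^ m) = (\<omega> ^ j) ^ e - 1"
      by (simp add: power_diff_1_eq)
    also have "\<dots> = 0" using \<omega>e by (metis power_commutes power_mult power_one mult.commute eq_iff_diff_eq_0)
    finally show ?thesis using \<omega>j[of j] that False by simp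
  qed simp
  have "w \<in> vec.span E" for w
  proof -
    define v where "v m = (\<Sum>j<e. \<omega> ^ (m * j) *s ((*v) M ^^ j) w)" for m
    have lin: "M *v (\<Sum>j\<in>J. c j *s u j) = (\<Sum>j\<in>J. c j *s (M *v u j))" for J c and u :: "nat \<Rightarrow> complex ^ 'n"
      by (induction J rule: infinite_finite_induct)
         (simp_all add: matrix_vector_right_distrib vector_scalar_commute)
    have "v m \<in> E" for m
    proof -
      \<comment> \<open>Applying \<open>M\<close> shifts the summation index; the cycle closes
        because \<omega>^e = 1 and M^e w = w.\<close>
      have "\<omega> ^ m *s (M *v v m) = (\<Sum>j<e. \<omega> ^ (m * Suc j) *s ((*v) M ^^ Suc j) w)"
        unfolding v_def lin by (simp add: vec.scale_sum_right power_add)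
      also have "\<dots> = (\<Sum>j<Suc e. \<omega> ^ (m * j) *s ((*v) M ^^ j) w) - w"
        by (subst sum.lessThan_Suc_shift) simp
      also have "\<dots> = v m + \<omega> ^ (m * e) *s w - w"
        by (simp add: v_def pow)
      also have "\<dots> = v m"
        using \<omega>e by (simp add: power_mult mult.commute[of m] power_one)
      finally have "\<omega> ^ m *s (M *v v m) = v m" .
      then have "inverse (\<omega> ^ m) *s (\<omega> ^ m *s (M *v v m)) = inverse (\<omega> ^ m) *s v m" by simp
      then have "M *v v m = inverse (\<omega> ^ m) *s v m" using \<omega>0 by (simp del: vector_smult_lneg)
      then show ?thesis unfolding E_def by blast
    qed
    then have "(\<Sum>m<e. v m) \<in> vec.span E" by (intro vec.span_sum vec.span_base) auto
    moreover have "(\<Sum>m<e. v m) = (\<Sum>j<e. (\<Sum>m<e. (\<omega> ^ j) ^ m) *s ((*v) M ^^ j) w)"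
      unfolding v_def by (subst sum.swap) (simp add: vec.scale_sum_left power_mult[symmetric] mult.commute)
    moreover have "\<dots> = (\<Sum>j<e. (if j = 0 then of_nat e else 0) *s ((*v) M ^^ j) w)"
      by (intro sum.cong HOL.refl) (simp add: geo)
    moreover have "\<dots> = (\<Sum>j<e. if j = 0 then of_nat e *s w else 0)"
      by (intro sum.cong HOL.refl) auto
    moreover have "\<dots> = of_nat e *s w"
      using e by simp
    ultimately have "of_nat e *s w \<in> vec.span E" by metis
    then have "inverse (of_nat e) *s (of_nat e *s w) \<in> vec.span E" by (rule vec.span_scale)
    then show ?thesis using e by simp
  qed
  then have span: "vec.span E = UNIV" by blast
  obtain B where B: "B \<subseteq> E" "vec.independent B" "E \<subseteq> vec.span B" "card B = vec.dim E"
    using vec.basis_exists by blast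
  have "vec.span B = UNIV" using B(3) span vec.span_mono vec.span_span by (metis UNIV_eq_I subsetD UNIV_I)
  moreover have "vec.dim E = CARD('n)"
    using span by (metis vec.dim_span vec_dim_card)
  then have "card B = CARD('n)" using B by simp
  moreover have "finite B" using B(2) vec.finiteI_independent by blast
  ultimately obtain b where b: "bij_betw b (UNIV::'n set) B"
    using finite_same_card_bij[of "UNIV::'n set" B] by auto
  have bB: "b i \<in> B" for i using b by (auto simp: bij_betw_def)
  then have "\<forall>i. \<exists>z. M *v b i = z *s b i" using B(1) unfolding E_def by blast
  then obtain z where "\<And>i. M *v b i = z i *s b i" by metis
  moreover have "b i \<noteq> 0" for i using bB B(2) vec.dependent_zero by metis
  moreover have "vec.span (range b) = UNIV" using b \<open>vec.span B = UNIV\<close> by (simp add: bij_betw_def)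
  ultimately show thesis using that by blast
qed

subsection \<open>Eigenforms of a fixed point free orthogonal matrix\<close>

lemma group_orthogonal_group: "group (orthogonal_group :: (real ^ 'n ^ 'n) monoid)"
proof (rule groupI)
  fix A :: "real ^ 'n ^ 'n" assume "A \<in> carrier orthogonal_group"
  then have "orthogonal_matrix A" by (simp add: orthogonal_group_def)
  then show "\<exists>B\<in>carrier orthogonal_group. B \<otimes>\<^bsub>orthogonal_group\<^esub> A = \<one>\<^bsub>orthogonal_group\<^esub>"
    by (intro bexI[of _ "transpose A"]) (auto simp: orthogonal_group_def orthogonal_matrix_def)
qed (auto simp: orthogonal_group_def orthogonal_matrix_mul matrix_mul_assoc orthogonal_matrix_id)

lemma orthogonal_group_mult [simp]: "x \<otimes>\<^bsub>orthogonal_group\<^esub> y = x ** y"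
  by (simp add: orthogonal_group_def)

lemma as_group_simps [simp]:
  "carrier (as_group G) = G" "x \<otimes>\<^bsub>as_group G\<^esub> y = x ** y" "\<one>\<^bsub>as_group G\<^esub> = mat 1"
  by (simp_all add: orthogonal_group_def)

definition real_coord :: "'n::finite \<Rightarrow> real ^ 'n \<Rightarrow> real" where
  "real_coord i x = x $ i"

definition complex_coord :: "'n::finite \<Rightarrow> real ^ 'n \<Rightarrow> complex" where
  "complex_coord i x = complex_of_real (x $ i)"

definition complex_form :: "complex ^ 'n \<Rightarrow> real ^ 'n \<Rightarrow> complex" where
  "complex_form w x = (\<Sum>i\<in>UNIV. w $ i * complex_coord i x)"

lemma complex_form_matrix:
  "complex_form w (A *v x) = complex_form (transpose (\<chi> i j. complex_of_real (A $ i $ j)) *v w) x"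
proof -
  have "complex_form w (A *v x) = (\<Sum>i\<in>UNIV. \<Sum>j\<in>UNIV. w $ i * (complex_of_real (A $ i $ j) * complex_of_real (x $ j)))"
    by (simp add: complex_form_def complex_coord_def matrix_vector_mult_def sum_distrib_left)
  also have "\<dots> = (\<Sum>j\<in>UNIV. \<Sum>i\<in>UNIV. w $ i * (complex_of_real (A $ i $ j) * complex_of_real (x $ j)))"
    by (rule sum.swap)
  also have "\<dots> = complex_form (transpose (\<chi> i j. complex_of_real (A $ i $ j)) *v w) x"
    by (simp add: complex_form_def complex_coord_def matrix_vector_mult_def transpose_def sum_distrib_left
        sum_distrib_right mult_ac)
  finally show ?thesis .
qed

lemma complex_form_eq_iff: "complex_form v = complex_form w \<longleftrightarrow> v = w"
proof
  assume *: "complex_form v = complex_form w"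
  have "complex_form u (axis i 1) = u $ i" for u :: "complex ^ 'n" and i
    by (simp add: complex_form_def complex_coord_def axis_def if_distrib[of complex_of_real]
        if_distrib[of "\<lambda>t. _ * t"] cong: if_cong)
  then show "v = w" using * by (metis vec_eq_iff)
qed simp

lemma complex_form_scale: "complex_form (z *s w) x = z * complex_form w x"
  by (simp add: complex_form_def sum_distrib_left mult.assoc)

lemma complex_form_Re_Im:
  "complex_form w x = Complex ((\<chi> i. Re (w $ i)) \<bullet> x) ((\<chi> i. Im (w $ i)) \<bullet> x)"
  by (simp add: complex_form_def complex_coord_def complex_eq_iff inner_vec_def)

definition inv_polys :: "(real ^ 'n ^ 'n) set \<Rightarrow> nat \<Rightarrow> (real ^ 'n \<Rightarrow> real) set" where
  "inv_polys G k = {p \<in> hom_polys real_coord k. \<forall>g\<in>G. \<forall>x. p (g *v x) = p x}"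

lemma hom_polys_real_coord_matrix:
  fixes A :: "real ^ 'n ^ 'n"
  assumes "p \<in> hom_polys real_coord k" shows "(\<lambda>x. p (A *v x)) \<in> hom_polys real_coord k"
proof (rule hom_polys_compose[where f = "(*v) A", OF _ assms])
  have "(\<lambda>x. \<Sum>j\<in>UNIV. A $ i $ j * real_coord j x) \<in> hom_polys real_coord 1" for i
    by (intro hom_polys_sum hom_polys_scale hom_polys_base)
  then show "(\<lambda>x. real_coord i (A *v x)) \<in> hom_polys real_coord 1" for i
    by (simp add: real_coord_def matrix_vector_mult_def)
qed

lemma monomial_complex_coord: "monomial complex_coord \<alpha> x = complex_of_real (monomial real_coord \<alpha> x)"
  by (simp add: monomial_def complex_coord_def real_coord_def)

lemma fam_independent_real_monomials:
  "fam_independent (multi_indices k) (monomial (real_coord :: 'n::finite \<Rightarrow> _))"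
  unfolding fam_independent_def
proof (intro allI impI ballI)
  fix u :: "('n \<Rightarrow> nat) \<Rightarrow> real" and \<alpha> :: "'n \<Rightarrow> nat" assume u: "\<forall>x. (\<Sum>a\<in>multi_indices k. u a * monomial real_coord a x) = 0"
    and \<alpha>: "\<alpha> \<in> multi_indices k"
  show "u \<alpha> = 0"
  proof (rule monomials_independent[OF _ _ \<alpha>])
    fix x :: "'n \<Rightarrow> real"
    show "(\<Sum>\<alpha>\<in>multi_indices k. u \<alpha> * (\<Prod>i\<in>UNIV. x i ^ \<alpha> i)) = 0"
      using u[rule_format, of "\<chi> i. x i"] by (simp add: monomial_def real_coord_def)
  qed simp
qed

lemma fam_independent_complexify:
  assumes "fam_independent A e"
  shows "fam_independent A (\<lambda>a x. complex_of_real (e a x))"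
  unfolding fam_independent_def
proof (intro allI impI ballI)
  fix u a assume u: "\<forall>x. (\<Sum>a\<in>A. u a * complex_of_real (e a x)) = 0" and a: "a \<in> A"
  have "(\<Sum>a\<in>A. Re (u a) * e a x) = 0" "(\<Sum>a\<in>A. Im (u a) * e a x) = 0" for x
    using arg_cong[OF u[rule_format, of x], of Re] arg_cong[OF u[rule_format, of x], of Im] by simp_all
  then have "Re (u a) = 0" "Im (u a) = 0"
    using assms[unfolded fam_independent_def, rule_format, of "\<lambda>a. Re (u a)"]
      assms[unfolded fam_independent_def, rule_format, of "\<lambda>a. Im (u a)"] a by blast+
  then show "u a = 0" by (simp add: complex_eq_iff)
qed

lemma fam_independent_id_if_independent:
  assumes "fun_space.independent B" "finite B"
  shows "fam_independent B (\<lambda>b::'x \<Rightarrow> real. b)"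
  unfolding fam_independent_def
proof (intro allI impI ballI)
  fix u b assume "\<forall>x. (\<Sum>b\<in>B. u b * b x) = 0" "b \<in> B"
  then have "(\<Sum>b\<in>B. (\<lambda>x. u b * b x)) = 0" by (simp add: fun_eq_iff sum_fun_apply)
  then show "u b = 0" using fun_space.independentD[OF assms order_refl] \<open>b \<in> B\<close> by blast
qed

lemma span_finite_explicit:
  assumes "finite B" "p \<in> fun_space.span B"
  shows "\<exists>u. \<forall>x. p x = (\<Sum>b\<in>B. u b * b x)"
  using assms fun_space.span_finite[OF assms(1)] by (auto simp: sum_fun_apply)

lemma hom_polys_real_subset_span:
  "hom_polys l k \<subseteq> fun_space.span (monomial l ` multi_indices k)"
proof
  fix p assume "p \<in> hom_polys l k"
  then obtain u where "\<And>x. p x = (\<Sum>\<alpha>\<in>multi_indices k. u \<alpha> * monomial l \<alpha> x)"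
    unfolding hom_polys_def by blast
  then have "p = (\<Sum>\<alpha>\<in>multi_indices k. (\<lambda>x. u \<alpha> * monomial l \<alpha> x))" by (simp add: fun_eq_iff sum_fun_apply)
  also have "\<dots> \<in> fun_space.span (monomial l ` multi_indices k)"
    by (intro fun_space.span_sum fun_space.span_scale fun_space.span_base) auto
  finally show "p \<in> fun_space.span (monomial l ` multi_indices k)" .
qed

context
  fixes G :: "(real ^ 'n ^ 'n) set"
  assumes G: "space_form_group G"
begin

lemma group_as_group: "group (as_group G)"
  using G group_orthogonal_group group.subgroup_imp_group unfolding space_form_group_def by blast

lemma finite_space_form_group: "finite G"
  using G by (simp add: space_form_group_def)

lemma orthogonal_matrix_if_mem: "g \<in> G \<Longrightarrow> orthogonal_matrix g"
  using G subgroup.subset[of G orthogonal_group] by (auto simp: space_form_group_def orthogonal_group_def)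

lemma mat_1_mem: "mat 1 \<in> G"
  using group.is_monoid[OF group_as_group] monoid.one_closed by fastforce

lemma eq_mat_1_if_fixes:
  assumes "g \<in> G" "g *v x = x" "x \<noteq> 0" shows "g = mat 1"
proof (rule ccontr)
  assume "g \<noteq> mat 1"
  moreover have "inverse (norm x) *\<^sub>R x \<in> sphere 0 1" using assms by simp
  moreover have "g *v (inverse (norm x) *\<^sub>R x) = inverse (norm x) *\<^sub>R x"
    using assms(2) by (simp add: matrix_vector_mult_scaleR)
  ultimately show False using G assms(1) unfolding space_form_group_def by blast
qed

text \<open>Eigenvectors of the complexified transpose are eigenforms. If z^j = 1, then g^j fixes
  the real and the imaginary part of the eigenvector; one of these is a nonzero real vector, so
  freeness gives g^j = 1. This is where the free action enters.\<close>

lemma eigenforms: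
  assumes g: "g \<in> G"
  shows "\<exists>z L. (\<forall>i. z i \<in> primitive_roots (group.ord (as_group G) g)) \<and>
    (\<forall>i x. L i (g *v x) = z i * L i x) \<and>
    (\<forall>i. L i \<in> hom_polys complex_coord 1) \<and> (\<forall>i. complex_coord i \<in> hom_polys (L :: 'n \<Rightarrow> _) 1)"
proof -
  interpret H: group "as_group G" by (rule group_as_group)
  define M where "M = transpose (\<chi> i j. complex_of_real (g $ i $ j))"
  define e where "e = H.ord g"
  have g': "g \<in> carrier (as_group G)" using g by simp
  have e: "e > 0" using H.ord_ge_1[OF _ g'] finite_space_form_group by (simp add: e_def)
  have form_pow: "complex_form w ((g [^]\<^bsub>as_group G\<^esub> k) *v x) = complex_form (((*v) M ^^ k) w) x" for k :: nat and w x
  proof (induction k arbitrary: x)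
    case (Suc k)
    have "complex_form w ((g [^]\<^bsub>as_group G\<^esub> Suc k) *v x) = complex_form w ((g [^]\<^bsub>as_group G\<^esub> k) *v (g *v x))"
      by (simp add: matrix_vector_mul_assoc)
    also have "\<dots> = complex_form (((*v) M ^^ k) w) (g *v x)" by (rule Suc)
    also have "\<dots> = complex_form (M *v ((*v) M ^^ k) w) x" unfolding M_def by (rule complex_form_matrix)
    finally show ?case by simp
  qed simp
  have pow: "((*v) M ^^ e) w = w" for w
  proof -
    have "complex_form (((*v) M ^^ e) w) x = complex_form w x" for x
      using form_pow[of w e x] H.pow_ord_eq_1[OF g'] by (simp add: e_def)
    then show ?thesis by (simp add: complex_form_eq_iff[symmetric] fun_eq_iff)
  qed
  obtain b z where b: "\<And>i::'n. M *v b i = z i *s b i" "\<And>i. b i \<noteq> 0" "vec.span (range b) = UNIV"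
    using root_of_unity_eigenbasis[OF pow e] by metis
  have Mpow: "((*v) M ^^ j) (b i) = z i ^ j *s b i" for i j
    by (induction j) (simp_all add: b(1) vector_scalar_commute mult.commute)
  have prim: "z i ^ j = 1 \<longleftrightarrow> e dvd j" for i j
  proof
    assume "e dvd j"
    then obtain t where "j = e * t" by (elim dvdE)
    moreover have "z i ^ e = 1"
      using Mpow[of e i] pow[of "b i"] b(2)[of i] by (metis vec.scale_cancel_right vec.scale_one)
    ultimately show "z i ^ j = 1" by (simp add: power_mult)
  next
    assume z1: "z i ^ j = 1"
    define h where "h = g [^]\<^bsub>as_group G\<^esub> j"
    have h: "h \<in> G" using H.nat_pow_closed[OF g'] by (simp add: h_def)
    have "complex_form (b i) (h *v x) = complex_form (b i) x" for x
      unfolding h_def form_pow Mpow z1 by simp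
    then have re: "(\<chi> k. Re (b i $ k)) \<bullet> (h *v x) = (\<chi> k. Re (b i $ k)) \<bullet> x"
      and im: "(\<chi> k. Im (b i $ k)) \<bullet> (h *v x) = (\<chi> k. Im (b i $ k)) \<bullet> x" for x
      by (simp_all add: complex_form_Re_Im)
    \<comment> \<open>Invariance of the form r alone concerns the transpose of \<open>h\<close>.
      Orthogonality gives |h r| = |r|, and with x = r the square |h r - r|^2 expands to 0.\<close>
    have hfix: "h *v r = r" if "\<And>x. r \<bullet> (h *v x) = r \<bullet> x" for r
    proof -
      have "orthogonal_transformation ((*v) h)"
        using orthogonal_matrix_if_mem[OF h] by (simp add: orthogonal_transformation_matrix)
      then have "(h *v r) \<bullet> (h *v r) = r \<bullet> r" by (simp add: orthogonal_transformation_def)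
      then have "(h *v r - r) \<bullet> (h *v r - r) = 0"
        using that[of r] by (simp add: inner_diff inner_commute)
      then show ?thesis by simp
    qed
    have "(\<chi> k. Re (b i $ k)) \<noteq> 0 \<or> (\<chi> k. Im (b i $ k)) \<noteq> 0"
      using b(2)[of i] by (auto simp: vec_eq_iff complex_eq_iff)
    then have "h = mat 1"
      using eq_mat_1_if_fixes[OF h] hfix[OF re] hfix[OF im] by blast
    then show "e dvd j" using H.pow_eq_id[OF g'] by (simp add: h_def e_def)
  qed
  define L where "L i = complex_form (b i)" for i
  have "L i \<in> hom_polys complex_coord 1" for i
    unfolding L_def complex_form_def[abs_def] by (intro hom_polys_sum hom_polys_scale hom_polys_base)
  moreover have "complex_coord i \<in> hom_polys L 1" for i
  proof -
    have "complex_form w \<in> hom_polys L 1" if "w \<in> vec.span (range b)" for w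
      using that
    proof (induction rule: vec.span_induct_alt)
      case base
      then show ?case by (simp add: complex_form_def[abs_def])
    next
      case (step c x y)
      then obtain k where x: "x = b k" by blast
      have "complex_form (c *s x + y) = (\<lambda>t. c * L k t + complex_form y t)"
        by (simp add: x L_def complex_form_def fun_eq_iff distrib_right sum.distrib sum_distrib_left mult.assoc)
      moreover have "(\<lambda>t. c * L k t + complex_form y t) \<in> hom_polys L 1"
        by (intro hom_polys_add hom_polys_scale hom_polys_base step)
      ultimately show ?case by simp
    qed
    moreover have "complex_form (axis i 1) = complex_coord i"
      by (simp add: complex_form_def axis_def fun_eq_iff if_distrib[of "\<lambda>t. t * _"] cong: if_cong)
    ultimately show ?thesis using b(3) by (metis UNIV_I)
  qed
  moreover have "L i (g *v x) = z i * L i x" for i x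
    unfolding L_def complex_form_matrix M_def[symmetric] b complex_form_scale ..
  moreover have "z i \<in> primitive_roots e" for i using prim by (simp add: primitive_roots_def)
  ultimately show ?thesis unfolding e_def by blast
qed

section \<open>Averaging over the group and Molien's formula\<close>

lemma bij_betw_mult_right:
  assumes "h \<in> G" shows "bij_betw (\<lambda>g. g ** h) G G"
proof -
  interpret H: group "as_group G" by (rule group_as_group)
  have "inj_on (\<lambda>g. g ** h) G" using H.right_cancel[of h] assms by (auto simp: inj_on_def)
  moreover have "(\<lambda>g. g ** h) ` G \<subseteq> G" using H.m_closed[of _ h] assms by auto
  ultimately show ?thesis using finite_space_form_group
    by (simp add: bij_betw_def endo_inj_surj)
qed

lemma sum_translate:
  assumes "h \<in> G" shows "(\<Sum>g\<in>G. p (g *v (h *v x))) = (\<Sum>g\<in>G. p (g *v x))"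
  using sum.reindex_bij_betw[OF bij_betw_mult_right[OF assms], of "\<lambda>g. p (g *v x)"]
  by (simp add: matrix_vector_mul_assoc)

lemma card_space_form_group_pos: "card G > 0"
  using finite_space_form_group mat_1_mem by (auto simp: card_gt_0_iff)

lemma average_inv_polys:
  assumes "p \<in> hom_polys real_coord k"
  shows "(\<lambda>x. inverse (card G) * (\<Sum>g\<in>G. p (g *v x))) \<in> inv_polys G k"
  unfolding inv_polys_def using assms
  by (auto intro!: hom_polys_scale hom_polys_sum hom_polys_real_coord_matrix simp: sum_translate)

text \<open>Averaging over the group is a projection onto the invariant forms; \<open>B1\<close> is
  a basis of its image and \<open>B2\<close> of its kernel. In such a basis the averaged trace can
  be read off the diagonal.\<close>

lemma adapted_basis:
  obtains B1 B2 where "finite B1" "finite B2" "B1 \<inter> B2 = {}" "card B1 = fun_dim (inv_polys G k)"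
    "fam_independent (B1 \<union> B2) (\<lambda>b. b)" "B1 \<subseteq> inv_polys G k" "B2 \<subseteq> hom_polys real_coord k"
    "\<And>b x. b \<in> B2 \<Longrightarrow> (\<Sum>g\<in>G. b (g *v x)) = 0"
    "\<And>p. p \<in> hom_polys real_coord k \<Longrightarrow> \<exists>u. \<forall>x. p x = (\<Sum>b\<in>B1 \<union> B2. u b * b x)"
    "card (B1 \<union> B2) = card (multi_indices k :: ('n \<Rightarrow> nat) set)"
proof -
  define P where "P = hom_polys (real_coord :: 'n \<Rightarrow> _) k"
  define K where "K = {p \<in> P. \<forall>x. (\<Sum>g\<in>G. p (g *v x)) = 0}"
  let ?M = "monomial real_coord ` (multi_indices k :: ('n \<Rightarrow> nat) set)"
  obtain B1 where B1: "B1 \<subseteq> inv_polys G k" "fun_space.independent B1" "inv_polys G k \<subseteq> fun_space.span B1"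
     "card B1 = fun_dim (inv_polys G k)"
    by (rule fun_space.basis_exists)
  obtain B2 where B2: "B2 \<subseteq> K" "fun_space.independent B2" "K \<subseteq> fun_space.span B2"
    by (rule fun_space.basis_exists)
  have PM: "P \<subseteq> fun_space.span ?M" unfolding P_def by (rule hom_polys_real_subset_span)
  have "B1 \<subseteq> P" using B1(1) by (auto simp: inv_polys_def P_def)
  have "B2 \<subseteq> P" using B2(1) by (auto simp: K_def)
  have fin: "finite B1" "finite B2"
    using fun_space.independent_span_bound[of ?M B1] fun_space.independent_span_bound[of ?M B2]
      B1(2) B2(2) PM \<open>B1 \<subseteq> P\<close> \<open>B2 \<subseteq> P\<close> by auto
  have B1inv: "b (g *v x) = b x" if "b \<in> B1" "g \<in> G" for b g x
    using B1(1) that by (auto simp: inv_polys_def)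
  have B2avg: "(\<Sum>g\<in>G. b (g *v x)) = 0" if "b \<in> B2" for b x
    using B2(1) that by (auto simp: K_def)
  have disj: "B1 \<inter> B2 = {}"
  proof (rule ccontr)
    assume "B1 \<inter> B2 \<noteq> {}"
    then obtain b where b: "b \<in> B1" "b \<in> B2" by blast
    have "b x = 0" for x
      using B2avg[OF b(2), of x] B1inv[OF b(1)] card_space_form_group_pos by simp
    then have "b = 0" by (simp add: fun_eq_iff)
    then show False using B1(2) b(1) fun_space.dependent_zero by blast
  qed
  have ind: "fam_independent (B1 \<union> B2) (\<lambda>b. b)"
    unfolding fam_independent_def
  proof (intro allI impI)
    fix u assume u: "\<forall>x. (\<Sum>b\<in>B1 \<union> B2. u b * b x) = 0"
    define w where "w x = (\<Sum>b\<in>B1. u b * b x)" for x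
    have w: "w x = - (\<Sum>b\<in>B2. u b * b x)" for x
      using u[rule_format, of x] fin disj by (simp add: sum.union_disjoint w_def)
    have winv: "w (g *v x) = w x" if "g \<in> G" for g x using that by (simp add: w_def B1inv)
    have w0: "w x = 0" for x
    proof -
      have "real (card G) * w x = (\<Sum>g\<in>G. w (g *v x))" by (simp add: winv)
      also have "\<dots> = - (\<Sum>g\<in>G. \<Sum>b\<in>B2. u b * b (g *v x))" unfolding w by (simp add: sum_negf)
      also have "\<dots> = - (\<Sum>b\<in>B2. u b * (\<Sum>g\<in>G. b (g *v x)))"
        by (subst sum.swap) (simp add: sum_distrib_left)
      also have "\<dots> = 0" by (simp add: B2avg)
      finally show ?thesis using card_space_form_group_pos by simp
    qed
    then have "\<forall>b\<in>B1. u b = 0"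
      using fam_independent_id_if_independent[OF B1(2) fin(1)] unfolding fam_independent_def w_def by blast
    moreover have "\<forall>b\<in>B2. u b = 0"
      using w w0 fam_independent_id_if_independent[OF B2(2) fin(2)] unfolding fam_independent_def by auto
    ultimately show "\<forall>b\<in>B1 \<union> B2. u b = 0" by blast
  qed
  have PB: "p \<in> fun_space.span (B1 \<union> B2)" if p: "p \<in> P" for p
  proof -
    define q where "q x = inverse (card G) * (\<Sum>g\<in>G. p (g *v x))" for x
    have q: "q \<in> inv_polys G k" using average_inv_polys p unfolding q_def[abs_def] P_def by blast
    have "(\<Sum>g\<in>G. p (g *v x) - q (g *v x)) = 0" for x
    proof -
      have "(\<Sum>g\<in>G. q (g *v x)) = (\<Sum>g\<in>G. q x)"
        using q by (intro sum.cong HOL.refl) (simp add: inv_polys_def)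
      then show ?thesis using card_space_form_group_pos by (simp add: sum_subtractf q_def)
    qed
    then have "(\<lambda>x. p x - q x) \<in> K"
      unfolding K_def using q p by (auto simp: P_def inv_polys_def intro: hom_polys_diff)
    then have "(\<lambda>x. p x - q x) \<in> fun_space.span (B1 \<union> B2)" using B2(3) fun_space.span_mono[of B2 "B1 \<union> B2"] by blast
    moreover have "q \<in> fun_space.span (B1 \<union> B2)" using B1(3) q fun_space.span_mono[of B1 "B1 \<union> B2"] by blast
    ultimately have "(\<lambda>x. p x - q x) + q \<in> fun_space.span (B1 \<union> B2)" by (rule fun_space.span_add)
    then show ?thesis by (simp add: plus_fun_def)
  qed
  have indB: "fun_space.independent (B1 \<union> B2)"
    using independent_if_fam_independent[OF _ ind] fin by simp
  have indM: "fun_space.independent ?M"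
    by (intro independent_if_fam_independent fam_independent_real_monomials) simp
  have "card (B1 \<union> B2) \<le> card ?M"
    using fun_space.independent_span_bound[OF _ indB, of ?M] PM \<open>B1 \<subseteq> P\<close> \<open>B2 \<subseteq> P\<close> by auto
  moreover have "card ?M \<le> card (B1 \<union> B2)"
    using fun_space.independent_span_bound[OF _ indM, of "B1 \<union> B2"] PB fin hom_polys_monomial
    by (auto simp: P_def)
  moreover have "card ?M = card (multi_indices k :: ('n \<Rightarrow> nat) set)"
    by (intro card_image inj_on_if_fam_independent fam_independent_real_monomials) simp
  ultimately have "card (B1 \<union> B2) = card (multi_indices k :: ('n \<Rightarrow> nat) set)" by simp
  moreover have "\<exists>u. \<forall>x. p x = (\<Sum>b\<in>B1 \<union> B2. u b * b x)" if "p \<in> hom_polys real_coord k" for p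
    using span_finite_explicit[OF _ PB] that fin by (simp add: P_def)
  ultimately show thesis
    using that[OF fin disj B1(4) ind B1(1)] B2avg \<open>B2 \<subseteq> P\<close> by (simp add: P_def)
qed

text \<open>The trace of p \<mapsto> p \<circ> g is computed a second time in the monomials of the
  eigenforms, on which the map is diagonal with the monomials in the eigenvalues as entries.\<close>

lemma trace_eq_sum_monomials:
  fixes B :: "(real ^ 'n \<Rightarrow> real) set" and L :: "'n \<Rightarrow> real ^ 'n \<Rightarrow> complex"
  assumes fin: "finite B" and card: "card B = card (multi_indices k :: ('n \<Rightarrow> nat) set)"
    and ind: "fam_independent B (\<lambda>b. b)" and BP: "B \<subseteq> hom_polys real_coord k"
    and span: "\<And>p. p \<in> hom_polys real_coord k \<Longrightarrow> \<exists>u. \<forall>x. p x = (\<Sum>b\<in>B. u b * b x)"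
    and c: "\<And>b x. b \<in> B \<Longrightarrow> b (g *v x) = (\<Sum>b'\<in>B. c b b' * b' x)"
    and L: "\<And>i x. L i (g *v x) = z i * L i x"
    and L1: "\<And>i. L i \<in> hom_polys complex_coord 1" and L2: "\<And>i. complex_coord i \<in> hom_polys L 1"
  shows "complex_of_real (\<Sum>b\<in>B. c b b) = (\<Sum>\<alpha>\<in>multi_indices k. \<Prod>i\<in>UNIV. z i ^ \<alpha> i)"
proof -
  let ?A = "multi_indices k :: ('n \<Rightarrow> nat) set"
  have LX: "hom_polys complex_coord k \<subseteq> hom_polys L k" using L2 by (rule hom_polys_subset)
  have XL: "hom_polys L k \<subseteq> hom_polys complex_coord k" using L1 by (rule hom_polys_subset)
  have p: "\<exists>p. \<forall>x. complex_of_real (b x) = (\<Sum>\<alpha>\<in>?A. p \<alpha> * monomial L \<alpha> x)" if b: "b \<in> B" for b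
  proof -
    obtain u where "\<And>x. b x = (\<Sum>\<alpha>\<in>?A. u \<alpha> * monomial real_coord \<alpha> x)"
      using BP b unfolding hom_polys_def by blast
    then have "(\<lambda>x. complex_of_real (b x)) \<in> hom_polys complex_coord k"
      unfolding hom_polys_def monomial_complex_coord
      by (intro CollectI exI[of _ "\<lambda>\<alpha>. complex_of_real (u \<alpha>)"]) simp
    then have "(\<lambda>x. complex_of_real (b x)) \<in> hom_polys L k" using LX by blast
    then show ?thesis unfolding hom_polys_def by blast
  qed
  have q: "\<exists>q. \<forall>x. monomial L \<alpha> x = (\<Sum>b\<in>B. q b * complex_of_real (b x))" if \<alpha>: "\<alpha> \<in> ?A" for \<alpha>
  proof -
    have "monomial L \<alpha> \<in> hom_polys complex_coord k" using XL hom_polys_monomial[OF \<alpha>] by blast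
    then obtain u where u: "\<And>x. monomial L \<alpha> x = (\<Sum>\<beta>\<in>?A. u \<beta> * complex_of_real (monomial real_coord \<beta> x))"
      unfolding hom_polys_def monomial_complex_coord by blast
    have "\<forall>\<beta>\<in>?A. \<exists>v. \<forall>x. monomial real_coord \<beta> x = (\<Sum>b\<in>B. v b * b x)"
      using span hom_polys_monomial by blast
    then obtain v where v: "\<And>\<beta> x. \<beta> \<in> ?A \<Longrightarrow> monomial real_coord \<beta> x = (\<Sum>b\<in>B. v \<beta> b * b x)"
      by metis
    have "monomial L \<alpha> x = (\<Sum>b\<in>B. (\<Sum>\<beta>\<in>?A. u \<beta> * complex_of_real (v \<beta> b)) * complex_of_real (b x))" for x
    proof -
      have "monomial L \<alpha> x = (\<Sum>\<beta>\<in>?A. \<Sum>b\<in>B. u \<beta> * complex_of_real (v \<beta> b) * complex_of_real (b x))"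
        unfolding u by (intro sum.cong HOL.refl) (simp add: v sum_distrib_left mult.assoc)
      then show ?thesis by (subst (asm) sum.swap) (simp add: sum_distrib_right)
    qed
    then show ?thesis
      by (intro exI[of _ "\<lambda>b. \<Sum>\<beta>\<in>?A. u \<beta> * complex_of_real (v \<beta> b)"] allI)
  qed
  obtain p' where p': "\<And>b x. b \<in> B \<Longrightarrow> complex_of_real (b x) = (\<Sum>\<alpha>\<in>?A. p' b \<alpha> * monomial L \<alpha> x)"
    using p by metis
  obtain q' where q': "\<And>\<alpha> x. \<alpha> \<in> ?A \<Longrightarrow> monomial L \<alpha> x = (\<Sum>b\<in>B. q' \<alpha> b * complex_of_real (b x))"
    using q by metis
  have e: "fam_independent B (\<lambda>b x. complex_of_real (b x))"
    using fam_independent_complexify[OF ind] .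
  \<comment> \<open>Independence comes from counting: the monomials in \<open>L\<close> span the
    complexified \<open>B\<close> and are equally many.\<close>
  have f: "fam_independent ?A (monomial L)"
    by (rule fam_independent_if_spanning[OF fin _ card[symmetric] e]) (use p in auto)
  have "(\<Sum>b\<in>B. complex_of_real (c b b)) =
      (\<Sum>\<alpha>\<in>?A. (\<lambda>\<alpha> \<beta>. if \<beta> = \<alpha> then \<Prod>i\<in>UNIV. z i ^ \<alpha> i else 0) \<alpha> \<alpha>)"
  proof (rule trace_unique[OF fin _ e f, where g = "(*v) g" and c = "\<lambda>b b'. complex_of_real (c b b')"
      and d = "\<lambda>\<alpha> \<beta>. if \<beta> = \<alpha> then \<Prod>i\<in>UNIV. z i ^ \<alpha> i else 0" and p = p' and q = q'])
    show "complex_of_real (b (g *v x)) = (\<Sum>b'\<in>B. complex_of_real (c b b') * complex_of_real (b' x))" if "b \<in> B" for b x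
      using c[OF that] by simp
    show "monomial L \<alpha> (g *v x) = (\<Sum>\<beta>\<in>?A. (if \<beta> = \<alpha> then \<Prod>i\<in>UNIV. z i ^ \<alpha> i else 0) * monomial L \<beta> x)"
      if "\<alpha> \<in> ?A" for \<alpha> x
      using that by (simp add: monomial_def L power_mult_distrib prod.distrib if_distrib[of "\<lambda>t. t * _"] cong: if_cong)
  qed (simp, erule p', erule q')
  then show ?thesis by simp
qed

text \<open>Both sides are the sum over the group of the traces on forms of degree k. In the adapted
  basis each invariant vector contributes 1 for every g, and each vector of the kernel contributes 0
  in total.\<close>

lemma molien:
  "\<exists>z. (\<forall>g\<in>G. \<forall>i. z g i \<in> primitive_roots (group.ord (as_group G) g)) \<and>
    (\<forall>k. of_nat (card G * fun_dim (inv_polys G k)) =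
       (\<Sum>g\<in>G. fps_nth (\<Prod>i\<in>(UNIV::'n set). Abs_fps (\<lambda>j. z g i ^ j)) k))"
proof -
  have "\<forall>g\<in>G. \<exists>z L. (\<forall>i. z i \<in> primitive_roots (group.ord (as_group G) g)) \<and>
    (\<forall>i x. L i (g *v x) = z i * L i x) \<and>
    (\<forall>i. L i \<in> hom_polys complex_coord 1) \<and> (\<forall>i. complex_coord i \<in> hom_polys (L :: 'n \<Rightarrow> _) 1)"
    using eigenforms by blast
  then obtain z L where z: "\<And>g i. g \<in> G \<Longrightarrow> z g i \<in> primitive_roots (group.ord (as_group G) g)"
    and L: "\<And>g i x. g \<in> G \<Longrightarrow> L g i (g *v x) = z g i * L g i x"
      "\<And>g i. g \<in> G \<Longrightarrow> L g i \<in> hom_polys complex_coord 1"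
      "\<And>g i. g \<in> G \<Longrightarrow> complex_coord i \<in> hom_polys (L g :: 'n \<Rightarrow> _) 1"
    by metis
  have "of_nat (card G * fun_dim (inv_polys G k)) =
       (\<Sum>g\<in>G. fps_nth (\<Prod>i\<in>(UNIV::'n set). Abs_fps (\<lambda>j. z g i ^ j)) k)" for k
  proof -
    obtain B1 B2 where B: "finite B1" "finite B2" "B1 \<inter> B2 = {}" "card B1 = fun_dim (inv_polys G k)"
      "fam_independent (B1 \<union> B2) (\<lambda>b. b)" "B1 \<subseteq> inv_polys G k" "B2 \<subseteq> hom_polys real_coord k"
      "\<And>b x. b \<in> B2 \<Longrightarrow> (\<Sum>g\<in>G. b (g *v x)) = 0"
      "\<And>p. p \<in> hom_polys real_coord k \<Longrightarrow> \<exists>u. \<forall>x. p x = (\<Sum>b\<in>B1 \<union> B2. u b * b x)"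
      "card (B1 \<union> B2) = card (multi_indices k :: ('n \<Rightarrow> nat) set)"
      using adapted_basis[of k] by blast
    define B where "B = B1 \<union> B2"
    have finB: "finite B" using B by (simp add: B_def)
    have BP: "B \<subseteq> hom_polys real_coord k" using B(6,7) by (auto simp: B_def inv_polys_def)
    have c_ex: "\<exists>c. \<forall>x. b (g *v x) = (\<Sum>b'\<in>B. c b' * b' x)" if "b \<in> B" for b g
    proof -
      have "b \<in> hom_polys real_coord k" using that BP by blast
      then show ?thesis using B(9)[OF hom_polys_real_coord_matrix, of b g] by (simp add: B_def)
    qed
    define c where "c g b = (SOME c. \<forall>x. b (g *v x) = (\<Sum>b'\<in>B. c b' * b' x))" for g :: "real ^ 'n ^ 'n" and b :: "real ^ 'n \<Rightarrow> real"
    have c: "b (g *v x) = (\<Sum>b'\<in>B. c g b b' * b' x)" if "b \<in> B" for b and g :: "real ^ 'n ^ 'n" and x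
      using someI_ex[OF c_ex[OF that, of g]] unfolding c_def by blast
    have tr: "complex_of_real (\<Sum>b\<in>B. c g b b) = fps_nth (\<Prod>i\<in>(UNIV::'n set). Abs_fps (\<lambda>j. z g i ^ j)) k"
      if "g \<in> G" for g
      unfolding sum_monomials_eq_fps_nth[symmetric]
      by (rule trace_eq_sum_monomials[OF finB _ _ BP, where L = "L g" and g = g])
         (use B(5,9,10) c L that in \<open>auto simp: B_def\<close>)
    have c1: "c g b b = 1" if "b \<in> B1" "g \<in> G" for g b
    proof -
      have "c g b b = (if b = b then 1 else 0)"
      proof (rule fam_independentD[OF B(5)[folded B_def], of "c g b" "\<lambda>b'. if b' = b then 1 else 0"])
        show "b \<in> B" using that by (simp add: B_def)
        fix x
        have "(\<Sum>b'\<in>B. c g b b' * b' x) = b x"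
          using c[of b g x] that B(6) by (auto simp: B_def inv_polys_def)
        then show "(\<Sum>b'\<in>B. c g b b' * b' x) = (\<Sum>b'\<in>B. (if b' = b then 1 else 0) * b' x)"
          using that finB by (simp add: B_def if_distrib[of "\<lambda>t. t * _"] cong: if_cong)
      qed
      then show ?thesis by simp
    qed
    \<comment> \<open>The averaged image of \<open>b\<close> is zero, so by independence all of its
      coefficients vanish, in particular the diagonal one.\<close>
    have c2: "(\<Sum>g\<in>G. c g b b) = 0" if "b \<in> B2" for b
    proof (rule fam_independentD[OF B(5)[folded B_def], of "\<lambda>b'. \<Sum>g\<in>G. c g b b'" "\<lambda>_. 0"])
      show "b \<in> B" using that by (simp add: B_def)
      fix x
      have "(\<Sum>b'\<in>B. (\<Sum>g\<in>G. c g b b') * b' x) = (\<Sum>g\<in>G. \<Sum>b'\<in>B. c g b b' * b' x)"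
        by (subst sum.swap) (simp add: sum_distrib_right)
      also have "\<dots> = (\<Sum>g\<in>G. b (g *v x))" using c[of b] that by (simp add: B_def)
      also have "\<dots> = 0" using B(8)[OF that] .
      finally show "(\<Sum>b'\<in>B. (\<Sum>g\<in>G. c g b b') * b' x) = (\<Sum>b'\<in>B. 0 * b' x)" by simp
    qed
    have "(\<Sum>g\<in>G. \<Sum>b\<in>B. c g b b) = (\<Sum>b\<in>B1. \<Sum>g\<in>G. c g b b) + (\<Sum>b\<in>B2. \<Sum>g\<in>G. c g b b)"
      by (subst sum.swap) (simp only: B_def sum.union_disjoint[OF B(1,2,3)])
    also have "\<dots> = real (card G * card B1)" by (simp add: c1 c2)
    finally have "complex_of_real (real (card G * card B1)) = (\<Sum>g\<in>G. complex_of_real (\<Sum>b\<in>B. c g b b))"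
      by (simp only: of_real_sum[symmetric])
    also have "\<dots> = (\<Sum>g\<in>G. fps_nth (\<Prod>i\<in>(UNIV::'n set). Abs_fps (\<lambda>j. z g i ^ j)) k)"
      by (intro sum.cong HOL.refl tr)
    finally show ?thesis by (simp only: B(4) of_real_of_nat_eq)
  qed
  then show ?thesis using z by blast
qed

end

text \<open>Equal dimensions give the same exponent in the denominators of both groups. Since the
  identity is the only element of order 1, the count for e = 1 equates the averaging factors, after
  which the remaining counts agree without weights.\<close>

theorem order_statistics_if_same_inv_dims:
  fixes G1 :: "(real ^ 'n1 ^ 'n1) set" and G2 :: "(real ^ 'n2 ^ 'n2) set"
  assumes G: "space_form_group G1" "space_form_group G2" and N: "CARD('n1) = CARD('n2)"
    and dims: "\<And>k. fun_dim (inv_polys G1 k) = fun_dim (inv_polys G2 k)"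
  shows "card G1 = card G2"
    and "card {g \<in> G1. group.ord (as_group G1) g = e} = card {g \<in> G2. group.ord (as_group G2) g = e}"
proof -
  interpret H1: group "as_group G1" by (rule group_as_group[OF G(1)])
  interpret H2: group "as_group G2" by (rule group_as_group[OF G(2)])
  obtain z1 where z1: "\<And>g i. g \<in> G1 \<Longrightarrow> z1 g i \<in> primitive_roots (H1.ord g)"
    and m1: "\<And>k. of_nat (card G1 * fun_dim (inv_polys G1 k)) =
       (\<Sum>g\<in>G1. fps_nth (\<Prod>i\<in>(UNIV::'n1 set). Abs_fps (\<lambda>j. z1 g i ^ j)) k)"
    using molien[OF G(1)] by blast
  obtain z2 where z2: "\<And>g i. g \<in> G2 \<Longrightarrow> z2 g i \<in> primitive_roots (H2.ord g)"
    and m2: "\<And>k. of_nat (card G2 * fun_dim (inv_polys G2 k)) =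
       (\<Sum>g\<in>G2. fps_nth (\<Prod>i\<in>(UNIV::'n2 set). Abs_fps (\<lambda>j. z2 g i ^ j)) k)"
    using molien[OF G(2)] by blast
  define F1 where "F1 g = (\<Prod>i\<in>(UNIV::'n1 set). Abs_fps (\<lambda>j. z1 g i ^ j))" for g
  define F2 where "F2 g = (\<Prod>i\<in>(UNIV::'n2 set). Abs_fps (\<lambda>j. z2 g i ^ j))" for g
  note fin = finite_space_form_group[OF G(1)] finite_space_form_group[OF G(2)]
  note pos = card_space_form_group_pos[OF G(1)] card_space_form_group_pos[OF G(2)]
  define c1 :: complex where "c1 = inverse (of_nat (card G1))"
  define c2 :: complex where "c2 = inverse (of_nat (card G2))"
  have eq: "fps_const c1 * (\<Sum>g\<in>G1. F1 g) = fps_const c2 * (\<Sum>g\<in>G2. F2 g)"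
  proof (rule fps_ext)
    fix k
    have "c1 * of_nat (card G1 * fun_dim (inv_polys G1 k)) = c2 * of_nat (card G2 * fun_dim (inv_polys G2 k))"
      using pos dims by (simp add: c1_def c2_def)
    then show "fps_nth (fps_const c1 * (\<Sum>g\<in>G1. F1 g)) k = fps_nth (fps_const c2 * (\<Sum>g\<in>G2. F2 g)) k"
      by (simp only: m1 m2 fps_mult_left_const_nth fps_sum_nth F1_def F2_def)
  qed
  have "H1.ord g > 0" if "g \<in> G1" for g using H1.ord_ge_1[of g] fin that by simp
  then have d1: "has_cyclo_denom (CARD('n1)) (H1.ord g) (F1 g)" if "g \<in> G1" for g
    unfolding F1_def using that z1 by (intro has_cyclo_denom_prod) auto
  have "H2.ord g > 0" if "g \<in> G2" for g using H2.ord_ge_1[of g] fin that by simp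
  then have d2: "has_cyclo_denom (CARD('n1)) (H2.ord g) (F2 g)" if "g \<in> G2" for g
    unfolding F2_def N using that z2 by (intro has_cyclo_denom_prod) auto
  have key: "c1 * of_nat (card {g\<in>G1. H1.ord g = e}) = c2 * of_nat (card {g\<in>G2. H2.ord g = e})" for e
    using sum_has_cyclo_denom_unique[OF fin d1 d2 eq] .
  have "{g\<in>G1. H1.ord g = 1} = {mat 1}"
    using H1.ord_eq_1 mat_1_mem[OF G(1)] by auto
  moreover have "{g\<in>G2. H2.ord g = 1} = {mat 1}"
    using H2.ord_eq_1 mat_1_mem[OF G(2)] by auto
  ultimately have "c1 = c2" using key[of 1] by simp
  then show "card G1 = card G2" using pos by (simp add: c1_def c2_def)
  show "card {g \<in> G1. H1.ord g = e} = card {g \<in> G2. H2.ord g = e}"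
    using key[of e] \<open>c1 = c2\<close> pos by (simp add: c2_def)
qed

section \<open>Calculus on the sphere\<close>

text \<open>The great circle through \<open>x\<close> in the direction of \<open>w\<close> stays on
  the sphere, so the chain rule applies to derivatives taken within the sphere and reduces
  uniqueness to one variable.\<close>

lemma tangent_derivative_unique:
  fixes f :: "real ^ 'n \<Rightarrow> 'b::real_normed_vector"
  assumes x: "x \<in> sphere 0 1" and w: "w \<bullet> x = 0"
    and D1: "(f has_derivative D1) (at x within sphere 0 1)"
    and D2: "(f has_derivative D2) (at x within sphere 0 1)"
  shows "D1 w = D2 w"
proof (cases "w = 0")
  case True
  then show ?thesis using D1 D2 has_derivative_linear linear_0 by metis
next
  case False
  define u where "u = inverse (norm w) *\<^sub>R w"
  define \<gamma> where "\<gamma> t = cos t *\<^sub>R x + sin t *\<^sub>R u" for t :: real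
  have u: "u \<bullet> u = 1" "u \<bullet> x = 0" "x \<bullet> u = 0"
    using False w by (simp_all add: u_def dot_square_norm power2_eq_square inner_commute)
  have x1: "x \<bullet> x = 1" using x by (simp add: dot_square_norm)
  have "\<gamma> t \<bullet> \<gamma> t = 1" for t
    by (simp add: \<gamma>_def inner_add u x1 power2_eq_square[symmetric])
  then have \<gamma>S: "\<gamma> t \<in> sphere 0 1" for t by (simp add: norm_eq_1)
  have "(\<gamma> has_derivative (\<lambda>t. t *\<^sub>R u)) (at 0)"
    unfolding \<gamma>_def by (auto intro!: derivative_eq_intros)
  moreover have \<gamma>0: "\<gamma> 0 = x" by (simp add: \<gamma>_def)
  ultimately have "((\<lambda>t. f (\<gamma> t)) has_derivative (\<lambda>t. D1 (t *\<^sub>R u))) (at 0)"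
    "((\<lambda>t. f (\<gamma> t)) has_derivative (\<lambda>t. D2 (t *\<^sub>R u))) (at 0)"
    using D1 D2 \<gamma>S
    by (auto intro!: has_derivative_in_compose[of \<gamma> _ 0 UNIV f] elim!: has_derivative_subset)
  then have "(\<lambda>t. D1 (t *\<^sub>R u)) = (\<lambda>t. D2 (t *\<^sub>R u))" by (rule has_derivative_unique)
  then have "D1 (norm w *\<^sub>R u) = D2 (norm w *\<^sub>R u)" by meson
  then show ?thesis using False by (simp add: u_def)
qed

lemma has_derivative_within_sphere:
  fixes f :: "real ^ 'n \<Rightarrow> 'b::real_normed_vector"
  assumes "open U" "x \<in> U" "x \<in> sphere 0 1" "\<And>y. y \<in> U \<Longrightarrow> y \<in> sphere 0 1 \<Longrightarrow> F y = f y"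
    and "(F has_derivative D) (at x)"
  shows "(f has_derivative D) (at x within sphere 0 1)"
proof (rule has_derivative_transform_eventually)
  show "(F has_derivative D) (at x within sphere 0 1)" using assms(5) by (rule has_derivative_at_withinI)
  show "\<forall>\<^sub>F y in at x within sphere 0 1. F y = f y"
    unfolding eventually_at_topological using assms by blast
qed (use assms in auto)

lemma frechet_derivative_within_sphere:
  fixes f :: "real ^ 'n \<Rightarrow> 'b::real_normed_vector"
  assumes "open U" "x \<in> U" "x \<in> sphere 0 1" "\<And>y. y \<in> U \<Longrightarrow> y \<in> sphere 0 1 \<Longrightarrow> F y = f y"
    and "(F has_derivative D) (at x)" and "w \<bullet> x = 0"
  shows "frechet_derivative f (at x within sphere 0 1) w = D w"
proof -
  have "(f has_derivative D) (at x within sphere 0 1)"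
    using has_derivative_within_sphere assms by blast
  moreover from this have "(f has_derivative frechet_derivative f (at x within sphere 0 1)) (at x within sphere 0 1)"
    using frechet_derivative_works differentiable_def by blast
  ultimately show ?thesis using tangent_derivative_unique assms by blast
qed

lemma tangent_proj_orth: "x \<in> sphere 0 1 \<Longrightarrow> tangent_proj x v \<bullet> x = 0"
  by (simp add: tangent_proj_def inner_diff dot_square_norm)

lemma tangent_proj_sym: "tangent_proj x v \<bullet> w = v \<bullet> tangent_proj x w"
  by (simp add: tangent_proj_def inner_diff inner_commute)

lemma tangent_proj_eq: "w \<bullet> x = 0 \<Longrightarrow> tangent_proj x w = w"
  by (simp add: tangent_proj_def)

lemma sphere_grad_eq:
  fixes f :: "real ^ 'n \<Rightarrow> real"
  assumes U: "open U" "x \<in> U" "x \<in> sphere 0 1" "\<And>y. y \<in> U \<Longrightarrow> y \<in> sphere 0 1 \<Longrightarrow> F y = f y"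
    and F: "(F has_derivative (\<lambda>v. g \<bullet> v)) (at x)"
  shows "sphere_grad f x = tangent_proj x g"
  unfolding sphere_grad_def
proof (rule the_equality)
  have fd: "frechet_derivative f (at x within sphere 0 1) w = g \<bullet> w" if "w \<bullet> x = 0" for w
    using frechet_derivative_within_sphere[OF U F that] .
  show "tangent_proj x g \<bullet> x = 0 \<and>
    (\<forall>w. w \<bullet> x = 0 \<longrightarrow> tangent_proj x g \<bullet> w = frechet_derivative f (at x within sphere 0 1) w)"
    using tangent_proj_orth[OF U(3)] by (auto simp: fd tangent_proj_sym[of x g] tangent_proj_eq)
  fix v assume v: "v \<bullet> x = 0 \<and> (\<forall>w. w \<bullet> x = 0 \<longrightarrow> v \<bullet> w = frechet_derivative f (at x within sphere 0 1) w)"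
  define d where "d = v - tangent_proj x g"
  have d0: "d \<bullet> x = 0" using v tangent_proj_orth[OF U(3)] by (simp add: d_def inner_diff)
  then have "v \<bullet> d = g \<bullet> d" using v fd by simp
  moreover have "tangent_proj x g \<bullet> d = g \<bullet> d" using d0 by (simp add: tangent_proj_sym tangent_proj_eq)
  ultimately have "d \<bullet> d = 0" by (simp add: d_def inner_diff_left)
  then show "v = tangent_proj x g" by (simp add: d_def)
qed

text \<open>The classical splitting of the Euclidean Laplacian for a local extension: the trace of
  the Hessian, minus the second radial derivative, minus N - 1 times the radial derivative, with the
  sign that makes eigenvalues nonnegative.\<close>

lemma sphere_laplacian_eq:
  fixes f :: "real ^ 'n \<Rightarrow> real"
  assumes U: "open U" "x \<in> U" "x \<in> sphere 0 1" "\<And>y. y \<in> U \<Longrightarrow> y \<in> sphere 0 1 \<Longrightarrow> F y = f y"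
    and F: "\<And>y. y \<in> U \<Longrightarrow> (F has_derivative (\<lambda>v. g y \<bullet> v)) (at y)"
    and g: "(g has_derivative H) (at x)"
  shows "sphere_laplacian f x =
    - ((\<Sum>i\<in>UNIV. H (axis i 1) $ i) - x \<bullet> H x - (real CARD('n) - 1) * (g x \<bullet> x))"
proof -
  \<comment> \<open>The tangential gradient as a field on an open set; \<open>?E\<close> is its
    ambient derivative at \<open>x\<close>, simplified by |x| = 1 only afterwards.\<close>
  let ?X = "\<lambda>y. g y - (g y \<bullet> y) *\<^sub>R y"
  let ?E = "\<lambda>v. H v - ((g x \<bullet> x) *\<^sub>R v + (g x \<bullet> v + H v \<bullet> x) *\<^sub>R x)"
  let ?P = "tangent_proj x"
  have linH: "linear H" using g by (rule has_derivative_linear)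
  have x1: "x \<bullet> x = 1" using U(3) by (simp add: dot_square_norm)
  have X: "(?X has_derivative ?E) (at x)"
    by (auto intro!: derivative_eq_intros g)
  have "?X y = sphere_grad f y" if "y \<in> U" "y \<in> sphere 0 1" for y
    using sphere_grad_eq[OF U(1) that U(4) F[OF that(1)]] by (simp add: tangent_proj_def)
  then have fd: "frechet_derivative (sphere_grad f) (at x within sphere 0 1) (?P v) = ?E (?P v)" for v
    using U X tangent_proj_orth by (intro frechet_derivative_within_sphere) auto
  have ax: "axis i 1 \<bullet> v = v $ i" "v \<bullet> axis i 1 = v $ i" for i and v :: "real ^ 'n"
    by (simp_all add: inner_axis inner_axis')
  have comp: "?P (?E (?P (axis i 1))) $ i =
     H (axis i 1) $ i - x $ i * (H x $ i) - x $ i * (x \<bullet> H (axis i 1)) + (x $ i)\<^sup>2 * (x \<bullet> H x)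
      - (g x \<bullet> x) * (1 - (x $ i)\<^sup>2)" for i
  proof -
    define p where "p = ?P (axis i 1)"
    have p: "p = axis i 1 - x $ i *\<^sub>R x" by (simp add: p_def tangent_proj_def ax)
    have px: "x \<bullet> p = 0" using tangent_proj_orth[OF U(3)] by (simp add: p_def inner_commute)
    have "?P (?E p) $ i = p \<bullet> ?E p"
      unfolding ax(1)[symmetric] p_def tangent_proj_sym[symmetric] ..
    also have "\<dots> = p \<bullet> H p - (g x \<bullet> x) * (p \<bullet> p)"
      using px by (simp add: inner_diff_right inner_add_right inner_commute)
    also have "p \<bullet> p = 1 - (x $ i)\<^sup>2"
      by (simp add: p inner_diff ax x1 power2_eq_square)
    also have "p \<bullet> H p = H (axis i 1) $ i - x $ i * (H x $ i) - x $ i * (x \<bullet> H (axis i 1)) + (x $ i)\<^sup>2 * (x \<bullet> H x)"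
      using linH by (simp add: p linear_diff linear_scale inner_diff ax power2_eq_square algebra_simps)
    finally show ?thesis by (simp add: p_def)
  qed
  have H1: "(\<Sum>i\<in>UNIV. x $ i * (x \<bullet> H (axis i 1))) = x \<bullet> H x"
  proof -
    have "x \<bullet> H x = x \<bullet> H (\<Sum>i\<in>UNIV. x $ i *\<^sub>R axis i 1)"
      using basis_expansion[of x] by (simp add: scalar_mult_eq_scaleR)
    also have "\<dots> = (\<Sum>i\<in>UNIV. x $ i * (x \<bullet> H (axis i 1)))"
      using linH by (simp add: linear_sum linear_scale inner_sum_right)
    finally show ?thesis by simp
  qed
  have xs: "(\<Sum>i\<in>UNIV. (x $ i)\<^sup>2) = 1"
    using x1 by (simp add: inner_vec_def power2_eq_square)
  have "sphere_div (sphere_grad f) x = (\<Sum>i\<in>UNIV. ?P (?E (?P (axis i 1))) $ i)"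
    by (simp add: sphere_div_def trace_def matrix_def fd)
  \<comment> \<open>Projecting on both sides subtracts the radial term twice and adds it back
    once.\<close>
  also have "\<dots> = (\<Sum>i\<in>UNIV. H (axis i 1) $ i) - x \<bullet> H x - x \<bullet> H x + x \<bullet> H x - (g x \<bullet> x) * (real CARD('n) - 1)"
    unfolding comp sum_subtractf sum.distrib H1 sum_distrib_left[symmetric] sum_distrib_right[symmetric] xs
    by (simp add: inner_vec_def)
  finally show ?thesis by (simp add: sphere_laplacian_def algebra_simps)
qed

text \<open>Local ambient extensions as in \<open>smooth_on_sphere\<close>, but with explicit
  gradients and finite order: each rotation derivative uses up one degree of differentiability, and
  integration by parts needs two in all.\<close>

definition C1_sphere :: "(real ^ 'n \<Rightarrow> real) \<Rightarrow> bool" where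
  "C1_sphere f \<longleftrightarrow> (\<forall>x\<in>sphere 0 1. \<exists>U F g. open U \<and> x \<in> U \<and> (\<forall>y\<in>U \<inter> sphere 0 1. F y = f y) \<and>
     (\<forall>y\<in>U. (F has_derivative (\<lambda>v. g y \<bullet> v)) (at y)) \<and> continuous_on U g)"

definition C2_sphere :: "(real ^ 'n \<Rightarrow> real) \<Rightarrow> bool" where
  "C2_sphere f \<longleftrightarrow> (\<forall>x\<in>sphere 0 1. \<exists>U F g H. open U \<and> x \<in> U \<and> (\<forall>y\<in>U \<inter> sphere 0 1. F y = f y) \<and>
     (\<forall>y\<in>U. (F has_derivative (\<lambda>v. g y \<bullet> v)) (at y)) \<and>
     (\<forall>y\<in>U. (g has_derivative H y) (at y)) \<and> (\<forall>v. continuous_on U (\<lambda>y. H y v)))"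

lemma C1_sphereE:
  fixes f :: "real ^ 'n \<Rightarrow> real"
  assumes "C1_sphere f" "x \<in> sphere 0 1"
  obtains U F g where "open U" "x \<in> U" "\<And>y. y \<in> U \<Longrightarrow> y \<in> sphere 0 1 \<Longrightarrow> F y = f y"
     "\<And>y. y \<in> U \<Longrightarrow> (F has_derivative (\<lambda>v. g y \<bullet> v)) (at y)" "continuous_on U g"
proof -
  from assms(1)[unfolded C1_sphere_def, THEN bspec, OF assms(2)]
  obtain U F g where *: "open U \<and> x \<in> U \<and> (\<forall>y\<in>U \<inter> sphere 0 1. F y = f y) \<and>
     (\<forall>y\<in>U. (F has_derivative (\<lambda>v. g y \<bullet> v)) (at y)) \<and> continuous_on U g"
    by (elim exE)
  show thesis by (rule that[of U F g]) (use * in simp_all)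
qed

lemma C2_sphereE:
  fixes f :: "real ^ 'n \<Rightarrow> real"
  assumes "C2_sphere f" "x \<in> sphere 0 1"
  obtains U F g H where "open U" "x \<in> U" "\<And>y. y \<in> U \<Longrightarrow> y \<in> sphere 0 1 \<Longrightarrow> F y = f y"
     "\<And>y. y \<in> U \<Longrightarrow> (F has_derivative (\<lambda>v. g y \<bullet> v)) (at y)"
     "\<And>y. y \<in> U \<Longrightarrow> (g has_derivative H y) (at y)" "\<And>v. continuous_on U (\<lambda>y. H y v)"
proof -
  from assms(1)[unfolded C2_sphere_def, THEN bspec, OF assms(2)]
  obtain U F g H where *: "open U \<and> x \<in> U \<and> (\<forall>y\<in>U \<inter> sphere 0 1. F y = f y) \<and>
     (\<forall>y\<in>U. (F has_derivative (\<lambda>v. g y \<bullet> v)) (at y)) \<and>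
     (\<forall>y\<in>U. (g has_derivative H y) (at y)) \<and> (\<forall>v. continuous_on U (\<lambda>y. H y v))"
    by (elim exE)
  show thesis by (rule that[of U F g H]) (use * in simp_all)
qed

lemma has_derivative_axis:
  fixes F :: "real ^ 'n \<Rightarrow> real"
  assumes "(F has_derivative D) (at y)"
  shows "(F has_derivative (\<lambda>v. (\<chi> i. D (axis i 1)) \<bullet> v)) (at y)"
proof -
  have "D v = (\<chi> i. D (axis i 1)) \<bullet> v" for v
  proof -
    have lin: "linear D" using assms by (rule has_derivative_linear)
    have "D v = D (\<Sum>i\<in>UNIV. v $ i *\<^sub>R axis i 1)"
      using basis_expansion[of v] by (simp add: scalar_mult_eq_scaleR)
    also have "\<dots> = (\<chi> i. D (axis i 1)) \<bullet> v"
      using lin by (simp add: linear_sum linear_scale inner_vec_def mult.commute)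
    finally show ?thesis .
  qed
  then show ?thesis using assms by (metis (no_types, lifting) ext)
qed

lemma has_derivative_componentwise:
  fixes f :: "'a::real_normed_vector \<Rightarrow> real ^ 'n"
  assumes "\<And>i. ((\<lambda>x. f x $ i) has_derivative (\<lambda>h. f' h $ i)) (at a within S)"
  shows "(f has_derivative f') (at a within S)"
  unfolding has_derivative_componentwise_within[of f]
  using assms by (auto simp: Basis_vec_def inner_axis)

lemma C2_sphere_if_smooth:
  fixes f :: "real ^ 'n \<Rightarrow> real"
  assumes "smooth_on_sphere f"
  shows "C2_sphere f"
  unfolding C2_sphere_def
proof
  fix x :: "real ^ 'n" assume "x \<in> sphere 0 1"
  then obtain U F where U: "open U" "x \<in> U" "\<And>k. Ck_on k F U" "\<forall>y\<in>U \<inter> sphere 0 1. F y = f y"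
    using assms unfolding smooth_on_sphere_def by blast
  let ?d = "\<lambda>v y. frechet_derivative F (at y) v"
  have F: "F differentiable at y" and d: "?d v differentiable at y"
    and c: "continuous_on U (\<lambda>y. frechet_derivative (?d v) (at y) w)" if "y \<in> U" for y v w
    using U(3)[of "Suc (Suc 0)"] that by auto
  define g where "g y = (\<chi> i. ?d (axis i 1) y)" for y
  define H where "H y v = (\<chi> i. frechet_derivative (?d (axis i 1)) (at y) v)" for y v
  have "(F has_derivative (\<lambda>v. g y \<bullet> v)) (at y)" if "y \<in> U" for y
    unfolding g_def by (rule has_derivative_axis[OF frechet_derivative_works[THEN iffD1, OF F[OF that]]])
  moreover have "(g has_derivative H y) (at y)" if "y \<in> U" for y
    unfolding g_def H_def
    by (rule has_derivative_componentwise) (simp add: frechet_derivative_works[THEN iffD1, OF d[OF that]])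
  moreover have "continuous_on U (\<lambda>y. H y v)" for v
    unfolding H_def using U(2) c by (auto intro!: continuous_intros)
  ultimately show "\<exists>U F g H. open U \<and> x \<in> U \<and> (\<forall>y\<in>U \<inter> sphere 0 1. F y = f y) \<and>
     (\<forall>y\<in>U. (F has_derivative (\<lambda>v. g y \<bullet> v)) (at y)) \<and>
     (\<forall>y\<in>U. (g has_derivative H y) (at y)) \<and> (\<forall>v. continuous_on U (\<lambda>y. H y v))"
    using U by (intro exI[of _ U] exI[of _ F] exI[of _ g] exI[of _ H]) simp
qed

lemma C1_sphere_if_C2:
  fixes f :: "real ^ 'n \<Rightarrow> real"
  assumes "C2_sphere f" shows "C1_sphere f"
  unfolding C1_sphere_def
proof
  fix x :: "real ^ 'n" assume "x \<in> sphere 0 1"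
  with assms obtain U F g H where *: "open U" "x \<in> U" "\<And>y. y \<in> U \<Longrightarrow> y \<in> sphere 0 1 \<Longrightarrow> F y = f y"
     "\<And>y. y \<in> U \<Longrightarrow> (F has_derivative (\<lambda>v. g y \<bullet> v)) (at y)"
     "\<And>y. y \<in> U \<Longrightarrow> (g has_derivative H y) (at y)" "\<And>v. continuous_on U (\<lambda>y. H y v)"
    by (rule C2_sphereE) blast
  have "continuous_on U g"
    using *(5) has_derivative_continuous by (intro continuous_at_imp_continuous_on) blast
  then show "\<exists>U F g. open U \<and> x \<in> U \<and> (\<forall>y\<in>U \<inter> sphere 0 1. F y = f y) \<and>
     (\<forall>y\<in>U. (F has_derivative (\<lambda>v. g y \<bullet> v)) (at y)) \<and> continuous_on U g"
    using * by (intro exI[of _ U] exI[of _ F] exI[of _ g]) simp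
qed

lemma C1_sphere_continuous:
  fixes f :: "real ^ 'n \<Rightarrow> real"
  assumes "C1_sphere f" shows "continuous_on (sphere 0 1) f"
  unfolding continuous_on_eq_continuous_within
proof
  fix x :: "real ^ 'n" assume x: "x \<in> sphere 0 1"
  with assms obtain U F g where U: "open U" "x \<in> U" "\<And>y. y \<in> U \<Longrightarrow> y \<in> sphere 0 1 \<Longrightarrow> F y = f y"
     "\<And>y. y \<in> U \<Longrightarrow> (F has_derivative (\<lambda>v. g y \<bullet> v)) (at y)"
    by (rule C1_sphereE) blast
  then have "(f has_derivative (\<lambda>v. g x \<bullet> v)) (at x within sphere 0 1)"
    using x by (intro has_derivative_within_sphere[of U x F f]) auto
  then show "continuous (at x within sphere 0 1) f" by (rule has_derivative_continuous)
qed

lemma C1_sphere_mult: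
  fixes f :: "real ^ 'n \<Rightarrow> real"
  assumes "C1_sphere f" "C1_sphere h" shows "C1_sphere (\<lambda>x. f x * h x)"
  unfolding C1_sphere_def
proof
  fix x :: "real ^ 'n" assume x: "x \<in> sphere 0 1"
  obtain U F g where U: "open U" "x \<in> U" "\<And>y. y \<in> U \<Longrightarrow> y \<in> sphere 0 1 \<Longrightarrow> F y = f y"
     "\<And>y. y \<in> U \<Longrightarrow> (F has_derivative (\<lambda>v. g y \<bullet> v)) (at y)" "continuous_on U g"
    using assms(1) x by (rule C1_sphereE) blast
  obtain V E k where V: "open V" "x \<in> V" "\<And>y. y \<in> V \<Longrightarrow> y \<in> sphere 0 1 \<Longrightarrow> E y = h y"
     "\<And>y. y \<in> V \<Longrightarrow> (E has_derivative (\<lambda>v. k y \<bullet> v)) (at y)" "continuous_on V k"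
    using assms(2) x by (rule C1_sphereE) blast
  have "((\<lambda>y. F y * E y) has_derivative (\<lambda>v. (F y *\<^sub>R k y + E y *\<^sub>R g y) \<bullet> v)) (at y)" if "y \<in> U \<inter> V" for y
    using U(4) V(4) that by (auto intro!: derivative_eq_intros simp: inner_add_left algebra_simps)
  moreover have "continuous_on (U \<inter> V) (\<lambda>y. F y *\<^sub>R k y + E y *\<^sub>R g y)"
  proof -
    have "continuous_on U F" "continuous_on V E"
      using U(4) V(4) has_derivative_continuous by (blast intro: continuous_at_imp_continuous_on)+
    then show ?thesis using U(5) V(5)
      by (auto intro!: continuous_intros intro: continuous_on_subset)
  qed
  ultimately show "\<exists>U F g. open U \<and> x \<in> U \<and> (\<forall>y\<in>U \<inter> sphere 0 1. F y = f y * h y) \<and>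
     (\<forall>y\<in>U. (F has_derivative (\<lambda>v. g y \<bullet> v)) (at y)) \<and> continuous_on U g"
    using U V by (intro exI[of _ "U \<inter> V"] exI[of _ "\<lambda>y. F y * E y"] exI[of _ "\<lambda>y. F y *\<^sub>R k y + E y *\<^sub>R g y"]) auto
qed

section \<open>Rotation fields and the Laplacian\<close>

definition rot_gen :: "'n \<Rightarrow> 'n \<Rightarrow> real ^ 'n \<Rightarrow> real ^ 'n" where
  "rot_gen i j x = x $ i *\<^sub>R axis j 1 - x $ j *\<^sub>R axis i 1"

definition rot_deriv :: "'n \<Rightarrow> 'n \<Rightarrow> (real ^ 'n \<Rightarrow> real) \<Rightarrow> real ^ 'n \<Rightarrow> real" where
  "rot_deriv i j f x = frechet_derivative f (at x within sphere 0 1) (rot_gen i j x)"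

lemma rot_gen_orth: "rot_gen i j x \<bullet> x = 0"
  by (simp add: rot_gen_def inner_diff_left inner_axis' mult.commute)

lemma linear_rot_gen: "linear (rot_gen i j)"
  by (rule linearI) (simp_all add: rot_gen_def algebra_simps)

lemma has_derivative_rot_gen: "(rot_gen i j has_derivative rot_gen i j) F"
  using linear_rot_gen by (rule linear_imp_has_derivative)

lemma rot_deriv_eq:
  assumes "open U" "x \<in> U" "x \<in> sphere 0 1" "\<And>y. y \<in> U \<Longrightarrow> y \<in> sphere 0 1 \<Longrightarrow> F y = f y"
    and "(F has_derivative (\<lambda>v. g \<bullet> v)) (at x)"
  shows "rot_deriv i j f x = g \<bullet> rot_gen i j x"
  unfolding rot_deriv_def by (rule frechet_derivative_within_sphere[OF assms rot_gen_orth])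

lemma C1_sphere_rot_deriv:
  fixes f :: "real ^ 'n \<Rightarrow> real"
  assumes "C2_sphere f" shows "C1_sphere (rot_deriv i j f)"
  unfolding C1_sphere_def
proof
  fix x :: "real ^ 'n" assume "x \<in> sphere 0 1"
  with assms obtain U F g H where *: "open U" "x \<in> U" "\<And>y. y \<in> U \<Longrightarrow> y \<in> sphere 0 1 \<Longrightarrow> F y = f y"
     "\<And>y. y \<in> U \<Longrightarrow> (F has_derivative (\<lambda>v. g y \<bullet> v)) (at y)"
     "\<And>y. y \<in> U \<Longrightarrow> (g has_derivative H y) (at y)" "\<And>v. continuous_on U (\<lambda>y. H y v)"
    by (rule C2_sphereE) blast
  let ?F = "\<lambda>y. g y \<bullet> rot_gen i j y"
  let ?D = "\<lambda>y v. g y \<bullet> rot_gen i j v + H y v \<bullet> rot_gen i j y"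
  have "\<forall>y\<in>U \<inter> sphere 0 1. ?F y = rot_deriv i j f y"
    using rot_deriv_eq[OF *(1) _ _ *(3) *(4)] by simp
  moreover have D: "(?F has_derivative ?D y) (at y)" if "y \<in> U" for y
    using *(5) that has_derivative_rot_gen by (auto intro!: derivative_eq_intros)
  moreover have "continuous_on U g"
    using *(5) has_derivative_continuous by (intro continuous_at_imp_continuous_on) blast
  then have "continuous_on U (\<lambda>y. \<chi> k. ?D y (axis k 1))"
    using *(6) linear_continuous_on[OF linear_conv_bounded_linear[THEN iffD1, OF linear_rot_gen]]
    by (auto intro!: continuous_intros)
  ultimately show "\<exists>U F g. open U \<and> x \<in> U \<and> (\<forall>y\<in>U \<inter> sphere 0 1. F y = rot_deriv i j f y) \<and>
     (\<forall>y\<in>U. (F has_derivative (\<lambda>v. g y \<bullet> v)) (at y)) \<and> continuous_on U g"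
    using *(1,2) has_derivative_axis[OF D]
    by (intro exI[of _ U] exI[of _ ?F] exI[of _ "\<lambda>y. \<chi> k. ?D y (axis k 1)"] conjI ballI) auto
qed

text \<open>The Laplacian as the Casimir operator of the rotation group. Ordered pairs count every
  coordinate plane twice, hence the division by 2; the diagonal terms vanish. Both sides are
  expanded in the gradient and Hessian of a local extension.\<close>

lemma sphere_laplacian_eq_rot_deriv:
  assumes f: "C2_sphere (f :: real ^ 'n \<Rightarrow> real)" and x: "x \<in> sphere 0 1"
  shows "sphere_laplacian f x = - (\<Sum>i\<in>UNIV. \<Sum>j\<in>UNIV. rot_deriv i j (rot_deriv i j f) x) / 2"
proof -
  obtain U F g H where *: "open U" "x \<in> U" "\<And>y. y \<in> U \<Longrightarrow> y \<in> sphere 0 1 \<Longrightarrow> F y = f y"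
     "\<And>y. y \<in> U \<Longrightarrow> (F has_derivative (\<lambda>v. g y \<bullet> v)) (at y)"
     "\<And>y. y \<in> U \<Longrightarrow> (g has_derivative H y) (at y)"
    using assms by (rule C2_sphereE) blast
  define h where "h i j = H x (axis i 1) $ j" for i j
  define s where "s = g x"
  have linH: "linear (H x)" using *(2,5) has_derivative_linear by blast
  have "x \<bullet> x = 1" using x by (simp add: dot_square_norm)
  then have x1: "(\<Sum>i\<in>UNIV. x $ i * x $ i) = 1" by (simp add: inner_vec_def)
  have xHx: "x \<bullet> H x x = (\<Sum>i\<in>UNIV. \<Sum>j\<in>UNIV. x $ i * x $ j * h i j)"
  proof -
    have "H x x = (\<Sum>i\<in>UNIV. x $ i *\<^sub>R H x (axis i 1))"
      using basis_expansion[of x] linH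
      by (metis (no_types, lifting) linear_scale linear_sum scalar_mult_eq_scaleR sum.cong)
    then have "x \<bullet> H x x = (\<Sum>i\<in>UNIV. x $ i * (x \<bullet> H x (axis i 1)))"
      by (simp add: inner_sum_right)
    also have "\<dots> = (\<Sum>i\<in>UNIV. x $ i * (\<Sum>j\<in>UNIV. x $ j * h i j))"
      by (simp add: h_def inner_vec_def)
    finally show ?thesis by (simp add: sum_distrib_left mult.assoc)
  qed
  have "rot_deriv i j (rot_deriv i j f) x =
      (x $ i * x $ i * h j j + x $ j * x $ j * h i i - x $ i * x $ j * h i j - x $ i * x $ j * h j i)
      - (if i = j then 0 else s $ i * x $ i + s $ j * x $ j)" for i j
  proof -
    let ?F = "\<lambda>y. g y \<bullet> rot_gen i j y"
    let ?D = "\<lambda>v. g x \<bullet> rot_gen i j v + H x v \<bullet> rot_gen i j x"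
    have "(?F has_derivative ?D) (at x)"
      using *(2,5) has_derivative_rot_gen by (auto intro!: derivative_eq_intros)
    then have "rot_deriv i j (rot_deriv i j f) x = ?D (rot_gen i j x)"
      unfolding rot_deriv_def[of i j "rot_deriv i j f"]
      using *(1,2) x rot_deriv_eq[OF *(1) _ _ *(3) *(4)]
      by (intro frechet_derivative_within_sphere[of U x ?F] rot_gen_orth) auto
    \<comment> \<open>For i \<noteq> j the field applied twice is minus the projection to the
      coordinate plane; these terms add up to the first-order part of the Laplacian.\<close>
    moreover have "g x \<bullet> rot_gen i j (rot_gen i j x) = - (if i = j then 0 else s $ i * x $ i + s $ j * x $ j)"
      by (simp add: rot_gen_def inner_diff_right inner_axis s_def) (simp add: axis_def)
    moreover have "H x (rot_gen i j x) = x $ i *\<^sub>R H x (axis j 1) - x $ j *\<^sub>R H x (axis i 1)"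
      using linH by (simp add: rot_gen_def linear_diff linear_scale)
    then have "H x (rot_gen i j x) \<bullet> rot_gen i j x =
       (x $ i *\<^sub>R H x (axis j 1) - x $ j *\<^sub>R H x (axis i 1)) \<bullet> (x $ i *\<^sub>R axis j 1 - x $ j *\<^sub>R axis i 1)"
      by (metis rot_gen_def)
    then have "H x (rot_gen i j x) \<bullet> rot_gen i j x =
       x $ i * x $ i * h j j + x $ j * x $ j * h i i - x $ i * x $ j * h i j - x $ i * x $ j * h j i"
      by (simp add: inner_diff inner_axis h_def algebra_simps)
    ultimately show ?thesis by simp
  qed
  then have "(\<Sum>i\<in>UNIV. \<Sum>j\<in>UNIV. rot_deriv i j (rot_deriv i j f) x) =
    (\<Sum>i\<in>UNIV. \<Sum>j\<in>UNIV. x $ i * x $ i * h j j) + (\<Sum>i\<in>UNIV. \<Sum>j\<in>UNIV. x $ j * x $ j * h i i)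
    - (\<Sum>i\<in>UNIV. \<Sum>j\<in>UNIV. x $ i * x $ j * h i j) - (\<Sum>i\<in>UNIV. \<Sum>j\<in>UNIV. x $ i * x $ j * h j i)
    - (\<Sum>i\<in>UNIV. \<Sum>j\<in>UNIV. if i = j then 0 else s $ i * x $ i + s $ j * x $ j)"
    by (simp add: sum.distrib sum_subtractf)
  moreover have "(\<Sum>i\<in>UNIV. \<Sum>j\<in>UNIV. x $ i * x $ i * h j j) = (\<Sum>j\<in>UNIV. h j j)"
    by (simp add: sum_distrib_left[symmetric] sum_distrib_right[symmetric] x1)
  moreover have "(\<Sum>i\<in>UNIV. \<Sum>j\<in>UNIV. x $ j * x $ j * h i i) = (\<Sum>j\<in>UNIV. h j j)"
    by (simp add: sum_distrib_left[symmetric] sum_distrib_right[symmetric] x1)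
  moreover have "(\<Sum>i\<in>UNIV. \<Sum>j\<in>UNIV. x $ i * x $ j * h j i) = x \<bullet> H x x"
    unfolding xHx by (subst sum.swap) (simp add: mult.commute)
  moreover have "(\<Sum>i\<in>UNIV. \<Sum>j\<in>UNIV. if i = j then 0 else s $ i * x $ i + s $ j * x $ j) =
      2 * (real CARD('n) - 1) * (s \<bullet> x)"
  proof -
    have "(\<Sum>i\<in>UNIV. \<Sum>j\<in>UNIV. if i = j then 0 else s $ i * x $ i + s $ j * x $ j) =
      (\<Sum>i\<in>UNIV. \<Sum>j\<in>UNIV. (s $ i * x $ i + s $ j * x $ j) - (if i = j then 2 * (s $ i * x $ i) else 0))"
      by (intro sum.cong HOL.refl) auto
    also have "\<dots> = 2 * (real CARD('n) * (s \<bullet> x)) - 2 * (s \<bullet> x)"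
      by (simp add: sum_subtractf sum.distrib inner_vec_def sum_distrib_left)
    finally show ?thesis by (simp add: algebra_simps)
  qed
  moreover have "sphere_laplacian f x = - ((\<Sum>i\<in>UNIV. h i i) - x \<bullet> H x x - (real CARD('n) - 1) * (s \<bullet> x))"
    using * x unfolding h_def s_def by (intro sphere_laplacian_eq[of U x F f g]) auto
  ultimately show ?thesis using xHx by simp
qed

section \<open>The rotation invariant integral\<close>

text \<open>The change of variables theorems for Lebesgue measure on \<open>real ^ 'm\<close> require \<open>'m\<close> to be of class
  \<^class>\<open>wellorder\<close>, hence this copy of a finite type.\<close>

typedef ('n::finite) idx = "{..<CARD('n)} :: nat set"
  by (rule exI[of _ 0]) simp

instance idx :: (finite) finite
  by standard (simp add: type_definition.univ[OF type_definition_idx])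

instantiation idx :: (finite) wellorder
begin

definition "i \<le> j \<longleftrightarrow> Rep_idx i \<le> Rep_idx j"
definition "i < j \<longleftrightarrow> Rep_idx i < Rep_idx j"

instance
proof
  fix P :: "'a idx \<Rightarrow> bool" and i
  assume *: "\<And>i. (\<And>j. j < i \<Longrightarrow> P j) \<Longrightarrow> P i"
  show "P i"
    by (induction i rule: measure_induct_rule[of Rep_idx]) (use * in \<open>simp add: less_idx_def\<close>)
qed (auto simp: less_eq_idx_def less_idx_def Rep_idx_inject)

end

definition idx_of :: "'n::finite \<Rightarrow> 'n idx" where
  "idx_of = (SOME f. bij f)"

lemma bij_idx_of: "bij (idx_of :: 'n::finite \<Rightarrow> 'n idx)"
proof -
  have "CARD('n idx) = CARD('n)"
    using type_definition.card[OF type_definition_idx] by simp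
  then have "\<exists>f :: 'n \<Rightarrow> 'n idx. bij f"
    by (metis finite_same_card_bij finite)
  then show ?thesis unfolding idx_of_def by (rule someI_ex)
qed

definition to_vec :: "real ^ ('n::finite) idx \<Rightarrow> real ^ 'n" where
  "to_vec y = (\<chi> i. y $ idx_of i)"

definition from_vec :: "real ^ 'n \<Rightarrow> real ^ ('n::finite) idx" where
  "from_vec x = (\<chi> k. x $ inv_into UNIV idx_of k)"

lemma to_vec_from_vec [simp]: "to_vec (from_vec x) = x"
  by (simp add: to_vec_def from_vec_def vec_eq_iff inv_f_f[OF bij_is_inj[OF bij_idx_of]])

lemma from_vec_to_vec [simp]: "from_vec (to_vec y) = y"
  by (simp add: to_vec_def from_vec_def vec_eq_iff surj_f_inv_f[OF bij_is_surj[OF bij_idx_of]])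

lemma inner_to_vec [simp]: "to_vec x \<bullet> to_vec y = x \<bullet> y"
  unfolding inner_vec_def to_vec_def using sum.reindex_bij_betw[OF bij_idx_of, of "\<lambda>k. x $ k \<bullet> y $ k"] by simp

lemma norm_to_vec [simp]: "norm (to_vec y) = norm y"
  by (simp add: norm_eq_sqrt_inner)

lemma norm_from_vec [simp]: "norm (from_vec x) = norm x"
  by (metis norm_to_vec to_vec_from_vec)

lemma linear_to_vec: "linear to_vec"
  by (rule linearI) (simp_all add: to_vec_def vec_eq_iff)

lemma linear_from_vec: "linear from_vec"
  by (rule linearI) (simp_all add: from_vec_def vec_eq_iff)

text \<open>Lebesgue measure is determined by its values on boxes, and the preimage of a box is its
  image under the inverse orthogonal map, which preserves volume.\<close>

lemma lborel_distr_orthogonal: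
  fixes R :: "real ^ 'm::{finite,wellorder} \<Rightarrow> real ^ 'm::_"
  assumes R: "orthogonal_transformation R"
  shows "distr lborel borel R = lborel"
proof (rule lborel_eqI[symmetric])
  have lin: "linear R" using R orthogonal_transformation_linear by blast
  have meas: "R \<in> borel_measurable borel"
    using lin linear_conv_bounded_linear linear_continuous_on borel_measurable_continuous_onI by blast
  show "sets (distr lborel borel R) = sets borel" by simp
  fix l u :: "real ^ 'm::_" assume lu: "\<And>b. b \<in> Basis \<Longrightarrow> l \<bullet> b \<le> u \<bullet> b"
  have bij: "bij R" using R orthogonal_transformation_bij by blast
  have inv: "orthogonal_transformation (inv_into UNIV R)" using R orthogonal_transformation_inv by blast
  have vim: "R -` box l u = inv_into UNIV R ` box l u" using bij by (rule bij_vimage_eq_inv_image)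
  have lm: "inv_into UNIV R ` box l u \<in> lmeasurable" using measurable_orthogonal_image[OF inv] lmeasurable_box by blast
  have sets: "R -` box l u \<in> sets borel" using measurable_sets[OF meas, of "box l u"] by simp
  have "emeasure (distr lborel borel R) (box l u) = emeasure lborel (R -` box l u)"
    using meas by (subst emeasure_distr) auto
  also have "\<dots> = emeasure lebesgue (inv_into UNIV R ` box l u)"
    using sets by (simp add: vim[symmetric])
  also have "\<dots> = measure lebesgue (inv_into UNIV R ` box l u)"
    using lm by (simp add: emeasure_eq_measure2)
  also have "measure lebesgue (inv_into UNIV R ` box l u) = measure lebesgue (box l u)"
    using measure_orthogonal_image[OF inv lmeasurable_box] .
  also have "ennreal \<dots> = (\<Prod>b\<in>Basis. (u - l) \<bullet> b)"
    using lu by (simp add: measure_lborel_box_eq)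
  finally show "emeasure (distr lborel borel R) (box l u) = ennreal (\<Prod>b\<in>Basis. (u - l) \<bullet> b)" .
qed

definition annulus :: "(real ^ ('n::finite) idx) set" where
  "annulus = {y. 1 \<le> norm y \<and> norm y \<le> 2}"

definition sph_proj :: "real ^ ('n::finite) idx \<Rightarrow> real ^ 'n" where
  "sph_proj y = to_vec (inverse (norm y) *\<^sub>R y)"

text \<open>By polar coordinates this is a positive constant times the surface integral. The annulus
  keeps away from the origin, where the radial projection is discontinuous, and is preserved by
  orthogonal maps.\<close>

definition sph_int :: "(real ^ ('n::finite) \<Rightarrow> real) \<Rightarrow> real" where
  "sph_int h = (\<integral>y. indicator annulus y *\<^sub>R h (sph_proj y) \<partial>lborel)"

lemma compact_annulus: "compact annulus"
proof -
  have "annulus = cball 0 2 - ball 0 1" by (auto simp: annulus_def)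
  then show ?thesis using compact_diff[OF compact_cball open_ball] by metis
qed

lemma sph_proj_mem: "y \<noteq> 0 \<Longrightarrow> sph_proj y \<in> sphere 0 1"
  by (simp add: sph_proj_def)

lemma annulus_nonzero: "y \<in> annulus \<Longrightarrow> y \<noteq> 0"
  by (auto simp: annulus_def)

lemma continuous_on_sph_proj: "continuous_on (- {0}) sph_proj"
  unfolding sph_proj_def
proof (rule continuous_on_compose2[of UNIV to_vec])
  show "continuous_on UNIV to_vec"
    using linear_to_vec linear_conv_bounded_linear linear_continuous_on by blast
qed (auto intro!: continuous_intros)

lemma continuous_on_sph_proj_comp:
  assumes "continuous_on (sphere 0 1) h" "0 \<notin> A"
  shows "continuous_on A (\<lambda>y. h (sph_proj y))"
proof -
  have "A \<subseteq> - {0}" using assms(2) by blast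
  then show ?thesis
    using continuous_on_subset[OF continuous_on_sph_proj] sph_proj_mem
    by (intro continuous_on_compose2[OF assms(1)]) blast+
qed

lemma sph_integrable:
  assumes "continuous_on (sphere 0 1) h"
  shows "integrable lborel (\<lambda>y. indicator annulus y *\<^sub>R (h (sph_proj y) :: real))"
  using annulus_nonzero by (intro borel_integrable_compact compact_annulus continuous_on_sph_proj_comp assms) auto

lemma sph_int_cong:
  assumes "\<And>x. x \<in> sphere 0 1 \<Longrightarrow> h x = k x" shows "sph_int h = sph_int k"
  unfolding sph_int_def
  by (intro Bochner_Integration.integral_cong HOL.refl)
     (auto simp: indicator_def simp del: mem_sphere intro!: assms sph_proj_mem annulus_nonzero)

lemma sph_int_add:
  assumes "continuous_on (sphere 0 1) h" "continuous_on (sphere 0 1) k"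
  shows "sph_int (\<lambda>x. h x + k x) = sph_int h + sph_int k"
  unfolding sph_int_def using sph_integrable[OF assms(1)] sph_integrable[OF assms(2)]
  by (simp add: distrib_left flip: Bochner_Integration.integral_add)

lemma sph_int_scale: "sph_int (\<lambda>x. c * h x) = c * sph_int h"
  unfolding sph_int_def by (simp add: mult.left_commute)

lemma sph_int_minus: "sph_int (\<lambda>x. - h x) = - sph_int h"
  using sph_int_scale[of "-1" h] by simp

lemma sph_int_diff:
  assumes "continuous_on (sphere 0 1) h" "continuous_on (sphere 0 1) k"
  shows "sph_int (\<lambda>x. h x - k x) = sph_int h - sph_int k"
  using sph_int_add[OF assms(1), of "\<lambda>x. - k x"] assms by (simp add: sph_int_minus continuous_on_minus)

lemma sph_int_zero [simp]: "sph_int (\<lambda>x. 0) = 0"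
  by (simp add: sph_int_def)

lemma sph_int_sum:
  assumes "\<And>i. i \<in> I \<Longrightarrow> continuous_on (sphere 0 1) (h i)"
  shows "sph_int (\<lambda>x. \<Sum>i\<in>I. h i x) = (\<Sum>i\<in>I. sph_int (h i))"
  using assms
  by (induction I rule: infinite_finite_induct) (simp_all add: sph_int_add continuous_on_sum)

lemma sph_int_mono:
  assumes "continuous_on (sphere 0 1) h" "continuous_on (sphere 0 1) k"
    and "\<And>x. x \<in> sphere 0 1 \<Longrightarrow> h x \<le> k x"
  shows "sph_int h \<le> sph_int k"
  unfolding sph_int_def
proof (rule integral_mono)
  fix y show "indicator annulus y *\<^sub>R h (sph_proj y) \<le> indicator annulus y *\<^sub>R k (sph_proj y)"
    using assms(3)[of "sph_proj y"] sph_proj_mem[of y] annulus_nonzero[of y]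
    by (auto simp: indicator_def simp del: mem_sphere)
qed (use assms sph_integrable in auto)

text \<open>Norms are preserved, so the transported map leaves the annulus invariant and commutes
  with radial projection; the rest is invariance of Lebesgue measure.\<close>

lemma sph_int_orthogonal:
  fixes R :: "real ^ 'n::finite \<Rightarrow> real ^ 'n" and h :: "real ^ 'n \<Rightarrow> real"
  assumes R: "orthogonal_transformation R" and h: "continuous_on (sphere 0 1) h"
  shows "sph_int (\<lambda>x. h (R x)) = sph_int h"
proof -
  define R' where "R' y = from_vec (R (to_vec y))" for y
  have lin: "linear R" using R orthogonal_transformation_linear by blast
  have linR': "linear R'" unfolding R'_def
    using linear_compose[OF linear_compose[OF linear_to_vec lin] linear_from_vec] by (simp add: o_def)
  have nR: "norm (R x) = norm x" for x using R orthogonal_transformation_norm by blast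
  have nR': "norm (R' y) = norm y" for y by (simp add: R'_def nR)
  have R': "orthogonal_transformation R'"
    using linR' nR' by (simp add: orthogonal_transformation)
  have proj: "sph_proj (R' y) = R (sph_proj y)" for y
  proof -
    have "sph_proj (R' y) = to_vec (R' (inverse (norm y) *\<^sub>R y))"
      using linR' by (simp add: sph_proj_def nR' linear_scale)
    then show ?thesis by (simp add: R'_def sph_proj_def)
  qed
  have meas: "R' \<in> borel_measurable borel"
    using linR' linear_conv_bounded_linear linear_continuous_on borel_measurable_continuous_onI by blast
  let ?\<phi> = "\<lambda>y. indicator annulus y *\<^sub>R h (sph_proj y)"
  have "?\<phi> \<in> borel_measurable borel"
    using borel_measurable_integrable[OF sph_integrable[OF h]] by simp
  then have "(\<integral>y. ?\<phi> y \<partial>(distr lborel borel R')) = (\<integral>y. ?\<phi> (R' y) \<partial>lborel)"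
    using meas by (intro integral_distr) auto
  moreover have "?\<phi> (R' y) = indicator annulus y *\<^sub>R h (R (sph_proj y))" for y
    by (simp add: proj indicator_def annulus_def nR')
  ultimately show ?thesis
    by (simp add: sph_int_def lborel_distr_orthogonal[OF R'])
qed

lemma sph_int_tendsto:
  assumes f: "\<And>n. continuous_on (sphere 0 1) (f n)" and g: "continuous_on (sphere 0 1) g"
    and lim: "\<And>x. x \<in> sphere 0 1 \<Longrightarrow> (\<lambda>n. f n x) \<longlonglongrightarrow> g x"
    and bd: "\<And>n x. x \<in> sphere 0 1 \<Longrightarrow> \<bar>f n x\<bar> \<le> B"
  shows "(\<lambda>n. sph_int (f n)) \<longlonglongrightarrow> sph_int g"
  unfolding sph_int_def
proof (rule integral_dominated_convergence)
  show "integrable lborel (\<lambda>y. indicator annulus y *\<^sub>R (\<lambda>_. B) (sph_proj y))"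
    by (rule sph_integrable) simp
  show "AE y in lborel. (\<lambda>n. indicator annulus y *\<^sub>R f n (sph_proj y)) \<longlonglongrightarrow> indicator annulus y *\<^sub>R g (sph_proj y)"
    using lim sph_proj_mem annulus_nonzero
    by (intro AE_I2) (auto simp: indicator_def simp del: mem_sphere)
  show "AE y in lborel. norm (indicator annulus y *\<^sub>R f n (sph_proj y)) \<le> indicator annulus y *\<^sub>R (\<lambda>_. B) (sph_proj y)" for n
    using bd sph_proj_mem annulus_nonzero
    by (intro AE_I2) (auto simp: indicator_def simp del: mem_sphere)
qed (use sph_integrable[OF f] sph_integrable[OF g] in \<open>auto simp: borel_measurable_integrable\<close>)

text \<open>The points of the open annulus lying over the nonvanishing set of \<open>h\<close> form
  an open set; it contains x scaled to the middle radius 3/2, hence has positive measure.\<close>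

lemma sph_int_square_eq_0:
  fixes h :: "real ^ 'n::finite \<Rightarrow> real"
  assumes h: "continuous_on (sphere 0 1) h" and zero: "sph_int (\<lambda>x. h x * h x) = 0" and x: "x \<in> sphere 0 1"
  shows "h x = 0"
proof (rule ccontr)
  assume nz: "h x \<noteq> 0"
  define V where "V = {y :: real ^ ('n idx). 1 < norm y \<and> norm y < 2}"
  define O' where "O' = {y \<in> V. h (sph_proj y) \<noteq> 0}"
  have "V = ball 0 2 - cball 0 1" by (auto simp: V_def)
  then have "open V" by auto
  moreover have "continuous_on V (\<lambda>y. h (sph_proj y))"
    using h by (intro continuous_on_sph_proj_comp) (auto simp: V_def)
  ultimately have "open (V \<inter> (\<lambda>y. h (sph_proj y)) -` (- {0}))"
    by (intro continuous_open_preimage) auto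
  moreover have "V \<inter> (\<lambda>y. h (sph_proj y)) -` (- {0}) = O'" by (auto simp: O'_def)
  ultimately have "open O'" by simp
  moreover have "(3/2) *\<^sub>R from_vec x \<in> O'"
  proof -
    have "sph_proj ((3/2) *\<^sub>R from_vec x) = x"
      using x by (simp add: sph_proj_def)
    then show ?thesis using x nz by (simp add: O'_def V_def)
  qed
  ultimately have "\<not> negligible O'" using open_not_negligible by blast
  moreover have "negligible O'"
  proof -
    have cont: "continuous_on (sphere 0 1) (\<lambda>x. h x * h x)" using h by (intro continuous_intros)
    have "AE y in lborel. indicator annulus y *\<^sub>R (h (sph_proj y) * h (sph_proj y)) = 0"
      using zero sph_integrable[OF cont] unfolding sph_int_def
      by (subst (asm) integral_nonneg_eq_0_iff_AE) (auto simp: indicator_def)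
    then have "AE y in lborel. y \<notin> O'"
      by eventually_elim (auto simp: O'_def V_def annulus_def indicator_def split: if_splits)
    then have "AE y in lebesgue. y \<notin> O'" by (rule AE_completion)
    then have "O' \<in> null_sets lebesgue"
      using \<open>open O'\<close> by (subst AE_iff_null_sets) auto
    then show ?thesis by (simp add: negligible_iff_null_sets)
  qed
  ultimately show False by blast
qed

text \<open>The flow of \<^const>\<open>rot_gen\<close>.\<close>

definition rot :: "'n \<Rightarrow> 'n \<Rightarrow> real \<Rightarrow> real ^ 'n \<Rightarrow> real ^ 'n" where
  "rot i j t x = (if i = j then x else
     x + (cos t - 1) *\<^sub>R (x $ i *\<^sub>R axis i 1 + x $ j *\<^sub>R axis j 1) + sin t *\<^sub>R rot_gen i j x)"

lemma rot_orthogonal: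
  fixes i j :: "'n::finite"
  shows "orthogonal_transformation (rot i j t)"
proof (cases "i = j")
  case False
  have "linear (rot i j t)"
    by (rule linearI) (simp_all add: rot_def rot_gen_def algebra_simps)
  moreover have "norm (rot i j t x) = norm x" for x
  proof -
    have a: "axis i 1 \<bullet> (axis i 1 :: real ^ 'n) = 1" "axis j 1 \<bullet> (axis j 1 :: real ^ 'n) = 1"
      "axis i 1 \<bullet> (axis j 1 :: real ^ 'n) = 0" "axis j 1 \<bullet> (axis i 1 :: real ^ 'n) = 0"
      using False by (simp_all add: inner_axis_axis)
    define p q where "p = x $ i" and "q = x $ j"
    have x: "x \<bullet> axis i 1 = p" "x \<bullet> axis j 1 = q" "axis i 1 \<bullet> x = p" "axis j 1 \<bullet> x = q"
      by (simp_all add: inner_axis inner_axis' p_def q_def)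
    define c s where "c = cos t" and "s = sin t"
    have cs: "s * s = 1 - c * c" using sin_cos_squared_add2[of t] by (simp add: c_def s_def algebra_simps)
    have r: "rot i j t x = x + ((c - 1) * p - s * q) *\<^sub>R axis i 1 + ((c - 1) * q + s * p) *\<^sub>R axis j 1"
      using False by (simp add: rot_def rot_gen_def p_def q_def c_def s_def algebra_simps)
    have "rot i j t x \<bullet> rot i j t x = x \<bullet> x + 2 * ((c - 1) * p - s * q) * p + 2 * ((c - 1) * q + s * p) * q
       + ((c - 1) * p - s * q)\<^sup>2 + ((c - 1) * q + s * p)\<^sup>2"
      unfolding r by (simp add: inner_add a x algebra_simps power2_eq_square)
    also have "\<dots> = x \<bullet> x + (c * c + s * s - 1) * (p * p + q * q)"
      by (simp add: algebra_simps power2_eq_square)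
    also have "\<dots> = x \<bullet> x" by (simp add: cs)
    finally show ?thesis by (simp add: norm_eq_sqrt_inner)
  qed
  ultimately show ?thesis by (simp add: orthogonal_transformation)
qed (simp add: rot_def[abs_def])

lemma rot_0 [simp]: "rot i j 0 x = x"
  by (simp add: rot_def)

lemma rot_mem_sphere: "x \<in> sphere 0 1 \<Longrightarrow> rot i j t x \<in> sphere 0 1"
  using orthogonal_transformation_norm[OF rot_orthogonal, of i j t x] by simp

text \<open>The flow equation at every time, not only at 0: the mean value estimate for difference
  quotients needs intermediate times.\<close>

lemma rot_has_derivative:
  "((\<lambda>t. rot i j t x) has_derivative (\<lambda>s. s *\<^sub>R rot_gen i j (rot i j t x))) (at t)"
proof (cases "i = j")
  case True
  then show ?thesis by (simp add: rot_def rot_gen_def)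
next
  case False
  let ?D = "\<lambda>s. (- (s * sin t)) *\<^sub>R (x $ i *\<^sub>R axis i 1 + x $ j *\<^sub>R axis j 1) + (s * cos t) *\<^sub>R rot_gen i j x"
  have "((\<lambda>t. rot i j t x) has_derivative ?D) (at t)"
    using False unfolding rot_def by (auto intro!: derivative_eq_intros)
  moreover have "?D = (\<lambda>s. s *\<^sub>R rot_gen i j (rot i j t x))"
    using False by (auto simp: fun_eq_iff vec_eq_iff rot_def rot_gen_def axis_def algebra_simps)
  ultimately show ?thesis by simp
qed

lemma has_real_derivative_along_rot:
  fixes h :: "real ^ 'n \<Rightarrow> real"
  assumes h: "C1_sphere h" and x: "x \<in> sphere 0 1"
  shows "((\<lambda>t. h (rot i j t x)) has_real_derivative rot_deriv i j h (rot i j t x)) (at t)"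
proof -
  let ?y = "rot i j t x"
  have y: "?y \<in> sphere 0 1" using x by (rule rot_mem_sphere)
  obtain U F g where U: "open U" "?y \<in> U" "\<And>y. y \<in> U \<Longrightarrow> y \<in> sphere 0 1 \<Longrightarrow> F y = h y"
     "\<And>y. y \<in> U \<Longrightarrow> (F has_derivative (\<lambda>v. g y \<bullet> v)) (at y)"
    using h y by (rule C1_sphereE) blast
  have "(h has_derivative (\<lambda>v. g ?y \<bullet> v)) (at ?y within sphere 0 1)"
    using has_derivative_within_sphere[OF U(1,2) y U(3) U(4)[OF U(2)]] .
  then have "(h has_derivative (\<lambda>v. g ?y \<bullet> v)) (at ?y within range (\<lambda>t. rot i j t x))"
    by (rule has_derivative_subset) (use rot_mem_sphere[OF x] in blast)
  then have D: "((\<lambda>t. h (rot i j t x)) has_derivative (\<lambda>s. g ?y \<bullet> (s *\<^sub>R rot_gen i j ?y))) (at t)"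
    by (rule has_derivative_in_compose[OF rot_has_derivative])
  have "rot_deriv i j h ?y = g ?y \<bullet> rot_gen i j ?y"
    using rot_deriv_eq[OF U(1,2) y U(3) U(4)[OF U(2)]] .
  then show ?thesis unfolding has_field_derivative_def
    by (intro has_derivative_eq_rhs[OF D]) (simp add: fun_eq_iff mult.commute)
qed

lemma continuous_on_rot_deriv:
  fixes h :: "real ^ 'n \<Rightarrow> real"
  assumes h: "C1_sphere h" shows "continuous_on (sphere 0 1) (rot_deriv i j h)"
  unfolding continuous_on_eq_continuous_within
proof
  fix x :: "real ^ 'n" assume x: "x \<in> sphere 0 1"
  obtain U F g where U: "open U" "x \<in> U" "\<And>y. y \<in> U \<Longrightarrow> y \<in> sphere 0 1 \<Longrightarrow> F y = h y"
     "\<And>y. y \<in> U \<Longrightarrow> (F has_derivative (\<lambda>v. g y \<bullet> v)) (at y)" "continuous_on U g"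
    using h x by (rule C1_sphereE) blast
  have eq: "rot_deriv i j h y = g y \<bullet> rot_gen i j y" if "y \<in> U" "y \<in> sphere 0 1" for y
    using rot_deriv_eq[OF U(1) that U(3) U(4)[OF that(1)]] .
  have "continuous_on U (rot_gen i j)"
    using linear_rot_gen linear_conv_bounded_linear linear_continuous_on by blast
  then have "continuous_on U (\<lambda>y. g y \<bullet> rot_gen i j y)"
    using U(5) by (intro continuous_intros)
  then have "((\<lambda>y. g y \<bullet> rot_gen i j y) \<longlongrightarrow> g x \<bullet> rot_gen i j x) (at x)"
    using U(1,2) by (simp add: continuous_on_eq_continuous_at isCont_def)
  then have "((\<lambda>y. g y \<bullet> rot_gen i j y) \<longlongrightarrow> g x \<bullet> rot_gen i j x) (at x within sphere 0 1)"
    by (rule tendsto_within_subset) simp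
  moreover have "\<forall>\<^sub>F y in at x within sphere 0 1. g y \<bullet> rot_gen i j y = rot_deriv i j h y"
    unfolding eventually_at_topological using U eq by (intro exI[of _ U]) auto
  ultimately have "(rot_deriv i j h \<longlongrightarrow> g x \<bullet> rot_gen i j x) (at x within sphere 0 1)"
    by (rule Lim_transform_eventually)
  then show "continuous (at x within sphere 0 1) (rot_deriv i j h)"
    using eq[OF U(2) x] by (simp add: continuous_within)
qed

text \<open>Differentiating the rotation invariance of the integral.\<close>

lemma sph_int_rot_deriv:
  fixes h :: "real ^ 'n \<Rightarrow> real"
  assumes h: "C1_sphere h" shows "sph_int (rot_deriv i j h) = 0"
proof -
  let ?h' = "rot_deriv i j h"
  define t where "t n = inverse (real (Suc n))" for n
  define f where "f n x = (h (rot i j (t n) x) - h x) / t n" for n x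
  have t: "t n > 0" for n by (simp add: t_def)
  have hc: "continuous_on (sphere 0 1) h" using h by (rule C1_sphere_continuous)
  have hrc: "continuous_on (sphere 0 1) (\<lambda>x. h (rot i j s x))" for s
  proof (rule continuous_on_compose2[OF hc])
    show "continuous_on (sphere 0 1) (rot i j s)"
      using orthogonal_transformation_linear[OF rot_orthogonal] linear_conv_bounded_linear linear_continuous_on by blast
  qed (use rot_mem_sphere in blast)
  have fc: "continuous_on (sphere 0 1) (f n)" for n
    unfolding f_def[abs_def] using hc hrc t[of n] by (intro continuous_intros) auto
  have h'c: "continuous_on (sphere 0 1) ?h'" using h by (rule continuous_on_rot_deriv)
  obtain B where B: "\<And>x. x \<in> sphere 0 1 \<Longrightarrow> \<bar>?h' x\<bar> \<le> B"
    using compact_imp_bounded[OF compact_continuous_image[OF h'c compact_sphere]]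
    unfolding bounded_iff by (metis imageI real_norm_def)
  have f0: "sph_int (f n) = 0" for n
  proof -
    have "sph_int (f n) = sph_int (\<lambda>x. inverse (t n) * (h (rot i j (t n) x) - h x))"
      by (simp add: f_def[abs_def] divide_inverse mult.commute)
    also have "\<dots> = 0"
      using hc hrc by (simp add: sph_int_scale sph_int_diff sph_int_orthogonal[OF rot_orthogonal hc])
    finally show ?thesis .
  qed
  have "(\<lambda>n. sph_int (f n)) \<longlonglongrightarrow> sph_int ?h'"
  proof (rule sph_int_tendsto[OF fc h'c])
    fix x :: "real ^ 'n" assume x: "x \<in> sphere 0 1"
    have D: "((\<lambda>t. h (rot i j t x)) has_real_derivative ?h' (rot i j s x)) (at s)" for s
      using has_real_derivative_along_rot[OF h x] .
    have "((\<lambda>s. (h (rot i j s x) - h x) / s) \<longlongrightarrow> ?h' x) (at 0)"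
      using D[of 0] by (simp add: has_field_derivative_iff)
    moreover have "filterlim t (at 0) sequentially"
    proof -
      have "t \<longlonglongrightarrow> 0" unfolding t_def by (rule LIMSEQ_inverse_real_of_nat)
      then show ?thesis unfolding filterlim_at using t by (auto simp: less_imp_neq[symmetric])
    qed
    ultimately show "(\<lambda>n. f n x) \<longlonglongrightarrow> ?h' x"
      unfolding f_def by (rule filterlim_compose)
    fix n
    \<comment> \<open>Along the orbit every difference quotient is a value of the derivative, so the
      bound \<open>B\<close> dominates all of them.\<close>
    obtain s where "0 < s" "s < t n" "h (rot i j (t n) x) - h (rot i j 0 x) = (t n - 0) * ?h' (rot i j s x)"
      using MVT2[OF t[of n], of "\<lambda>t. h (rot i j t x)" "\<lambda>s. ?h' (rot i j s x)"] D by blast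
    then have "f n x = ?h' (rot i j s x)" using t[of n] by (simp add: f_def)
    then show "\<bar>f n x\<bar> \<le> B" using B rot_mem_sphere[OF x] by simp
  qed
  then show ?thesis using f0 by (simp add: LIMSEQ_const_iff)
qed

text \<open>Differentiating along the flow at time 0 reduces this to the product rule in one real
  variable.\<close>

lemma rot_deriv_mult:
  fixes f h :: "real ^ 'n \<Rightarrow> real"
  assumes "C1_sphere f" "C1_sphere h" "x \<in> sphere 0 1"
  shows "rot_deriv i j (\<lambda>x. f x * h x) x = rot_deriv i j f x * h x + f x * rot_deriv i j h x"
proof -
  have "((\<lambda>t. f (rot i j t x) * h (rot i j t x)) has_real_derivative
      rot_deriv i j f x * h x + f x * rot_deriv i j h x) (at 0)"
    using has_real_derivative_along_rot[OF assms(1,3), of i j 0] has_real_derivative_along_rot[OF assms(2,3), of i j 0]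
    by (auto intro!: derivative_eq_intros)
  then show ?thesis
    using has_real_derivative_along_rot[OF C1_sphere_mult[OF assms(1,2)] assms(3), of i j 0] DERIV_unique
    by fastforce
qed

lemma sph_int_rot_deriv_parts:
  fixes f h :: "real ^ 'n \<Rightarrow> real"
  assumes f: "C1_sphere f" and h: "C1_sphere h"
  shows "sph_int (\<lambda>x. rot_deriv i j f x * h x) = - sph_int (\<lambda>x. f x * rot_deriv i j h x)"
proof -
  have "0 = sph_int (\<lambda>x. rot_deriv i j f x * h x + f x * rot_deriv i j h x)"
    using sph_int_rot_deriv[OF C1_sphere_mult[OF f h], of i j] rot_deriv_mult[OF f h]
    by (metis (no_types, lifting) sph_int_cong)
  also have "\<dots> = sph_int (\<lambda>x. rot_deriv i j f x * h x) + sph_int (\<lambda>x. f x * rot_deriv i j h x)"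
    using f h by (intro sph_int_add continuous_intros continuous_on_rot_deriv C1_sphere_continuous)
  finally show ?thesis by simp
qed

text \<open>Each rotation derivative is skew for the integral, so two integrations by parts restore
  the sign.\<close>

lemma sphere_laplacian_self_adjoint:
  fixes f h :: "real ^ 'n \<Rightarrow> real"
  assumes f: "C2_sphere f" and h: "C2_sphere h"
  shows "sph_int (\<lambda>x. sphere_laplacian f x * h x) = sph_int (\<lambda>x. f x * sphere_laplacian h x)"
proof -
  note f1 = C1_sphere_if_C2[OF f] and h1 = C1_sphere_if_C2[OF h]
  note fr = C1_sphere_rot_deriv[OF f] and hr = C1_sphere_rot_deriv[OF h]
  have "sph_int (\<lambda>x. sphere_laplacian f x * h x) =
      sph_int (\<lambda>x. (-1/2) * (\<Sum>i\<in>UNIV. \<Sum>j\<in>UNIV. rot_deriv i j (rot_deriv i j f) x * h x))"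
    by (rule sph_int_cong) (simp add: sphere_laplacian_eq_rot_deriv[OF f] sum_distrib_right)
  also have "\<dots> = (-1/2) * (\<Sum>i\<in>UNIV. \<Sum>j\<in>UNIV. sph_int (\<lambda>x. rot_deriv i j (rot_deriv i j f) x * h x))"
    unfolding sph_int_scale
    by (subst sph_int_sum, intro continuous_intros continuous_on_rot_deriv fr C1_sphere_continuous[OF h1],
        subst sph_int_sum, intro continuous_intros continuous_on_rot_deriv fr C1_sphere_continuous[OF h1]) simp
  also have "\<dots> = (-1/2) * (\<Sum>i\<in>UNIV. \<Sum>j\<in>UNIV. sph_int (\<lambda>x. f x * rot_deriv i j (rot_deriv i j h) x))"
    using sph_int_rot_deriv_parts[OF fr h1] sph_int_rot_deriv_parts[OF f1 hr] by simp
  also have "\<dots> = sph_int (\<lambda>x. (-1/2) * (\<Sum>i\<in>UNIV. \<Sum>j\<in>UNIV. f x * rot_deriv i j (rot_deriv i j h) x))"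
    unfolding sph_int_scale
    by (subst sph_int_sum, intro continuous_intros continuous_on_rot_deriv hr C1_sphere_continuous[OF f1],
        subst sph_int_sum, intro continuous_intros continuous_on_rot_deriv hr C1_sphere_continuous[OF f1]) simp
  also have "\<dots> = sph_int (\<lambda>x. f x * sphere_laplacian h x)"
    by (rule sph_int_cong) (simp add: sphere_laplacian_eq_rot_deriv[OF h] sum_distrib_left)
  finally show ?thesis .
qed

section \<open>Spherical harmonics\<close>

lemma monomial_remove:
  assumes "\<alpha> i > 0" shows "monomial l \<alpha> x = l i x * monomial l (\<alpha>(i := \<alpha> i - 1)) x"
proof -
  have "monomial l \<alpha> x = l i x ^ \<alpha> i * (\<Prod>j\<in>UNIV - {i}. l j x ^ \<alpha> j)"
    unfolding monomial_def by (simp add: prod.remove)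
  moreover have "monomial l (\<alpha>(i := \<alpha> i - 1)) x = l i x ^ (\<alpha> i - 1) * (\<Prod>j\<in>UNIV - {i}. l j x ^ (\<alpha>(i := \<alpha> i - 1)) j)"
    unfolding monomial_def by (subst prod.remove[of UNIV i]) auto
  moreover have "(\<Prod>j\<in>UNIV - {i}. l j x ^ (\<alpha>(i := \<alpha> i - 1)) j) = (\<Prod>j\<in>UNIV - {i}. l j x ^ \<alpha> j)"
    by (intro prod.cong) auto
  ultimately show ?thesis using assms by (simp add: power_eq_if)
qed

text \<open>Where the components of the gradient of a form of degree k live. The case k = 0 is
  separate because truncated subtraction would allow nonzero constants.\<close>

definition low_polys :: "nat \<Rightarrow> (real ^ 'n \<Rightarrow> real) set" where
  "low_polys k = (if k = 0 then {\<lambda>x. 0} else hom_polys real_coord (k - 1))"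

lemma low_polys_add: "p \<in> low_polys k \<Longrightarrow> q \<in> low_polys k \<Longrightarrow> (\<lambda>x. p x + q x) \<in> low_polys k"
  by (auto simp: low_polys_def intro: hom_polys_add split: if_splits)

lemma low_polys_scale: "p \<in> low_polys k \<Longrightarrow> (\<lambda>x. c * p x) \<in> low_polys k"
  by (auto simp: low_polys_def intro: hom_polys_scale split: if_splits)

lemma low_polys_zero: "(\<lambda>x. 0) \<in> low_polys k"
  by (auto simp: low_polys_def)

lemma low_polys_sum: "(\<And>i. i \<in> I \<Longrightarrow> p i \<in> low_polys k) \<Longrightarrow> (\<lambda>x. \<Sum>i\<in>I. p i x) \<in> low_polys k"
  by (induction I rule: infinite_finite_induct) (auto simp: low_polys_zero intro: low_polys_add)

lemma low_polys_coord_mult: "p \<in> low_polys k \<Longrightarrow> (\<lambda>x. x $ i * p x) \<in> hom_polys real_coord k"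
  using hom_polys_mult[OF hom_polys_base[of real_coord i], of p "k - 1"]
  by (auto simp: low_polys_def real_coord_def split: if_splits)

lemma inner_zero_fun: "(\<bullet>) (0::'a::real_inner) = (\<lambda>v. 0)"
  by (simp add: fun_eq_iff)

definition has_poly_gradient :: "nat \<Rightarrow> (real ^ 'n \<Rightarrow> real) \<Rightarrow> (real ^ 'n \<Rightarrow> real ^ 'n) \<Rightarrow> bool" where
  "has_poly_gradient k p g \<longleftrightarrow> (\<forall>i. (\<lambda>x. g x $ i) \<in> low_polys k) \<and>
     (\<forall>x. (p has_derivative (\<lambda>v. g x \<bullet> v)) (at x)) \<and> (\<forall>x. g x \<bullet> x = real k * p x)"

text \<open>A monomial of positive degree is a coordinate times a monomial of lower degree, so the
  Leibniz rule yields the gradient; Euler's identity is carried along in the same induction.\<close>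

lemma hom_polys_gradient:
  fixes p :: "real ^ 'n \<Rightarrow> real"
  assumes "p \<in> hom_polys real_coord k"
  shows "\<exists>g. has_poly_gradient k p g"
  using assms
proof (induction k arbitrary: p)
  case (Suc k)
  from Suc.prems show ?case
  proof (induction rule: hom_polys_induct)
    case (monomial \<alpha>)
    then have "\<exists>i. \<alpha> i > 0" unfolding multi_indices_def
      by (metis (mono_tags, lifting) gr0I mem_Collect_eq nat.distinct(1) sum.neutral)
    then obtain i where i: "\<alpha> i > 0" by blast
    define \<beta> where "\<beta> = \<alpha>(i := \<alpha> i - 1)"
    have "sum \<beta> UNIV + 1 = sum \<alpha> UNIV"
    proof -
      have "sum \<alpha> UNIV = \<alpha> i + sum \<alpha> (UNIV - {i})" by (simp add: sum.remove)
      moreover have "sum \<beta> UNIV = \<beta> i + sum \<beta> (UNIV - {i})" by (simp add: sum.remove)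
      moreover have "sum \<beta> (UNIV - {i}) = sum \<alpha> (UNIV - {i})" by (intro sum.cong) (auto simp: \<beta>_def)
      ultimately show ?thesis using i by (simp add: \<beta>_def)
    qed
    then have "\<beta> \<in> multi_indices k" using monomial by (simp add: multi_indices_def)
    then have q: "monomial real_coord \<beta> \<in> hom_polys real_coord k" by (rule hom_polys_monomial)
    define q where "q = monomial real_coord \<beta>"
    obtain g where g: "has_poly_gradient k q g" using Suc.IH[OF q] unfolding q_def by blast
    have p: "monomial real_coord \<alpha> = (\<lambda>x. x $ i * q x)"
      by (rule ext) (simp add: monomial_remove[where \<alpha> = \<alpha> and i = i, OF i] q_def \<beta>_def real_coord_def)
    let ?g = "\<lambda>x. q x *\<^sub>R axis i 1 + x $ i *\<^sub>R g x"
    have "(\<lambda>x. ?g x $ j) \<in> low_polys (Suc k)" for j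
    proof -
      have "(\<lambda>x. x $ i * g x $ j) \<in> hom_polys real_coord k"
        using g low_polys_coord_mult unfolding has_poly_gradient_def by blast
      moreover have "(\<lambda>x. (axis i 1 $ j) * q x) \<in> hom_polys real_coord k"
        using q unfolding q_def by (rule hom_polys_scale)
      ultimately have "(\<lambda>x. (axis i 1 $ j) * q x + x $ i * g x $ j) \<in> hom_polys real_coord k"
        by (intro hom_polys_add)
      then show ?thesis by (simp add: low_polys_def mult.commute)
    qed
    moreover have "((\<lambda>x. x $ i * q x) has_derivative (\<lambda>v. ?g x \<bullet> v)) (at x)" for x
    proof -
      have "(q has_derivative (\<lambda>v. g x \<bullet> v)) (at x)" using g by (simp add: has_poly_gradient_def)
      moreover have "((\<lambda>x. x $ i) has_derivative (\<lambda>v. v $ i)) (at x)"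
        by (rule linear_imp_has_derivative) (simp add: linear_iff)
      ultimately have "((\<lambda>x. x $ i * q x) has_derivative (\<lambda>v. x $ i * (g x \<bullet> v) + v $ i * q x)) (at x)"
        by (intro has_derivative_mult)
      then show ?thesis
        by (rule has_derivative_eq_rhs) (auto simp: inner_add_left inner_axis' fun_eq_iff)
    qed
    moreover have "?g x \<bullet> x = real (Suc k) * (x $ i * q x)" for x
      using g by (simp add: has_poly_gradient_def inner_add_left inner_axis' algebra_simps)
    ultimately show ?case unfolding p has_poly_gradient_def by (intro exI[of _ ?g]) simp
  next
    case (add p q)
    then obtain g h where "has_poly_gradient (Suc k) p g" "has_poly_gradient (Suc k) q h" by blast
    then have "has_poly_gradient (Suc k) (\<lambda>x. p x + q x) (\<lambda>x. g x + h x)"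
      unfolding has_poly_gradient_def
      by (auto simp: inner_add_left algebra_simps low_polys_add intro!: derivative_eq_intros)
    then show ?case by blast
  next
    case (scale c p)
    then obtain g where "has_poly_gradient (Suc k) p g" by blast
    then have "has_poly_gradient (Suc k) (\<lambda>x. c * p x) (\<lambda>x. c *\<^sub>R g x)"
      unfolding has_poly_gradient_def by (auto simp: low_polys_scale intro!: derivative_eq_intros)
    then show ?case by blast
  next
    case zero
    have "has_poly_gradient (Suc k) (\<lambda>x. 0) (\<lambda>x. 0)"
      unfolding has_poly_gradient_def by (auto simp: low_polys_zero inner_zero_fun)
    then show ?case by blast
  qed
next
  case 0
  then obtain c where "p = (\<lambda>x. c)"
    unfolding hom_polys_def multi_indices_0 by (auto simp: monomial_def)
  then have "has_poly_gradient 0 p (\<lambda>x. 0)" by (simp add: has_poly_gradient_def low_polys_def inner_zero_fun)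
  then show ?case by blast
qed

lemma hom_polys_continuous:
  assumes "p \<in> hom_polys real_coord k" shows "continuous_on A (p :: real ^ 'n \<Rightarrow> real)"
proof -
  obtain g where "\<And>x. (p has_derivative (\<lambda>v. g x \<bullet> v)) (at x)"
    using hom_polys_gradient[OF assms] unfolding has_poly_gradient_def by blast
  then show ?thesis using has_derivative_continuous by (blast intro: continuous_at_imp_continuous_on)
qed

lemma low_polys_subset: "p \<in> low_polys k \<Longrightarrow> p \<in> hom_polys real_coord (k - 1)"
  by (auto simp: low_polys_def split: if_splits)

text \<open>Where the Euclidean Laplacian of a form of degree k lives. As for
  \<open>low_polys\<close>, small degrees are separated because of truncated subtraction.\<close>

definition lap_polys :: "nat \<Rightarrow> (real ^ 'n \<Rightarrow> real) set" where
  "lap_polys k = (if k < 2 then {\<lambda>x. 0} else hom_polys real_coord (k - 2))"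

text \<open>The gradient lemma is applied once more to each component of the gradient; Euler's
  identity used twice gives the second radial derivative.\<close>

lemma hom_polys_hessian:
  fixes p :: "real ^ 'n \<Rightarrow> real"
  assumes "p \<in> hom_polys real_coord k"
  shows "\<exists>g H. (\<forall>x. (p has_derivative (\<lambda>v. g x \<bullet> v)) (at x)) \<and> (\<forall>x. (g has_derivative H x) (at x)) \<and>
    (\<forall>v. continuous_on UNIV (\<lambda>x. H x v)) \<and> (\<lambda>x. \<Sum>i\<in>UNIV. H x (axis i 1) $ i) \<in> lap_polys k \<and>
    (\<forall>x. g x \<bullet> x = real k * p x) \<and> (\<forall>x. x \<bullet> H x x = real k * (real k - 1) * p x)"
proof -
  obtain g where g: "has_poly_gradient k p g" using hom_polys_gradient[OF assms] by blast
  have "\<forall>i. \<exists>G. has_poly_gradient (k - 1) (\<lambda>x. g x $ i) G"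
  proof
    fix i
    have "(\<lambda>x. g x $ i) \<in> low_polys k" using g unfolding has_poly_gradient_def by blast
    then show "\<exists>G. has_poly_gradient (k - 1) (\<lambda>x. g x $ i) G"
      using hom_polys_gradient[OF low_polys_subset] by blast
  qed
  then obtain G where G: "\<And>i. has_poly_gradient (k - 1) (\<lambda>x. g x $ i) (G i)" by metis
  define H where "H x v = (\<chi> i. G i x \<bullet> v)" for x v
  have "(g has_derivative H x) (at x)" for x
    by (rule has_derivative_componentwise) (use G in \<open>simp add: H_def has_poly_gradient_def\<close>)
  moreover have "continuous_on UNIV (\<lambda>x. H x v)" for v
  proof -
    have "continuous_on UNIV (\<lambda>x. G i x $ j)" for i j
      using G low_polys_subset hom_polys_continuous unfolding has_poly_gradient_def by blast
    then show ?thesis unfolding H_def inner_vec_def inner_real_def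
      by (intro continuous_on_vec_lambda continuous_on_sum continuous_on_mult continuous_on_const)
  qed
  moreover have "(\<lambda>x. \<Sum>i\<in>UNIV. H x (axis i 1) $ i) \<in> lap_polys k"
  proof (cases "k = 0")
    case True
    have g0: "g x = 0" for x
      using g True by (simp add: has_poly_gradient_def low_polys_def vec_eq_iff) meson
    have "G i x = 0" for i x
      using G[of i] True by (simp add: has_poly_gradient_def low_polys_def vec_eq_iff) meson
    then show ?thesis using True by (simp add: H_def lap_polys_def)
  next
    case False
    have "(\<lambda>x. \<Sum>i\<in>UNIV. G i x $ i) \<in> low_polys (k - 1)"
      using G unfolding has_poly_gradient_def by (intro low_polys_sum) blast
    moreover have "(low_polys (k - 1) :: (real ^ 'n \<Rightarrow> real) set) = lap_polys k" using False
      by (auto simp: low_polys_def lap_polys_def numeral_2_eq_2)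
    ultimately show ?thesis by (simp add: H_def inner_axis)
  qed
  moreover have "x \<bullet> H x x = real k * (real k - 1) * p x" for x
  proof -
    have "x \<bullet> H x x = (\<Sum>i\<in>UNIV. x $ i * (real (k - 1) * g x $ i))"
      using G by (simp add: H_def inner_vec_def[of x] has_poly_gradient_def)
    also have "\<dots> = real (k - 1) * (g x \<bullet> x)"
      by (simp add: inner_vec_def sum_distrib_left mult_ac)
    also have "\<dots> = real (k - 1) * (real k * p x)" using g by (simp add: has_poly_gradient_def)
    also have "\<dots> = real k * (real k - 1) * p x" by (cases k) simp_all
    finally show ?thesis .
  qed
  ultimately show ?thesis using g unfolding has_poly_gradient_def
    by (intro exI[of _ g] exI[of _ H]) simp
qed

lemma C2_sphere_hom_polys:
  fixes p :: "real ^ 'n \<Rightarrow> real"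
  assumes "p \<in> hom_polys real_coord k" shows "C2_sphere p"
proof -
  obtain g H where "\<forall>x. (p has_derivative (\<lambda>v. g x \<bullet> v)) (at x)" "\<forall>x. (g has_derivative H x) (at x)"
    "\<forall>v. continuous_on UNIV (\<lambda>x. H x v)"
    using hom_polys_hessian[OF assms] by (elim exE conjE)
  then show ?thesis unfolding C2_sphere_def
    by (intro ballI exI[of _ UNIV] exI[of _ p] exI[of _ g] exI[of _ H]) simp
qed

text \<open>With N = q + 1 this is k (k + q - 1).\<close>

definition sph_eigenvalue :: "nat \<Rightarrow> nat \<Rightarrow> real" where
  "sph_eigenvalue N k = real k * (real k + real N - 2)"

text \<open>Euler's identities turn the radial terms into k (k - 1) + (N - 1) k = k (k + N - 2)
  times the form; \<open>L\<close> is its Euclidean Laplacian.\<close>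

lemma sphere_laplacian_hom_polys:
  fixes p :: "real ^ 'n \<Rightarrow> real"
  assumes "p \<in> hom_polys real_coord k"
  shows "\<exists>L\<in>lap_polys k. \<forall>x\<in>sphere 0 1. sphere_laplacian p x = sph_eigenvalue CARD('n) k * p x - L x"
proof -
  obtain g H where *: "\<forall>x. (p has_derivative (\<lambda>v. g x \<bullet> v)) (at x)" "\<forall>x. (g has_derivative H x) (at x)"
    "(\<lambda>x. \<Sum>i\<in>UNIV. H x (axis i 1) $ i) \<in> lap_polys k"
    "\<forall>x. g x \<bullet> x = real k * p x" "\<forall>x. x \<bullet> H x x = real k * (real k - 1) * p x"
    using hom_polys_hessian[OF assms] by (elim exE conjE)
  show ?thesis
  proof (intro bexI[OF _ *(3)] ballI)
    fix x :: "real ^ 'n" assume x: "x \<in> sphere 0 1"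
    have "sphere_laplacian p x =
      - ((\<Sum>i\<in>UNIV. H x (axis i 1) $ i) - x \<bullet> H x x - (real CARD('n) - 1) * (g x \<bullet> x))"
      using x *(1,2) by (intro sphere_laplacian_eq[of UNIV x p]) auto
    also have "x \<bullet> H x x = real k * (real k - 1) * p x" using *(5) by blast
    also have "g x \<bullet> x = real k * p x" using *(4) by blast
    finally show "sphere_laplacian p x = sph_eigenvalue CARD('n) k * p x - (\<Sum>i\<in>UNIV. H x (axis i 1) $ i)"
      by (simp add: sph_eigenvalue_def algebra_simps)
  qed
qed

lemma Ck_on_hom_polys:
  fixes p :: "real ^ 'n \<Rightarrow> real"
  assumes "p \<in> hom_polys real_coord j" shows "Ck_on k p U"
  using assms
proof (induction k arbitrary: p j)
  case 0
  then show ?case using hom_polys_continuous by simp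
next
  case (Suc k)
  obtain g where g: "has_poly_gradient j p g" using hom_polys_gradient[OF Suc.prems] by blast
  then have D: "(p has_derivative (\<lambda>v. g x \<bullet> v)) (at x)" for x by (simp add: has_poly_gradient_def)
  have "frechet_derivative p (at x) = (\<lambda>v. g x \<bullet> v)" for x using frechet_derivative_at[OF D] by simp
  moreover
  have "(\<lambda>x. g x \<bullet> v) \<in> low_polys j" for v
  proof -
    have "(\<lambda>x. \<Sum>i\<in>UNIV. v $ i * g x $ i) \<in> low_polys j"
      using g unfolding has_poly_gradient_def by (intro low_polys_sum low_polys_scale) blast
    then show ?thesis by (simp add: inner_vec_def mult.commute)
  qed
  then have "Ck_on k (\<lambda>x. g x \<bullet> v) U" for v using Suc.IH[OF low_polys_subset] by blast
  moreover have "p differentiable at x" for x using D differentiable_def by blast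
  ultimately show ?case by simp
qed

lemma smooth_on_sphere_if_eq_hom_poly:
  assumes "p \<in> hom_polys real_coord k" "\<And>x. x \<in> sphere 0 1 \<Longrightarrow> f x = p x"
  shows "smooth_on_sphere f"
  unfolding smooth_on_sphere_def using assms Ck_on_hom_polys
  by (intro ballI exI[of _ UNIV] exI[of _ p]) auto

lemma hom_polys_homogeneous:
  assumes "p \<in> hom_polys real_coord k" shows "p (c *\<^sub>R x) = c ^ k * p x"
  using assms
proof (induction rule: hom_polys_induct)
  case (monomial \<alpha>)
  have "monomial real_coord \<alpha> (c *\<^sub>R x) = c ^ (sum \<alpha> UNIV) * monomial real_coord \<alpha> x"
    by (simp add: monomial_def real_coord_def power_mult_distrib prod.distrib power_sum)
  then show ?case using monomial by (simp add: multi_indices_def)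
qed (auto simp: algebra_simps)

lemma hom_polys_eq_if_eq_on_sphere:
  fixes p :: "real ^ 'n \<Rightarrow> real"
  assumes "p \<in> hom_polys real_coord k" "q \<in> hom_polys real_coord k"
    and eq: "\<And>x. x \<in> sphere 0 1 \<Longrightarrow> p x = q x"
  shows "p = q"
proof
  fix x :: "real ^ 'n"
  obtain y where y: "y \<in> sphere 0 1" "x = norm x *\<^sub>R y"
  proof (cases "x = 0")
    case True
    obtain y :: "real ^ 'n" where "norm y = 1" using vector_choose_size[of 1] by auto
    then show ?thesis using that[of y] True by simp
  next
    case False
    then show ?thesis using that[of "inverse (norm x) *\<^sub>R x"] by simp
  qed
  have "p x = norm x ^ k * p y" "q x = norm x ^ k * q y"
    using hom_polys_homogeneous[OF assms(1), of "norm x" y] hom_polys_homogeneous[OF assms(2), of "norm x" y] y(2)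
    by metis+
  then show "p x = q x" using eq[OF y(1)] by simp
qed

definition radial_mult :: "(real ^ 'n \<Rightarrow> real) \<Rightarrow> real ^ 'n \<Rightarrow> real" where
  "radial_mult p x = (x \<bullet> x) * p x"

lemma radial_mult_hom_polys:
  fixes p :: "real ^ 'n \<Rightarrow> real"
  assumes "p \<in> hom_polys real_coord k" shows "radial_mult p \<in> hom_polys real_coord (Suc (Suc k))"
proof -
  have "(\<lambda>x. real_coord i x * real_coord i x) \<in> hom_polys real_coord (1 + 1)" for i :: 'n
    by (intro hom_polys_mult hom_polys_base)
  then have "(\<lambda>x. \<Sum>i\<in>UNIV. real_coord i x * real_coord i x) \<in> hom_polys (real_coord :: 'n \<Rightarrow> _) (1 + 1)"
    by (intro hom_polys_sum)
  then have "(\<lambda>x :: real ^ 'n. x \<bullet> x) \<in> hom_polys real_coord (1 + 1)"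
    by (simp add: inner_vec_def real_coord_def)
  from hom_polys_mult[OF this assms] show ?thesis by (simp add: radial_mult_def[abs_def])
qed

lemma radial_mult_lap_polys: "p \<in> lap_polys k \<Longrightarrow> radial_mult p \<in> hom_polys real_coord k"
proof (cases "k < 2")
  case False
  assume "p \<in> lap_polys k"
  then have "radial_mult p \<in> hom_polys real_coord (Suc (Suc (k - 2)))"
    using False by (intro radial_mult_hom_polys) (simp add: lap_polys_def)
  then show ?thesis using False by (simp add: numeral_2_eq_2 Suc_diff_Suc)
qed (auto simp: lap_polys_def radial_mult_def[abs_def])

lemma radial_mult_sphere: "x \<in> sphere 0 1 \<Longrightarrow> radial_mult p x = p x"
  by (simp add: radial_mult_def dot_square_norm)

section \<open>The inner product and orthogonal projection\<close>

definition sph_ip :: "(real ^ 'n \<Rightarrow> real) \<Rightarrow> (real ^ 'n \<Rightarrow> real) \<Rightarrow> real" where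
  "sph_ip f h = sph_int (\<lambda>x. f x * h x)"

abbreviation sph_cont :: "(real ^ 'n \<Rightarrow> real) \<Rightarrow> bool" where
  "sph_cont f \<equiv> continuous_on (sphere 0 1) f"

lemma sph_ip_commute: "sph_ip f h = sph_ip h f"
  by (simp add: sph_ip_def mult.commute)

lemma sph_ip_cong:
  "(\<And>x. x \<in> sphere 0 1 \<Longrightarrow> f x = f' x) \<Longrightarrow> (\<And>x. x \<in> sphere 0 1 \<Longrightarrow> h x = h' x) \<Longrightarrow> sph_ip f h = sph_ip f' h'"
  unfolding sph_ip_def by (rule sph_int_cong) simp

lemma sph_ip_add_right:
  assumes "sph_cont f" "sph_cont h" "sph_cont k" shows "sph_ip f (\<lambda>x. h x + k x) = sph_ip f h + sph_ip f k"
  unfolding sph_ip_def distrib_left using assms by (intro sph_int_add continuous_intros)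

lemma sph_ip_diff_left:
  assumes "sph_cont f" "sph_cont h" "sph_cont k" shows "sph_ip (\<lambda>x. h x - k x) f = sph_ip h f - sph_ip k f"
  unfolding sph_ip_def left_diff_distrib using assms by (intro sph_int_diff continuous_intros)

lemma sph_ip_scale_right: "sph_ip f (\<lambda>x. c * h x) = c * sph_ip f h"
  unfolding sph_ip_def by (simp add: mult.left_commute flip: sph_int_scale)

lemma sph_ip_scale_left: "sph_ip (\<lambda>x. c * h x) f = c * sph_ip h f"
  by (metis sph_ip_commute sph_ip_scale_right)

lemma sph_ip_zero_iff: "sph_cont f \<Longrightarrow> sph_ip f f = 0 \<Longrightarrow> x \<in> sphere 0 1 \<Longrightarrow> f x = 0"
  unfolding sph_ip_def by (rule sph_int_square_eq_0)

lemma sph_cont_span: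
  assumes "\<And>b. b \<in> B \<Longrightarrow> sph_cont b" "q \<in> fun_space.span B" shows "sph_cont q"
  using assms(2)
proof (induction rule: fun_space.span_induct_alt)
  case base
  then show ?case by (simp add: zero_fun_def)
next
  case (step c b q)
  then have "sph_cont (\<lambda>x. c * b x + q x)" using assms(1) by (intro continuous_intros) auto
  then show ?case by (simp add: plus_fun_def)
qed

text \<open>Gram-Schmidt, one vector at a time: b' is \<open>b\<close> minus its projection to the
  span of \<open>B\<close>, so correcting by a multiple of b' keeps the orthogonality already
  achieved.\<close>

lemma sph_projection:
  assumes "finite B" "\<And>b. b \<in> B \<Longrightarrow> sph_cont b" "sph_cont f"
  shows "\<exists>q\<in>fun_space.span B. \<forall>b\<in>fun_space.span B. sph_ip (\<lambda>x. f x - q x) b = 0"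
  using assms
proof (induction B arbitrary: f rule: finite_induct)
  case empty
  show ?case
    by (intro bexI[of _ 0]) (auto simp: sph_ip_def)
next
  case (insert b B)
  have bc: "sph_cont b" and Bc: "\<And>s. s \<in> fun_space.span B \<Longrightarrow> sph_cont s"
    using insert.prems sph_cont_span by blast+
  obtain q where q: "q \<in> fun_space.span B" "\<And>s. s \<in> fun_space.span B \<Longrightarrow> sph_ip (\<lambda>x. f x - q x) s = 0"
    using insert.IH[of f] insert.prems by blast
  obtain r where r: "r \<in> fun_space.span B" "\<And>s. s \<in> fun_space.span B \<Longrightarrow> sph_ip (\<lambda>x. b x - r x) s = 0"
    using insert.IH[of b] insert.prems bc by blast
  define b' where "b' x = b x - r x" for x
  define f' where "f' x = f x - q x" for x
  have qc: "sph_cont q" and rc: "sph_cont r" using Bc q r by auto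
  have b'c: "sph_cont b'" and f'c: "sph_cont f'"
    unfolding b'_def f'_def using qc rc bc insert.prems by (auto intro!: continuous_intros)
  \<comment> \<open>If b' has norm 0, this quotient is 0. The form is only semidefinite on functions
    on the whole space, so b' may then be a nonzero function, but it vanishes on the sphere.\<close>
  define c where "c = sph_ip f' b' / sph_ip b' b'"
  define p where "p x = q x + c * b' x" for x
  have "p = q + (\<lambda>x. c * (b - r) x)" by (simp add: p_def b'_def fun_eq_iff)
  moreover have "q \<in> fun_space.span (insert b B)" "r \<in> fun_space.span (insert b B)"
    using q(1) r(1) fun_space.span_mono[of B "insert b B"] by blast+
  moreover have "b - r \<in> fun_space.span (insert b B)"
    by (rule fun_space.span_diff[OF fun_space.span_base calculation(3)]) simp
  ultimately have p_span: "p \<in> fun_space.span (insert b B)"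
    using fun_space.span_add fun_space.span_scale by metis
  have fp: "(\<lambda>x. f x - p x) = (\<lambda>x. f' x - c * b' x)" by (simp add: p_def f'_def fun_eq_iff)
  have cb'c: "sph_cont (\<lambda>x. c * b' x)" using b'c by (intro continuous_intros)
  have pB: "sph_ip (\<lambda>x. f x - p x) s = 0" if "s \<in> fun_space.span B" for s
    unfolding fp using sph_ip_diff_left[OF Bc[OF that] f'c cb'c] q(2)[OF that] r(2)[OF that]
    by (simp add: sph_ip_scale_left f'_def[abs_def] b'_def[abs_def])
  have pb': "sph_ip (\<lambda>x. f x - p x) b' = 0"
  proof (cases "sph_ip b' b' = 0")
    case True
    then have "\<And>x. x \<in> sphere 0 1 \<Longrightarrow> b' x = 0" using sph_ip_zero_iff[OF b'c] by blast
    then have "sph_ip (\<lambda>x. f x - p x) b' = sph_ip (\<lambda>x. f x - p x) (\<lambda>x. 0)" by (intro sph_ip_cong) auto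
    then show ?thesis by (simp add: sph_ip_def)
  next
    case False
    then have "c * sph_ip b' b' = sph_ip f' b'" by (simp add: c_def)
    then show ?thesis unfolding fp using sph_ip_diff_left[OF b'c f'c cb'c] by (simp add: sph_ip_scale_left)
  qed
  have fpc: "sph_cont (\<lambda>x. f x - p x)" unfolding fp using f'c cb'c by (rule continuous_on_diff)
  have "sph_ip (\<lambda>x. f x - p x) s = 0" if s: "s \<in> fun_space.span (insert b B)" for s
  proof -
    obtain k where k: "s - (\<lambda>x. k * b x) \<in> fun_space.span B"
      using s fun_space.span_breakdown_eq[of s b B] by blast
    define s' where "s' x = s x - k * b x + k * r x" for x
    have "s' = (s - (\<lambda>x. k * b x)) + (\<lambda>x. k * r x)" by (simp add: s'_def fun_eq_iff)
    then have s': "s' \<in> fun_space.span B" using k r(1) by (simp add: fun_space.span_add fun_space.span_scale)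
    have kb'c: "sph_cont (\<lambda>x. k * b' x)" using b'c by (intro continuous_intros)
    have "s = (\<lambda>x. s' x + k * b' x)" by (simp add: s'_def b'_def fun_eq_iff algebra_simps)
    then show ?thesis
      using sph_ip_add_right[OF fpc Bc[OF s'] kb'c] pB[OF s'] pb' by (simp add: sph_ip_scale_right)
  qed
  then show ?case using p_span by blast
qed

text \<open>On the sphere a form q and |x|^2 q coincide, so this is the orthogonal complement, among
  forms of degree k, of the multiples of |x|^2. It stands in for the kernel of the Euclidean
  Laplacian.\<close>

definition harmonics :: "nat \<Rightarrow> (real ^ 'n \<Rightarrow> real) set" where
  "harmonics k = {w \<in> hom_polys real_coord k. \<forall>q\<in>lap_polys k. sph_ip w q = 0}"

lemma sph_cont_hom_polys: "p \<in> hom_polys real_coord k \<Longrightarrow> sph_cont p"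
  by (rule hom_polys_continuous)

lemma lap_polys_hom: "q \<in> lap_polys k \<Longrightarrow> q \<in> hom_polys real_coord (k - 2)"
  by (auto simp: lap_polys_def split: if_splits)

lemma subspace_hom_polys: "fun_space.subspace (hom_polys l k)"
  unfolding fun_space.subspace_def
  using hom_polys_add[of _ l k] by (auto simp: hom_polys_scale plus_fun_def zero_fun_def)

lemma subspace_lap_polys: "fun_space.subspace (lap_polys k :: (real ^ 'n \<Rightarrow> real) set)"
proof (cases "k < 2")
  case True
  then have "lap_polys k = {0 :: real ^ 'n \<Rightarrow> real}" by (simp add: lap_polys_def zero_fun_def)
  then show ?thesis using fun_space.subspace_single_0 by metis
qed (simp add: lap_polys_def subspace_hom_polys)

lemma finite_span_subset_hom_polys:
  fixes V :: "(real ^ 'n \<Rightarrow> real) set"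
  assumes "fun_space.subspace V" "V \<subseteq> hom_polys real_coord k"
  obtains B where "finite B" "B \<subseteq> V" "fun_space.independent B" "fun_space.span B = V" "card B = fun_dim V"
proof -
  obtain B where B: "B \<subseteq> V" "fun_space.independent B" "V \<subseteq> fun_space.span B" "card B = fun_dim V"
    by (rule fun_space.basis_exists)
  have "B \<subseteq> fun_space.span (monomial real_coord ` multi_indices k)"
    using order_trans[OF order_trans[OF B(1) assms(2)] hom_polys_real_subset_span] .
  then have "finite B"
    using fun_space.independent_span_bound[OF _ B(2), of "monomial real_coord ` multi_indices k"] by simp
  moreover have "fun_space.span B = V"
    using B(1,3) assms(1) fun_space.span_minimal by blast
  ultimately show thesis using that B by blast
qed

text \<open>The form is projected to \<open>lap_polys k\<close>; multiplying the projection by |x|^2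
  restores degree k without changing values on the sphere.\<close>

lemma harmonic_decomposition:
  fixes p :: "real ^ 'n \<Rightarrow> real"
  assumes p: "p \<in> hom_polys real_coord k"
  shows "\<exists>w\<in>harmonics k. \<exists>q\<in>lap_polys k. p = (\<lambda>x. w x + radial_mult q x)"
proof -
  have sub: "lap_polys k \<subseteq> hom_polys real_coord (k - 2)" using lap_polys_hom by blast
  obtain B :: "(real ^ 'n \<Rightarrow> real) set" where B: "finite B" "B \<subseteq> lap_polys k" "fun_space.span B = lap_polys k"
    by (rule finite_span_subset_hom_polys[OF subspace_lap_polys sub])
  obtain q where q: "q \<in> lap_polys k" "\<And>b. b \<in> lap_polys k \<Longrightarrow> sph_ip (\<lambda>x. p x - q x) b = 0"
    using sph_projection[OF B(1), of p] B(2,3) sub sph_cont_hom_polys p by blast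
  let ?w = "\<lambda>x. p x - radial_mult q x"
  have "?w \<in> hom_polys real_coord k" using p radial_mult_lap_polys[OF q(1)] by (rule hom_polys_diff)
  moreover have "sph_ip ?w b = 0" if "b \<in> lap_polys k" for b
    using q(2)[OF that] sph_ip_cong[of ?w "\<lambda>x. p x - q x" b b] by (simp add: radial_mult_sphere del: mem_sphere)
  ultimately have "?w \<in> harmonics k" by (simp add: harmonics_def)
  then show ?thesis using q(1) by (intro bexI[of _ ?w] bexI[of _ q]) auto
qed

text \<open>Let \<mu> be the eigenvalue and \<Delta> w = \<mu> w - L with L of degree k - 2; put q =
  |x|^2 L, so \<Delta> q = \<mu> q - M. Then <\<Delta> w, q> = <w, \<Delta> q> = <w, \<mu> L - M> =
  0, while directly <\<Delta> w, q> = <\<mu> w - L, L> = -<L, L>. Hence L vanishes on the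
  sphere.\<close>

lemma sphere_laplacian_harmonics:
  fixes w :: "real ^ 'n \<Rightarrow> real"
  assumes w: "w \<in> harmonics k" and x: "x \<in> sphere 0 1"
  shows "sphere_laplacian w x = sph_eigenvalue CARD('n) k * w x"
proof -
  have wP: "w \<in> hom_polys real_coord k" and worth: "\<And>q. q \<in> lap_polys k \<Longrightarrow> sph_ip w q = 0"
    using w by (auto simp: harmonics_def)
  obtain L where L: "L \<in> lap_polys k"
    "\<And>x. x \<in> sphere 0 1 \<Longrightarrow> sphere_laplacian w x = sph_eigenvalue CARD('n) k * w x - L x"
    using sphere_laplacian_hom_polys[OF wP] by blast
  define q where "q = radial_mult L"
  have q: "q \<in> hom_polys real_coord k" unfolding q_def using L(1) by (rule radial_mult_lap_polys)
  have qL: "q x = L x" if "x \<in> sphere 0 1" for x using that by (simp add: q_def radial_mult_sphere del: mem_sphere)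
  obtain M where M: "M \<in> lap_polys k"
    "\<And>x. x \<in> sphere 0 1 \<Longrightarrow> sphere_laplacian q x = sph_eigenvalue CARD('n) k * q x - M x"
    using sphere_laplacian_hom_polys[OF q] by blast
  have Lc: "sph_cont L" and Mc: "sph_cont M" and wc: "sph_cont w"
    using L(1) M(1) wP lap_polys_hom sph_cont_hom_polys by blast+
  let ?\<mu> = "sph_eigenvalue CARD('n) k"
  have \<mu>wc: "sph_cont (\<lambda>x. ?\<mu> * w x)" and \<mu>Lc: "sph_cont (\<lambda>x. ?\<mu> * L x)"
    using wc Lc by (auto intro!: continuous_intros)
  have "sph_ip (sphere_laplacian w) q = sph_ip w (sphere_laplacian q)"
    unfolding sph_ip_def by (rule sphere_laplacian_self_adjoint) (use wP q C2_sphere_hom_polys in auto)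
  also have "\<dots> = sph_ip (\<lambda>x. ?\<mu> * L x - M x) w"
    unfolding sph_ip_commute[of w] by (rule sph_ip_cong) (auto simp: M qL simp del: mem_sphere)
  also have "\<dots> = 0"
    using worth[OF L(1)] worth[OF M(1)]
    by (simp add: sph_ip_diff_left[OF wc \<mu>Lc Mc] sph_ip_scale_left sph_ip_commute[of _ w])
  finally have "sph_ip (sphere_laplacian w) q = 0" .
  moreover have "sph_ip (sphere_laplacian w) q = sph_ip (\<lambda>x. ?\<mu> * w x - L x) L"
    by (rule sph_ip_cong) (auto simp: L qL simp del: mem_sphere)
  moreover have "\<dots> = - sph_ip L L"
    using worth[OF L(1)] by (simp add: sph_ip_diff_left[OF Lc \<mu>wc Lc] sph_ip_scale_left)
  ultimately have "sph_ip L L = 0" by simp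
  then have "L x = 0" using sph_ip_zero_iff[OF Lc] x by blast
  then show ?thesis using L(2)[OF x] by simp
qed

lemma sph_eigenvalue_inj:
  assumes "N \<ge> 3" "sph_eigenvalue N j = sph_eigenvalue N k" shows "j = k"
proof (rule ccontr)
  have *: "sph_eigenvalue N j < sph_eigenvalue N k" if "j < k" for j k
  proof -
    have "real j * (real j + (real N - 2)) \<le> real j * (real k + (real N - 2))"
      using that by (intro mult_left_mono) auto
    also have "\<dots> < real k * (real k + (real N - 2))"
      using that assms(1) by (intro mult_strict_right_mono) auto
    finally show ?thesis by (simp add: sph_eigenvalue_def algebra_simps)
  qed
  assume "j \<noteq> k"
  then show False using *[of j k] *[of k j] assms(2) by (cases "j < k") auto
qed

text \<open>Repeated decomposition shows orthogonality to all forms, hence to all polynomials.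
  Approximating \<open>f\<close> uniformly within e by a polynomial bounds <f, f> by e times the
  integral of |f|.\<close>

lemma orthogonal_to_harmonics_imp_zero:
  fixes f :: "real ^ 'n \<Rightarrow> real"
  assumes f: "sph_cont f" and orth: "\<And>k w. w \<in> harmonics k \<Longrightarrow> sph_ip f w = 0" and x: "x \<in> sphere 0 1"
  shows "f x = 0"
proof -
  have hom: "sph_ip f p = 0" if "p \<in> hom_polys real_coord k" for p k
    using that
  proof (induction k arbitrary: p rule: less_induct)
    case (less k)
    obtain w q where wq: "w \<in> harmonics k" "q \<in> lap_polys k" "p = (\<lambda>x. w x + radial_mult q x)"
      using harmonic_decomposition[OF less.prems] by blast
    have qc: "sph_cont q" and wc: "sph_cont w"
      using wq lap_polys_hom sph_cont_hom_polys by (auto simp: harmonics_def)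
    have "sph_ip f q = 0"
    proof (cases "k < 2")
      case True
      then show ?thesis using wq(2) by (simp add: lap_polys_def sph_ip_def)
    next
      case False
      then show ?thesis using wq(2) by (intro less.IH[of "k - 2"]) (auto simp: lap_polys_def)
    qed
    moreover have "sph_ip f p = sph_ip f (\<lambda>x. w x + q x)"
      by (rule sph_ip_cong) (auto simp: wq(3) radial_mult_sphere simp del: mem_sphere)
    ultimately show ?case using orth[OF wq(1)] by (simp add: sph_ip_add_right[OF f wc qc])
  qed
  \<comment> \<open>All polynomial functions: the Stone-Weierstrass theorem needs an algebra, and
    forms of a single degree are not closed under products.\<close>
  define \<P> where "\<P> = fun_space.span (\<Union>k. hom_polys (real_coord :: 'n \<Rightarrow> _) k)"
  have Pc: "sph_cont g" if "g \<in> \<P>" for g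
    using sph_cont_span that sph_cont_hom_polys unfolding \<P>_def by blast
  have Porth: "sph_cont g \<and> sph_ip f g = 0" if "g \<in> \<P>" for g
    using that unfolding \<P>_def
  proof (induction rule: fun_space.span_induct_alt)
    case base
    then show ?case by (simp add: sph_ip_def zero_fun_def)
  next
    case (step c p g)
    then obtain k where p: "p \<in> hom_polys real_coord k" by blast
    have cpc: "sph_cont (\<lambda>x. c * p x)" using sph_cont_hom_polys[OF p] by (intro continuous_intros)
    have "sph_ip f (\<lambda>x. c * p x + g x) = 0" "sph_cont (\<lambda>x. c * p x + g x)"
      using step(2) hom[OF p] cpc
      by (auto simp: sph_ip_add_right[OF f cpc] sph_ip_scale_right intro: continuous_on_add)
    then show ?case by (simp add: plus_fun_def)
  qed
  have hom_mult: "(\<lambda>x. p x * h x) \<in> \<P>" if p: "p \<in> hom_polys real_coord k" and h: "h \<in> \<P>" for p h k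
    using h unfolding \<P>_def
  proof (induction rule: fun_space.span_induct_alt)
    case base
    show ?case using fun_space.span_zero by (simp add: zero_fun_def)
  next
    case (step c q h)
    then obtain j where "q \<in> hom_polys real_coord j" by blast
    then have "(\<lambda>x. c * (p x * q x)) \<in> hom_polys real_coord (k + j)" using p by (intro hom_polys_scale hom_polys_mult)
    then have "(\<lambda>x. c * (p x * q x)) \<in> fun_space.span (\<Union>k. hom_polys real_coord k)" by (intro fun_space.span_base) blast
    from fun_space.span_add[OF this step(2)]
    show ?case by (simp add: plus_fun_def algebra_simps)
  qed
  have mult: "(\<lambda>x. g x * h x) \<in> \<P>" if g: "g \<in> \<P>" and h: "h \<in> \<P>" for g h
    using g unfolding \<P>_def
  proof (induction rule: fun_space.span_induct_alt)
    case base
    show ?case using fun_space.span_zero by (simp add: zero_fun_def)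
  next
    case (step c q g)
    then obtain j where "q \<in> hom_polys real_coord j" by blast
    then have "(\<lambda>x. c * (q x * h x)) \<in> \<P>"
      using hom_mult[OF _ h] unfolding \<P>_def by (intro fun_space.span_scale) blast
    from fun_space.span_add[OF this[unfolded \<P>_def] step(2)]
    show ?case by (simp add: plus_fun_def algebra_simps)
  qed
  have add: "(\<lambda>x. g x + h x) \<in> \<P>" if "g \<in> \<P>" "h \<in> \<P>" for g h
    using fun_space.span_add[OF that[unfolded \<P>_def]] by (simp add: \<P>_def plus_fun_def)
  have const: "(\<lambda>x. c) \<in> \<P>" for c
    using hom_polys_scale[OF hom_polys_one, of c] unfolding \<P>_def
    by (intro fun_space.span_base) auto
  have coord: "real_coord i \<in> \<P>" for i :: 'n
    unfolding \<P>_def by (intro fun_space.span_base) (use hom_polys_base in blast)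
  have approx: "\<exists>g\<in>\<P>. \<forall>x\<in>sphere 0 1. \<bar>f x - g x\<bar> < e" if "e > 0" for e
  proof -
    have "\<exists>g. g \<in> \<P> \<and> (\<forall>x\<in>sphere 0 1. \<bar>f x - g x\<bar> < e)"
    proof (rule Stone_Weierstrass_HOL[where P = "\<lambda>g. g \<in> \<P>"])
      fix x y :: "real ^ 'n" assume "x \<in> sphere 0 1 \<and> y \<in> sphere 0 1 \<and> x \<noteq> y"
      then obtain i where "x $ i \<noteq> y $ i" by (auto simp: vec_eq_iff)
      then show "\<exists>f. f \<in> \<P> \<and> f x \<noteq> f y" using coord[of i] by (intro exI[of _ "real_coord i"]) (simp add: real_coord_def)
    qed (use f that Pc const add mult in auto)
    then show ?thesis by blast
  qed
  define C where "C = sph_int (\<lambda>x. \<bar>f x\<bar>)"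
  have "C \<ge> 0" unfolding C_def
    using sph_int_mono[of "\<lambda>_. 0" "\<lambda>x. \<bar>f x\<bar>"] f by (simp add: continuous_on_rabs)
  have ff: "sph_ip f f \<le> e * C" if e: "e > 0" for e
  proof -
    obtain g where g: "g \<in> \<P>" "\<And>x. x \<in> sphere 0 1 \<Longrightarrow> \<bar>f x - g x\<bar> < e" using approx[OF e] by blast
    note gc = Pc[OF g(1)]
    have "sph_ip f f = sph_ip (\<lambda>x. f x - g x) f"
      using sph_ip_diff_left[OF f f gc] conjunct2[OF Porth[OF g(1)]] by (simp add: sph_ip_commute)
    also have "\<dots> \<le> sph_int (\<lambda>x. e * \<bar>f x\<bar>)"
      unfolding sph_ip_def
    proof (rule sph_int_mono)
      fix x :: "real ^ 'n" assume "x \<in> sphere 0 1"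
      then have "\<bar>f x - g x\<bar> * \<bar>f x\<bar> \<le> e * \<bar>f x\<bar>" using g(2) by (intro mult_right_mono) (auto intro: less_imp_le)
      moreover have "(f x - g x) * f x \<le> \<bar>f x - g x\<bar> * \<bar>f x\<bar>" by (metis abs_ge_self abs_mult)
      ultimately show "(f x - g x) * f x \<le> e * \<bar>f x\<bar>" by linarith
    qed (use f gc in \<open>auto intro!: continuous_intros\<close>)
    finally show ?thesis by (simp add: sph_int_scale C_def)
  qed
  have "sph_ip f f \<le> 0"
  proof (rule field_le_epsilon)
    fix e :: real assume "e > 0"
    \<comment> \<open>The denominator \<open>C + 1\<close> avoids a separate case for C = 0.\<close>
    then have "sph_ip f f \<le> e / (C + 1) * C" using ff[of "e / (C + 1)"] \<open>C \<ge> 0\<close> by simp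
    also have "\<dots> \<le> e" using \<open>e > 0\<close> \<open>C \<ge> 0\<close> by (simp add: field_simps)
    finally show "sph_ip f f \<le> 0 + e" by simp
  qed
  moreover have "sph_ip f f \<ge> 0" unfolding sph_ip_def
    using sph_int_mono[of "\<lambda>_. 0" "\<lambda>x. f x * f x"] f by (simp add: continuous_on_mult)
  ultimately have "sph_ip f f = 0" by simp
  then show ?thesis using sph_ip_zero_iff[OF f] x by blast
qed

lemma subspace_harmonics: "fun_space.subspace (harmonics k :: (real ^ 'n \<Rightarrow> real) set)"
  unfolding fun_space.subspace_def harmonics_def
proof (safe)
  fix p r q :: "real ^ 'n \<Rightarrow> real" and c
  show "0 \<in> hom_polys (real_coord :: 'n \<Rightarrow> _) k" by (simp add: zero_fun_def)
  show "sph_ip 0 q = 0" by (simp add: sph_ip_def)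
  assume p: "p \<in> hom_polys real_coord k" "\<forall>q\<in>lap_polys k. sph_ip p q = 0"
  show "(\<lambda>x. c * p x) \<in> hom_polys real_coord k" using p(1) by (rule hom_polys_scale)
  assume q: "q \<in> lap_polys k"
  show "sph_ip (\<lambda>x. c * p x) q = 0" using p(2) q by (simp add: sph_ip_scale_left)
next
  fix p r :: "real ^ 'n \<Rightarrow> real"
  assume p: "p \<in> hom_polys real_coord k" "\<forall>q\<in>lap_polys k. sph_ip p q = 0"
  assume r: "r \<in> hom_polys real_coord k" "\<forall>q\<in>lap_polys k. sph_ip r q = 0"
  show "p + r \<in> hom_polys real_coord k" using hom_polys_add[OF p(1) r(1)] by (simp add: plus_fun_def)
  fix q :: "real ^ 'n \<Rightarrow> real" assume q: "q \<in> lap_polys k"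
  have "sph_ip q (\<lambda>x. p x + r x) = 0"
    using p q r sph_cont_hom_polys lap_polys_hom[OF q]
    by (subst sph_ip_add_right) (auto simp: sph_ip_commute[of q])
  then show "sph_ip (p + r) q = 0" by (simp add: plus_fun_def sph_ip_commute[of q])
qed

lemma eigenfunction_orth_harmonics:
  fixes f :: "real ^ 'n \<Rightarrow> real"
  assumes f: "C2_sphere f" and eig: "\<And>x. x \<in> sphere 0 1 \<Longrightarrow> sphere_laplacian f x = \<mu> * f x"
    and w: "w \<in> harmonics k" and ne: "\<mu> \<noteq> sph_eigenvalue CARD('n) k"
  shows "sph_ip f w = 0"
proof -
  have wP: "w \<in> hom_polys real_coord k" using w by (simp add: harmonics_def)
  have "\<mu> * sph_ip f w = sph_ip (sphere_laplacian f) w"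
    unfolding sph_ip_scale_left[symmetric] by (rule sph_ip_cong) (use eig in auto)
  also have "\<dots> = sph_ip f (sphere_laplacian w)"
    unfolding sph_ip_def by (rule sphere_laplacian_self_adjoint[OF f C2_sphere_hom_polys[OF wP]])
  also have "\<dots> = sph_eigenvalue CARD('n) k * sph_ip f w"
    unfolding sph_ip_scale_right[symmetric] by (rule sph_ip_cong) (use sphere_laplacian_harmonics[OF w] in auto)
  finally show ?thesis using ne by simp
qed

lemma eigenfunction_zero:
  fixes f :: "real ^ 'n \<Rightarrow> real"
  assumes "C2_sphere f" "\<And>x. x \<in> sphere 0 1 \<Longrightarrow> sphere_laplacian f x = \<mu> * f x"
    and "\<And>k. \<mu> \<noteq> sph_eigenvalue CARD('n) k" and "x \<in> sphere 0 1"
  shows "f x = 0"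
  using orthogonal_to_harmonics_imp_zero[OF C1_sphere_continuous[OF C1_sphere_if_C2[OF assms(1)]]]
    eigenfunction_orth_harmonics[OF assms(1,2)] assms(3,4) by blast

text \<open>Let w be the projection of f to the harmonics of degree k. The difference f - w is
  orthogonal to degree k by construction and to every other degree j because f and w share an
  eigenvalue different from that of j. Completeness makes it vanish on the sphere.\<close>

lemma eigenfunction_harmonic:
  fixes f :: "real ^ 'n \<Rightarrow> real"
  assumes N: "CARD('n) \<ge> 3" and f: "C2_sphere f"
    and eig: "\<And>x. x \<in> sphere 0 1 \<Longrightarrow> sphere_laplacian f x = sph_eigenvalue CARD('n) k * f x"
  shows "\<exists>w\<in>harmonics k. \<forall>x\<in>sphere 0 1. f x = w x"
proof -
  have fc: "sph_cont f" using C1_sphere_continuous[OF C1_sphere_if_C2[OF f]] .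
  have sub: "harmonics k \<subseteq> hom_polys real_coord k" by (auto simp: harmonics_def)
  obtain B :: "(real ^ 'n \<Rightarrow> real) set" where B: "finite B" "B \<subseteq> harmonics k" "fun_space.span B = harmonics k"
    by (rule finite_span_subset_hom_polys[OF subspace_harmonics sub])
  obtain w where w: "w \<in> harmonics k" "\<And>v. v \<in> harmonics k \<Longrightarrow> sph_ip (\<lambda>x. f x - w x) v = 0"
    using sph_projection[OF B(1) _ fc] B(2,3) sub sph_cont_hom_polys by blast
  have wP: "w \<in> hom_polys real_coord k" using w(1) sub by blast
  have wc: "sph_cont w" using wP by (rule sph_cont_hom_polys)
  have "sph_ip (\<lambda>x. f x - w x) v = 0" if v: "v \<in> harmonics j" for j v
  proof (cases "j = k")
    case True
    then show ?thesis using w(2) v by simp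
  next
    case False
    then have ne: "sph_eigenvalue CARD('n) k \<noteq> sph_eigenvalue CARD('n) j" using sph_eigenvalue_inj[OF N] by blast
    have vc: "sph_cont v" using v sph_cont_hom_polys by (auto simp: harmonics_def)
    have "sph_ip f v = 0" by (rule eigenfunction_orth_harmonics[OF f eig v ne])
    moreover have "sph_ip w v = 0"
      by (rule eigenfunction_orth_harmonics[OF C2_sphere_hom_polys[OF wP] sphere_laplacian_harmonics[OF w(1)] v ne])
    ultimately show ?thesis by (simp add: sph_ip_diff_left[OF vc fc wc])
  qed
  then have "f x - w x = 0" if "x \<in> sphere 0 1" for x
    using orthogonal_to_harmonics_imp_zero[of "\<lambda>x. f x - w x"] fc wc that by (auto intro!: continuous_intros)
  then show ?thesis using w(1) by (intro bexI[of _ w]) auto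
qed

section \<open>The spectrum of a space form\<close>

lemma frechet_derivative_cong_sphere:
  assumes "\<And>y. y \<in> sphere 0 1 \<Longrightarrow> f y = h y" "x \<in> sphere 0 1"
  shows "frechet_derivative f (at x within sphere 0 1) = frechet_derivative h (at x within sphere 0 1)"
proof -
  have "(f has_derivative D) (at x within sphere 0 1) \<longleftrightarrow> (h has_derivative D) (at x within sphere 0 1)" for D
    using assms has_derivative_transform[of x "sphere 0 1" f h D] has_derivative_transform[of x "sphere 0 1" h f D]
    by metis
  then show ?thesis by (simp add: frechet_derivative_def)
qed

lemma sphere_laplacian_cong:
  fixes f h :: "real ^ 'n \<Rightarrow> real"
  assumes eq: "\<And>y. y \<in> sphere 0 1 \<Longrightarrow> f y = h y" and x: "x \<in> sphere 0 1"
  shows "sphere_laplacian f x = sphere_laplacian h x"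
proof -
  have "sphere_grad f y = sphere_grad h y" if "y \<in> sphere 0 1" for y
    unfolding sphere_grad_def using frechet_derivative_cong_sphere[of f h y] eq that by simp
  then have "frechet_derivative (sphere_grad f) (at x within sphere 0 1) =
      frechet_derivative (sphere_grad h) (at x within sphere 0 1)"
    using x by (rule frechet_derivative_cong_sphere)
  then show ?thesis by (simp add: sphere_laplacian_def sphere_div_def)
qed

lemma fun_dim_linear_image:
  fixes \<Psi> :: "('a \<Rightarrow> real) \<Rightarrow> ('b \<Rightarrow> real)"
  assumes add: "\<And>p q. \<Psi> (p + q) = \<Psi> p + \<Psi> q" and scale: "\<And>c p. \<Psi> (\<lambda>x. c * p x) = (\<lambda>y. c * \<Psi> p y)"
    and V: "fun_space.subspace V" and inj: "inj_on \<Psi> V"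
  shows "fun_dim (\<Psi> ` V) = fun_dim V"
proof -
  interpret L: Vector_Spaces.linear "\<lambda>(c::real) (f::'a \<Rightarrow> real) x. c * f x" "\<lambda>(c::real) (f::'b \<Rightarrow> real) x. c * f x" \<Psi>
    by unfold_locales (auto simp: add scale algebra_simps fun_eq_iff)
  obtain B where B: "B \<subseteq> V" "fun_space.independent B" "V \<subseteq> fun_space.span B" "card B = fun_dim V"
    by (rule fun_space.basis_exists)
  have span: "fun_space.span B = V" using B(1,3) V fun_space.span_minimal by blast
  have "fun_space.independent (\<Psi> ` B)"
    using L.dependent_inj_imageD[of B] B(2) inj span by auto
  moreover have "fun_space.span (\<Psi> ` B) = fun_space.span (\<Psi> ` V)"
    using span fun_space.span_eq_iff[THEN iffD2, OF V] by (simp only: L.span_image)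
  ultimately have "fun_dim (\<Psi> ` V) = card (\<Psi> ` B)" by (intro fun_space.dim_eq_card)
  also have "\<dots> = card B" using inj_on_subset[OF inj B(1)] by (rule card_image)
  finally show ?thesis using B(4) by simp
qed

lemma fun_dim_direct_sum:
  fixes A B :: "('a \<Rightarrow> real) set"
  assumes A: "fun_space.span A' = A" "fun_space.independent A'" "finite A'"
    and B: "fun_space.span B' = B" "fun_space.independent B'" "finite B'"
    and int: "\<And>p. p \<in> A \<Longrightarrow> p \<in> B \<Longrightarrow> p = 0"
  shows "fun_dim {p + q |p q. p \<in> A \<and> q \<in> B} = card A' + card B'"
proof -
  have disj: "A' \<inter> B' = {}"
  proof (rule ccontr)
    assume "A' \<inter> B' \<noteq> {}"
    then obtain p where p: "p \<in> A'" "p \<in> B'" by blast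
    then have "p = 0" using int A(1) B(1) fun_space.span_base by blast
    then show False using p(1) A(2) fun_space.dependent_zero by blast
  qed
  have ind: "fun_space.independent (A' \<union> B')"
  proof (rule fun_space.independent_if_scalars_zero)
    fix u v assume sum0: "(\<Sum>v\<in>A' \<union> B'. (\<lambda>x. u v * v x)) = 0" and v: "v \<in> A' \<union> B'"
    define p where "p = (\<Sum>v\<in>A'. (\<lambda>x. u v * v x))"
    define q where "q = (\<Sum>v\<in>B'. (\<lambda>x. u v * v x))"
    have pq: "p + q = 0" using sum0 A(3) B(3) disj by (simp add: p_def q_def sum.union_disjoint)
    have pA: "p \<in> A" unfolding p_def A(1)[symmetric]
      by (intro fun_space.span_sum fun_space.span_scale fun_space.span_base)
    have "q \<in> B" unfolding q_def B(1)[symmetric]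
      by (intro fun_space.span_sum fun_space.span_scale fun_space.span_base)
    then have "- q \<in> B" unfolding B(1)[symmetric] by (rule fun_space.span_neg)
    moreover have "p = - q" using pq by (simp only: eq_neg_iff_add_eq_0)
    ultimately have "p \<in> B" by (simp only:)
    then have p0: "p = 0" using int pA by blast
    then have "q = 0" using pq by simp
    then have "\<forall>v\<in>B'. u v = 0" "\<forall>v\<in>A'. u v = 0"
      using fun_space.independentD[OF A(2,3) order_refl, of u] fun_space.independentD[OF B(2,3) order_refl, of u] p0
      unfolding p_def q_def by blast+
    then show "u v = 0" using v by blast
  qed (use A B in simp)
  have "{p + q |p q. p \<in> A \<and> q \<in> B} = fun_space.span (A' \<union> B')"
    by (simp add: fun_space.span_Un A B)
  then have "fun_dim {p + q |p q. p \<in> A \<and> q \<in> B} = card (A' \<union> B')"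
    using ind fun_space.dim_eq_card[of "A' \<union> B'"] by simp
  then show ?thesis using A B disj by (simp add: card_Un_disjoint)
qed

section \<open>Invariant harmonic forms\<close>

definition inv_harmonics :: "(real ^ 'n ^ 'n) set \<Rightarrow> nat \<Rightarrow> (real ^ 'n \<Rightarrow> real) set" where
  "inv_harmonics G k = {w \<in> harmonics k. \<forall>g\<in>G. \<forall>x. w (g *v x) = w x}"

definition inv_lap_polys :: "(real ^ 'n ^ 'n) set \<Rightarrow> nat \<Rightarrow> (real ^ 'n \<Rightarrow> real) set" where
  "inv_lap_polys G k = {q \<in> lap_polys k. \<forall>g\<in>G. \<forall>x. q (g *v x) = q x}"

lemma lap_polys_matrix:
  fixes A :: "real ^ 'n ^ 'n"
  assumes "q \<in> lap_polys k" shows "(\<lambda>x. q (A *v x)) \<in> lap_polys k"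
  using assms hom_polys_real_coord_matrix by (auto simp: lap_polys_def split: if_splits)

lemma lap_polys_diff: "p \<in> lap_polys k \<Longrightarrow> q \<in> lap_polys k \<Longrightarrow> (\<lambda>x. p x - q x) \<in> lap_polys k"
  by (auto simp: lap_polys_def hom_polys_diff split: if_splits)

lemma orthogonal_transformation_matrix_vector:
  fixes A :: "real ^ 'n ^ 'n"
  assumes "orthogonal_matrix A" shows "orthogonal_transformation ((*v) A)"
  using assms by (simp add: orthogonal_transformation_matrix)

text \<open>By invariance of the integral, pairing w \<circ> A with q is pairing w with q composed
  with the transpose, and the latter is again in \<open>lap_polys k\<close>.\<close>

lemma harmonics_matrix:
  fixes A :: "real ^ 'n ^ 'n"
  assumes A: "orthogonal_matrix A" and w: "w \<in> harmonics k"
  shows "(\<lambda>x. w (A *v x)) \<in> harmonics k"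
proof -
  have wP: "w \<in> hom_polys real_coord k" using w by (simp add: harmonics_def)
  have "sph_ip (\<lambda>x. w (A *v x)) q = 0" if q: "q \<in> lap_polys k" for q
  proof -
    define q' where "q' = (\<lambda>x. q (transpose A *v x))"
    have q': "q' \<in> lap_polys k" unfolding q'_def using q by (rule lap_polys_matrix)
    have "transpose A ** A = mat 1" using A by (simp add: orthogonal_matrix_def)
    then have "transpose A *v (A *v x) = x" for x
      by (metis matrix_vector_mul_assoc matrix_vector_mul_lid)
    then have "q' (A *v x) = q x" for x unfolding q'_def by metis
    then have "sph_ip (\<lambda>x. w (A *v x)) q = sph_int (\<lambda>x. (\<lambda>y. w y * q' y) (A *v x))"
      by (simp add: sph_ip_def)
    also have "\<dots> = sph_ip w q'" unfolding sph_ip_def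
      using wP lap_polys_hom[OF q'] sph_cont_hom_polys
      by (intro sph_int_orthogonal orthogonal_transformation_matrix_vector A continuous_on_mult) blast+
    also have "\<dots> = 0" using w q' by (simp add: harmonics_def)
    finally show ?thesis .
  qed
  then show ?thesis using hom_polys_real_coord_matrix[OF wP] by (simp add: harmonics_def)
qed

lemma radial_mult_eq_0_iff:
  assumes "q \<in> lap_polys k" shows "radial_mult q = (\<lambda>x. 0) \<longleftrightarrow> q = (\<lambda>x. 0)"
proof
  assume "radial_mult q = (\<lambda>x. 0)"
  then have "q x = 0" if "x \<in> sphere 0 1" for x using radial_mult_sphere[OF that, of q] by simp
  then show "q = (\<lambda>x. 0)"
    using hom_polys_eq_if_eq_on_sphere[OF lap_polys_hom[OF assms] hom_polys_zero] by blast
qed (simp add: radial_mult_def[abs_def])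

text \<open>This makes the decomposition direct: on the sphere w equals q, to which it is
  orthogonal, so <w, w> = 0.\<close>

lemma harmonics_radial_mult:
  assumes w: "w \<in> harmonics k" and q: "q \<in> lap_polys k" and eq: "w = radial_mult q"
  shows "w = (\<lambda>x. 0)"
proof -
  have wP: "w \<in> hom_polys real_coord k" using w by (simp add: harmonics_def)
  have "sph_ip w w = sph_ip w q"
    by (rule sph_ip_cong) (auto simp: eq radial_mult_sphere simp del: mem_sphere)
  also have "\<dots> = 0" using w q by (simp add: harmonics_def)
  finally have "w x = 0" if "x \<in> sphere 0 1" for x
    using sph_ip_zero_iff[OF sph_cont_hom_polys[OF wP] _ that] by blast
  then show ?thesis using hom_polys_eq_if_eq_on_sphere[OF wP hom_polys_zero] by blast
qed

lemma radial_mult_matrix: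
  assumes "orthogonal_matrix A" shows "radial_mult q (A *v x) = (x \<bullet> x) * q (A *v x)"
  using orthogonal_transformation_matrix_vector[OF assms]
  by (simp add: radial_mult_def orthogonal_transformation_def)

context
  fixes G :: "(real ^ 'n ^ 'n) set"
  assumes G: "space_form_group G"
begin

lemma subspace_invariant:
  assumes "fun_space.subspace V" shows "fun_space.subspace {p \<in> V. \<forall>g\<in>G. \<forall>x. p (g *v x) = p x}"
  using assms unfolding fun_space.subspace_def by simp

lemma subspace_inv_harmonics: "fun_space.subspace (inv_harmonics G k)"
  unfolding inv_harmonics_def by (rule subspace_invariant[OF subspace_harmonics])

lemma subspace_inv_lap_polys: "fun_space.subspace (inv_lap_polys G k)"
  unfolding inv_lap_polys_def by (rule subspace_invariant[OF subspace_lap_polys])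

text \<open>Both components of an invariant form are invariant, because the group acts on each
  summand and the sum is direct.\<close>

lemma inv_polys_decomposition:
  "inv_polys G k = {w + r |w r. w \<in> inv_harmonics G k \<and> r \<in> radial_mult ` inv_lap_polys G k}"
proof safe
  fix p assume p: "p \<in> inv_polys G k"
  then obtain w q where wq: "w \<in> harmonics k" "q \<in> lap_polys k" "p = (\<lambda>x. w x + radial_mult q x)"
    using harmonic_decomposition unfolding inv_polys_def by blast
  have inv: "w (g *v x) = w x \<and> q (g *v x) = q x" if g: "g \<in> G" for g x
  proof -
    note orth = orthogonal_matrix_if_mem[OF G g]
    \<comment> \<open>Invariance of p gives w - w \<circ> g = |x|^2 d, an element of both summands,
      so both sides vanish.\<close>
    define d where "d = (\<lambda>x. q (g *v x) - q x)"
    have d: "d \<in> lap_polys k" unfolding d_def using wq(2) by (intro lap_polys_diff lap_polys_matrix)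
    have "w x - w (g *v x) = radial_mult d x" for x
    proof -
      have "p (g *v x) = p x" using p g by (simp add: inv_polys_def)
      then show ?thesis
        by (simp add: wq(3) radial_mult_matrix[OF orth] d_def) (simp add: radial_mult_def algebra_simps)
    qed
    then have eq: "(\<lambda>x. w x - w (g *v x)) = radial_mult d" by (simp add: fun_eq_iff)
    have "(\<lambda>x. w x - w (g *v x)) \<in> harmonics k"
      using fun_space.subspace_diff[OF subspace_harmonics wq(1) harmonics_matrix[OF orth wq(1)]]
      by (simp add: fun_diff_def)
    from harmonics_radial_mult[OF this d eq] have "(\<lambda>x. w x - w (g *v x)) = (\<lambda>x. 0)" .
    moreover from this have "d = (\<lambda>x. 0)" using eq radial_mult_eq_0_iff[OF d] by simp
    ultimately show ?thesis by (simp add: d_def fun_eq_iff)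
  qed
  have "p = w + radial_mult q" using wq(3) by (simp add: plus_fun_def)
  moreover have "w \<in> inv_harmonics G k" "q \<in> inv_lap_polys G k"
    using wq inv by (simp_all add: inv_harmonics_def inv_lap_polys_def)
  ultimately show "\<exists>w r. p = w + r \<and> w \<in> inv_harmonics G k \<and> r \<in> radial_mult ` inv_lap_polys G k" by blast
next
  fix w q assume w: "w \<in> inv_harmonics G k" and q: "q \<in> inv_lap_polys G k"
  have "(\<lambda>x. w x + radial_mult q x) \<in> hom_polys real_coord k"
    using w q by (intro hom_polys_add radial_mult_lap_polys) (auto simp: inv_harmonics_def inv_lap_polys_def harmonics_def)
  moreover have "radial_mult q (g *v x) = radial_mult q x" if "g \<in> G" for g x
    using q that by (simp add: radial_mult_matrix[OF orthogonal_matrix_if_mem[OF G that]] inv_lap_polys_def)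
       (simp add: radial_mult_def)
  ultimately show "w + radial_mult q \<in> inv_polys G k"
    using w by (simp add: inv_polys_def inv_harmonics_def plus_fun_def)
qed

text \<open>The additive form of the statement that the multiplicity is a_k - a_{k-2}, avoiding
  subtraction of dimensions.\<close>

lemma fun_dim_inv_polys:
  "fun_dim (inv_polys G k) = fun_dim (inv_harmonics G k) + fun_dim (inv_lap_polys G k)"
proof -
  let ?R = "radial_mult ` inv_lap_polys G k"
  have R: "fun_space.subspace ?R"
  proof -
    have "0 \<in> inv_lap_polys G k" using subspace_inv_lap_polys by (rule fun_space.subspace_0)
    then have "0 \<in> ?R" by (rule rev_image_eqI) (simp add: radial_mult_def fun_eq_iff)
    moreover have "radial_mult p + radial_mult q \<in> ?R" if "p \<in> inv_lap_polys G k" "q \<in> inv_lap_polys G k" for p q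
      by (rule image_eqI[OF _ fun_space.subspace_add[OF subspace_inv_lap_polys that]])
         (simp add: radial_mult_def fun_eq_iff algebra_simps)
    moreover have "(\<lambda>x. c * radial_mult p x) \<in> ?R" if "p \<in> inv_lap_polys G k" for c p
      by (rule image_eqI[OF _ fun_space.subspace_scale[OF subspace_inv_lap_polys that, of c]])
         (simp add: radial_mult_def fun_eq_iff algebra_simps)
    ultimately show ?thesis unfolding fun_space.subspace_def by auto
  qed
  have sub: "inv_harmonics G k \<subseteq> hom_polys real_coord k" "?R \<subseteq> hom_polys real_coord k"
    using radial_mult_lap_polys by (auto simp: inv_harmonics_def harmonics_def inv_lap_polys_def)
  obtain A' where A': "finite A'" "fun_space.independent A'" "fun_space.span A' = inv_harmonics G k"
     "card A' = fun_dim (inv_harmonics G k)"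
    by (rule finite_span_subset_hom_polys[OF subspace_inv_harmonics sub(1)])
  obtain B' where B': "finite B'" "fun_space.independent B'" "fun_space.span B' = ?R" "card B' = fun_dim ?R"
    by (rule finite_span_subset_hom_polys[OF R sub(2)])
  have "fun_dim (inv_polys G k) = card A' + card B'"
    unfolding inv_polys_decomposition
  proof (rule fun_dim_direct_sum[OF A'(3,2,1) B'(3,2,1)])
    fix p assume "p \<in> inv_harmonics G k" "p \<in> ?R"
    then obtain q where "p \<in> harmonics k" "q \<in> lap_polys k" "p = radial_mult q"
      by (auto simp: inv_harmonics_def inv_lap_polys_def)
    from harmonics_radial_mult[OF this] show "p = 0" by (simp add: zero_fun_def)
  qed
  moreover have "fun_dim ?R = fun_dim (inv_lap_polys G k)"
  proof (rule fun_dim_linear_image[OF _ _ subspace_inv_lap_polys])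
    show "inj_on radial_mult (inv_lap_polys G k)"
    proof (rule inj_onI)
      fix p q assume pq: "p \<in> inv_lap_polys G k" "q \<in> inv_lap_polys G k" "radial_mult p = radial_mult q"
      then have "(\<lambda>x. p x - q x) \<in> lap_polys k" by (intro lap_polys_diff) (auto simp: inv_lap_polys_def)
      moreover have "radial_mult (\<lambda>x. p x - q x) = (\<lambda>x. 0)"
        using pq(3) by (simp add: radial_mult_def fun_eq_iff algebra_simps)
      ultimately have "(\<lambda>x. p x - q x) = (\<lambda>x. 0)" using radial_mult_eq_0_iff by blast
      then show "p = q" by (simp add: fun_eq_iff)
    qed
  qed (simp_all add: radial_mult_def fun_eq_iff algebra_simps)
  ultimately show ?thesis using A' B' by simp
qed

section \<open>Functions on the quotient\<close>

lemma orbit_proj_eq: "orbit_proj G x = (\<lambda>g. g *v x) ` G"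
  by (auto simp: orbit_proj_def orbit_def)

lemma space_form_eq: "space_form G = orbit_proj G ` sphere 0 1"
  by (auto simp: space_form_def orbits_def orbit_proj_def)

lemma matrix_mem_sphere: "g \<in> G \<Longrightarrow> x \<in> sphere 0 1 \<Longrightarrow> g *v x \<in> sphere 0 1"
  using orthogonal_transformation_norm[OF orthogonal_transformation_matrix_vector[OF orthogonal_matrix_if_mem[OF G]], of g x]
  by simp

lemma orbit_proj_matrix:
  assumes "g \<in> G" shows "orbit_proj G (g *v x) = orbit_proj G x"
proof -
  have "(\<lambda>h. h *v (g *v x)) ` G = (\<lambda>h. h *v x) ` (\<lambda>h. h ** g) ` G"
    by (simp add: image_image matrix_vector_mul_assoc)
  also have "(\<lambda>h. h ** g) ` G = G"
    using bij_betw_mult_right[OF G assms] by (rule bij_betw_imp_surj_on)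
  finally show ?thesis by (simp add: orbit_proj_eq)
qed

text \<open>The function induced on orbits by an invariant p: the chosen point of the orbit is then
  irrelevant. The value 0 elsewhere follows the convention of \<open>eigenspace\<close>.\<close>

definition descend :: "(real ^ 'n \<Rightarrow> real) \<Rightarrow> (real ^ 'n) set \<Rightarrow> real" where
  "descend p O' = (if O' \<in> space_form G then p (SOME x. x \<in> O') else 0)"

lemma descend_orbit_proj:
  assumes "x \<in> sphere 0 1" "\<And>g x. g \<in> G \<Longrightarrow> p (g *v x) = p x"
  shows "descend p (orbit_proj G x) = p x"
proof -
  have "mat 1 *v x \<in> orbit_proj G x" unfolding orbit_proj_eq using mat_1_mem[OF G] by (rule imageI)
  then have "(SOME y. y \<in> orbit_proj G x) \<in> orbit_proj G x" by (rule someI)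
  then obtain g where "g \<in> G" "(SOME y. y \<in> orbit_proj G x) = g *v x" unfolding orbit_proj_eq by blast
  moreover have "orbit_proj G x \<in> space_form G" using assms(1) unfolding space_form_eq by (rule imageI)
  ultimately show ?thesis using assms(2) by (simp add: descend_def)
qed

lemma smooth_lift_eigenspace:
  assumes "f \<in> eigenspace G \<mu>"
  shows "C2_sphere (f \<circ> orbit_proj G)"
    and "x \<in> sphere 0 1 \<Longrightarrow> sphere_laplacian (f \<circ> orbit_proj G) x = \<mu> * (f \<circ> orbit_proj G) x"
  using assms C2_sphere_if_smooth by (auto simp: eigenspace_def)

text \<open>The lift of an eigenfunction agrees on the sphere with a harmonic form; this form is
  invariant there because the lift is, and everywhere by homogeneity.\<close>

lemma eigenspace_eq_descend:
  "eigenspace G (sph_eigenvalue CARD('n) k) = descend ` inv_harmonics G k"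
proof (rule Set.set_eqI, rule iffI)
  fix f assume f: "f \<in> eigenspace G (sph_eigenvalue CARD('n) k)"
  let ?\<phi> = "f \<circ> orbit_proj G"
  have N: "CARD('n) \<ge> 3" using G by (simp add: space_form_group_def)
  obtain w where w: "w \<in> harmonics k" "\<And>x. x \<in> sphere 0 1 \<Longrightarrow> ?\<phi> x = w x"
    using eigenfunction_harmonic[OF N smooth_lift_eigenspace[OF f]] by blast
  have wP: "w \<in> hom_polys real_coord k" using w(1) by (simp add: harmonics_def)
  have inv: "w (g *v x) = w x" if g: "g \<in> G" for g x
  proof -
    have "(\<lambda>x. w (g *v x)) = w"
    proof (rule hom_polys_eq_if_eq_on_sphere[OF hom_polys_real_coord_matrix[OF wP] wP])
      fix x :: "real ^ 'n" assume x: "x \<in> sphere 0 1"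
      have "w (g *v x) = ?\<phi> (g *v x)" using w(2)[OF matrix_mem_sphere[OF g x]] by simp
      also have "\<dots> = ?\<phi> x" by (simp add: orbit_proj_matrix[OF g])
      finally show "w (g *v x) = w x" using w(2)[OF x] by simp
    qed
    then show ?thesis by (simp add: fun_eq_iff)
  qed
  have "f = descend w"
  proof
    fix O' show "f O' = descend w O'"
    proof (cases "O' \<in> space_form G")
      case True
      then obtain x where x: "x \<in> sphere 0 1" "O' = orbit_proj G x" unfolding space_form_eq by blast
      then show ?thesis using descend_orbit_proj[OF x(1), of w] inv w(2)[OF x(1)] by simp
    next
      case False
      then show ?thesis using f by (simp add: descend_def eigenspace_def)
    qed
  qed
  then show "f \<in> descend ` inv_harmonics G k" using w(1) inv by (simp add: inv_harmonics_def)
next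
  fix f assume "f \<in> descend ` inv_harmonics G k"
  then obtain w where w: "w \<in> harmonics k" "\<And>g x. g \<in> G \<Longrightarrow> w (g *v x) = w x" "f = descend w"
    by (auto simp: inv_harmonics_def)
  have eq: "(f \<circ> orbit_proj G) x = w x" if "x \<in> sphere 0 1" for x
    using descend_orbit_proj[OF that, of w] w(2,3) by simp
  have "smooth_on_sphere (f \<circ> orbit_proj G)"
    using w(1) eq by (intro smooth_on_sphere_if_eq_hom_poly[of w k]) (auto simp: harmonics_def)
  moreover have "sphere_laplacian (f \<circ> orbit_proj G) x = sph_eigenvalue CARD('n) k * f (orbit_proj G x)"
    if "x \<in> sphere 0 1" for x
    using sphere_laplacian_cong[of "f \<circ> orbit_proj G" w x, OF eq that] sphere_laplacian_harmonics[OF w(1) that] eq[OF that] by simp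
  ultimately show "f \<in> eigenspace G (sph_eigenvalue CARD('n) k)"
    using w(3) by (simp add: eigenspace_def descend_def)
qed

lemma spectrum_eigenvalue:
  "spectrum G (sph_eigenvalue CARD('n) k) = fun_dim (inv_harmonics G k)"
  unfolding spectrum_def eigenspace_eq_descend
proof (rule fun_dim_linear_image[OF _ _ subspace_inv_harmonics])
  show "inj_on descend (inv_harmonics G k)"
  proof (rule inj_onI)
    fix v w assume vw: "v \<in> inv_harmonics G k" "w \<in> inv_harmonics G k" "descend v = descend w"
    have "v x = w x" if "x \<in> sphere 0 1" for x
      using descend_orbit_proj[OF that, of v] descend_orbit_proj[OF that, of w] vw by (simp add: inv_harmonics_def)
    then show "v = w" using vw hom_polys_eq_if_eq_on_sphere[of v k w]
      by (simp add: inv_harmonics_def harmonics_def)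
  qed
qed (auto simp: descend_def fun_eq_iff)

lemma spectrum_not_eigenvalue:
  assumes "\<And>k. \<mu> \<noteq> sph_eigenvalue CARD('n) k" shows "spectrum G \<mu> = 0"
proof -
  have "f = 0" if f: "f \<in> eigenspace G \<mu>" for f
  proof
    fix O' show "f O' = 0 O'"
    proof (cases "O' \<in> space_form G")
      case True
      then obtain x where x: "x \<in> sphere 0 1" "O' = orbit_proj G x" unfolding space_form_eq by blast
      then show ?thesis using eigenfunction_zero[OF smooth_lift_eigenspace[OF f] assms x(1)] by simp
    qed (use f in \<open>simp add: eigenspace_def\<close>)
  qed
  then have "eigenspace G \<mu> \<subseteq> fun_space.span {}" by auto
  then show ?thesis using fun_space.dim_le_card[of "eigenspace G \<mu>" "{}"] by (simp add: spectrum_def)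
qed

end

section \<open>The dimension is determined by the spectrum\<close>

lemma hom_polys_power_mult:
  assumes "p \<in> hom_polys l d" shows "(\<lambda>x. p x ^ k) \<in> hom_polys l (d * k)"
  by (induction k) (use hom_polys_mult[OF assms] in \<open>auto simp: hom_polys_one\<close>)

lemma hom_polys_inner_self: "(\<lambda>x :: real ^ 'n. x \<bullet> x) \<in> hom_polys real_coord 2"
  using radial_mult_hom_polys[OF hom_polys_one] by (simp add: radial_mult_def[abs_def] numeral_2_eq_2)

context
  fixes G :: "(real ^ 'n ^ 'n) set"
  assumes G: "space_form_group G"
begin

text \<open>The product over the orbit of a coordinate is the simplest invariant form; squaring
  makes it nonnegative. It serves as an invariant that is not constant on the sphere.\<close>

definition norm_poly :: "'n \<Rightarrow> real ^ 'n \<Rightarrow> real" where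
  "norm_poly i x = (\<Prod>g\<in>G. (g *v x) $ i * (g *v x) $ i)"

lemma norm_poly_hom: "norm_poly i \<in> hom_polys real_coord (2 * card G)"
proof -
  have "(\<lambda>x. (g *v x) $ i * (g *v x) $ i) \<in> hom_polys real_coord 2" for g :: "real ^ 'n ^ 'n"
    using hom_polys_mult[OF hom_polys_real_coord_matrix[OF hom_polys_base[of real_coord i]]
        hom_polys_real_coord_matrix[OF hom_polys_base[of real_coord i]], of g g]
    by (simp add: real_coord_def numeral_2_eq_2)
  from hom_polys_prod[OF finite_space_form_group[OF G] this]
  show ?thesis by (simp add: norm_poly_def[abs_def] mult.commute)
qed

lemma norm_poly_inv: "h \<in> G \<Longrightarrow> norm_poly i (h *v x) = norm_poly i x"
  using prod.reindex_bij_betw[OF bij_betw_mult_right[OF G], of h "\<lambda>g. (g *v x) $ i * (g *v x) $ i"]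
  by (simp add: norm_poly_def matrix_vector_mul_assoc)

lemma norm_poly_nonneg: "norm_poly i x \<ge> 0"
  by (simp add: norm_poly_def prod_nonneg)

lemma norm_poly_zero: "\<exists>x\<in>sphere 0 1. norm_poly i x = 0"
proof -
  have "CARD('n) \<ge> 3" using G by (simp add: space_form_group_def)
  then have "\<not> (UNIV :: 'n set) \<subseteq> {i}"
    by (metis card.empty card.insert card_mono finite.emptyI finite_insert empty_iff numeral_le_one_iff
        One_nat_def le_trans semiring_norm(70))
  then obtain j where j: "j \<noteq> i" by blast
  have "(mat 1 *v axis j (1::real)) $ i = 0" using j by (simp add: axis_def)
  then have "norm_poly i (axis j 1) = 0"
    unfolding norm_poly_def using mat_1_mem[OF G] finite_space_form_group[OF G]
    by (intro prod_zero bexI[of _ "mat 1"]) simp_all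
  moreover have "axis j (1::real) \<in> sphere 0 1" by (simp add: norm_eq_1 inner_axis_axis)
  ultimately show ?thesis by blast
qed

text \<open>Each factor vanishes only on a hyperplane, since g is invertible, and finitely many
  hyperplanes do not cover the space; homogeneity moves the point found to the sphere.\<close>

lemma norm_poly_pos: "\<exists>x\<in>sphere 0 1. norm_poly i x > 0"
proof -
  have neg: "negligible {x. (g *v x) $ i = 0}" if g: "g \<in> G" for g
  proof -
    define a where "a = axis i (1::real) v* g"
    have eq: "(g *v x) $ i = a \<bullet> x" for x
      by (simp add: a_def dot_lmul_matrix inner_axis')
    have "g ** transpose g = mat 1"
      using orthogonal_matrix_if_mem[OF G g] by (simp add: orthogonal_matrix_def)
    then have "g *v (transpose g *v axis i 1) = axis i 1"
      by (metis matrix_vector_mul_assoc matrix_vector_mul_lid)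
    then have "a \<bullet> (transpose g *v axis i 1) = 1" by (simp add: eq[symmetric] del: transpose_matrix_vector)
    then have "a \<noteq> 0" by auto
    then show ?thesis unfolding eq using negligible_hyperplane[of a 0] by simp
  qed
  have "negligible (\<Union>g\<in>G. {x. (g *v x) $ i = 0})"
    using finite_space_form_group[OF G] neg by (intro negligible_Union) auto
  then have "(\<Union>g\<in>G. {x. (g *v x) $ i = 0}) \<noteq> UNIV" using non_negligible_UNIV by metis
  then obtain x where x: "\<And>g. g \<in> G \<Longrightarrow> (g *v x) $ i \<noteq> 0" by blast
  have "x \<noteq> 0" using x[OF mat_1_mem[OF G]] by auto
  have "norm_poly i x \<noteq> 0" using x finite_space_form_group[OF G] by (simp add: norm_poly_def)
  then have "norm_poly i (inverse (norm x) *\<^sub>R x) \<noteq> 0"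
    using \<open>x \<noteq> 0\<close> by (simp add: hom_polys_homogeneous[OF norm_poly_hom])
  then have "norm_poly i (inverse (norm x) *\<^sub>R x) > 0" using norm_poly_nonneg[of i] by (simp add: less_le)
  moreover have "inverse (norm x) *\<^sub>R x \<in> sphere 0 1" using \<open>x \<noteq> 0\<close> by simp
  ultimately show ?thesis by blast
qed

text \<open>The sphere is connected, so the values fill an interval between 0 and a positive
  number.\<close>

lemma infinite_norm_poly_values: "infinite (norm_poly i ` sphere 0 1)"
proof -
  obtain x y where xy: "x \<in> sphere 0 1" "norm_poly i x = 0" "y \<in> sphere 0 1" "norm_poly i y > 0"
    using norm_poly_zero norm_poly_pos by metis
  have "CARD('n) \<ge> 3" using G by (simp add: space_form_group_def)
  then have "connected (sphere (0 :: real ^ 'n) 1)" by (intro connected_sphere) simp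
  then have "connected (norm_poly i ` sphere 0 1)"
    using sph_cont_hom_polys[OF norm_poly_hom] by (intro connected_continuous_image)
  then have "{norm_poly i x..norm_poly i y} \<subseteq> norm_poly i ` sphere 0 1"
    using xy by (intro connected_contains_Icc) auto
  moreover have "infinite {norm_poly i x..norm_poly i y}" using xy by (intro infinite_Icc) simp
  ultimately show ?thesis by (rule infinite_super)
qed

lemma subspace_inv_polys: "fun_space.subspace (inv_polys G k)"
  unfolding inv_polys_def by (rule subspace_invariant[OF G subspace_hom_polys])

text \<open>The powers of \<^const>\<open>norm_poly\<close>, made homogeneous of the same degree by powers of \<open>x \<bullet> x\<close>, are
  linearly independent because \<^const>\<open>norm_poly\<close> takes infinitely many values.\<close>

lemma fun_dim_inv_polys_unbounded: "\<exists>k. fun_dim (inv_polys G k) > n"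
proof -
  define i :: 'n where "i = undefined"
  define m where "m = card G"
  \<comment> \<open>The exponents give every \<open>F a\<close> the degree 2 m a + 2 m (n - a) = 2 m
    n. On the sphere the second factor is 1, so a linear relation becomes a polynomial relation for
    the values of \<open>norm_poly\<close>.\<close>
  define F where "F a x = norm_poly i x ^ a * (x \<bullet> x) ^ (m * (n - a))" for a x
  let ?k = "2 * m * n"
  have F: "F a \<in> inv_polys G ?k" if "a \<le> n" for a
  proof -
    have "2 * m * a + 2 * (m * (n - a)) = ?k" using that by (simp add: algebra_simps flip: distrib_left)
    then have "F a \<in> hom_polys real_coord ?k"
      using hom_polys_mult[OF hom_polys_power_mult[OF norm_poly_hom[of i], of a]
          hom_polys_power_mult[OF hom_polys_inner_self, of "m * (n - a)"]]
      by (simp add: F_def[abs_def] m_def)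
    moreover have "F a (g *v x) = F a x" if "g \<in> G" for g x
      using that orthogonal_transformation_matrix_vector[OF orthogonal_matrix_if_mem[OF G that]]
      by (simp add: F_def norm_poly_inv orthogonal_transformation_def)
    ultimately show ?thesis by (simp add: inv_polys_def)
  qed
  have ind: "fam_independent {..n} F"
    unfolding fam_independent_def
  proof (intro allI impI ballI)
    fix u a assume u: "\<forall>x. (\<Sum>a\<le>n. u a * F a x) = 0" and a: "a \<in> {..n}"
    define p where "p = (\<Sum>a\<le>n. Polynomial.monom (u a) a)"
    have "poly p (norm_poly i x) = 0" if "x \<in> sphere 0 1" for x
    proof -
      have "x \<bullet> x = 1" using that by (simp add: dot_square_norm)
      then show ?thesis using u[rule_format, of x] by (simp add: p_def poly_sum poly_monom F_def)
    qed
    then have "norm_poly i ` sphere 0 1 \<subseteq> {t. poly p t = 0}" by blast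
    then have "p = 0" using infinite_norm_poly_values[of i] poly_roots_finite[of p] finite_subset by blast
    then have "Polynomial.coeff p a = 0" by simp
    then show "u a = 0" using a by (simp add: p_def coeff_sum)
  qed
  obtain B where B: "finite B" "fun_space.span B = inv_polys G ?k" "card B = fun_dim (inv_polys G ?k)"
    by (rule finite_span_subset_hom_polys[OF subspace_inv_polys, of ?k ?k]) (auto simp: inv_polys_def)
  have "card (F ` {..n}) \<le> card B"
    using fun_space.independent_span_bound[OF B(1) independent_if_fam_independent[OF _ ind]] F B(2) by auto
  then have "Suc n \<le> fun_dim (inv_polys G ?k)"
    using B(3) card_image[OF inj_on_if_fam_independent[OF _ ind]] by simp
  then show ?thesis by (intro exI[of _ ?k]) simp
qed

lemma inv_lap_polys_eq: "inv_lap_polys G k = (if k < 2 then {\<lambda>x. 0} else inv_polys G (k - 2))"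
  by (auto simp: inv_lap_polys_def inv_polys_def lap_polys_def)

text \<open>Through this recursion the spectrum determines all dimensions of invariant forms, once
  the number of coordinates is known.\<close>

lemma fun_dim_inv_polys_rec:
  "fun_dim (inv_polys G k) =
    spectrum G (sph_eigenvalue CARD('n) k) + (if k < 2 then 0 else fun_dim (inv_polys G (k - 2)))"
proof -
  have "fun_dim {\<lambda>x :: real ^ 'n. 0} = 0"
    using fun_space.dim_le_card[of "{\<lambda>x :: real ^ 'n. 0}" "{}"] by (simp add: zero_fun_def)
  then show ?thesis
    using fun_dim_inv_polys[OF G, of k] by (simp add: spectrum_eigenvalue[OF G] inv_lap_polys_eq)
qed

text \<open>Unrolling the recursion bounds a_k by the sum of the multiplicities up to degree k. If
  these vanished from \<open>K\<close> on, all a_k would be bounded by one constant, contrary to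
  \<open>fun_dim_inv_polys_unbounded\<close>.\<close>

lemma exists_large_eigenvalue: "\<exists>k\<ge>K. spectrum G (sph_eigenvalue CARD('n) k) \<noteq> 0"
proof (rule ccontr)
  assume "\<not> (\<exists>k\<ge>K. spectrum G (sph_eigenvalue CARD('n) k) \<noteq> 0)"
  then have zero: "spectrum G (sph_eigenvalue CARD('n) k) = 0" if "k \<ge> K" for k using that by blast
  define C where "C = (\<Sum>j<K. spectrum G (sph_eigenvalue CARD('n) j))"
  have bound: "fun_dim (inv_polys G k) \<le> (\<Sum>j\<le>k. spectrum G (sph_eigenvalue CARD('n) j))" for k
  proof (induction k rule: less_induct)
    case (less k)
    have "(\<Sum>j\<le>k. spectrum G (sph_eigenvalue CARD('n) j)) =
        spectrum G (sph_eigenvalue CARD('n) k) + (\<Sum>j<k. spectrum G (sph_eigenvalue CARD('n) j))"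
      by (simp add: lessThan_Suc_atMost[symmetric])
    moreover have "(if k < 2 then 0 else fun_dim (inv_polys G (k - 2))) \<le> (\<Sum>j<k. spectrum G (sph_eigenvalue CARD('n) j))"
    proof (cases "k < 2")
      case False
      have "fun_dim (inv_polys G (k - 2)) \<le> (\<Sum>j\<le>k - 2. spectrum G (sph_eigenvalue CARD('n) j))"
        using less.IH[of "k - 2"] False by simp
      also have "\<dots> \<le> (\<Sum>j<k. spectrum G (sph_eigenvalue CARD('n) j))"
        using False by (intro sum_mono2) auto
      finally show ?thesis using False by simp
    qed simp
    ultimately show ?case using fun_dim_inv_polys_rec[of k] by simp
  qed
  obtain k where k: "fun_dim (inv_polys G k) > C" using fun_dim_inv_polys_unbounded by blast
  have "(\<Sum>j\<le>k. spectrum G (sph_eigenvalue CARD('n) j)) = (\<Sum>j\<in>{..k} \<inter> {..<K}. spectrum G (sph_eigenvalue CARD('n) j))"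
    by (intro sum.mono_neutral_right ballI zero) auto
  also have "\<dots> \<le> C" unfolding C_def by (intro sum_mono2) auto
  finally show False using bound[of k] k by simp
qed

end

text \<open>Completing the square in $k (k + N - 2) = l (l + M - 2)$ gives two squares whose difference does not
  depend on \<open>k\<close> and \<open>l\<close>; for $N \<noteq> M$ this bounds \<open>k\<close>.\<close>

lemma sph_eigenvalue_collision_bound:
  assumes "N \<noteq> M" "N \<ge> 2" "M \<ge> 2" "sph_eigenvalue N k = sph_eigenvalue M l"
  shows "k \<le> N * N + M * M"
proof -
  \<comment> \<open>With these, 4 k (k + a) = x^2 - a^2 and 4 l (l + b) = y^2 - b^2, so equal
    eigenvalues give x^2 - y^2 = a^2 - b^2.\<close>
  define a b x y :: int where "a = int N - 2" and "b = int M - 2" and "x = 2 * int k + a" and "y = 2 * int l + b"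
  have "real_of_int (int k * (int k + a)) = real_of_int (int l * (int l + b))"
    using assms(4) by (simp add: sph_eigenvalue_def a_def b_def add_diff_eq)
  then have "int k * (int k + a) = int l * (int l + b)" by (simp only: of_int_eq_iff)
  then have eq: "x * x - y * y = a * a - b * b" by (simp add: x_def y_def algebra_simps)
  have a0: "a \<ge> 0" "b \<ge> 0" "a \<noteq> b" using assms by (auto simp: a_def b_def)
  have xy: "x \<ge> 0" "y \<ge> 0" using a0 by (simp_all add: x_def y_def)
  have "a * a \<noteq> b * b" using a0 by (metis abs_of_nonneg abs_mult_self_eq power2_eq_iff_nonneg power2_eq_square)
  then have ne: "x \<noteq> y" using eq by auto
  \<comment> \<open>Distinct integers differ by at least 1, so x + y is at most |x^2 - y^2|.\<close>
  have "x + y \<le> \<bar>x - y\<bar> * (x + y)" using ne xy mult_right_mono[of 1 "\<bar>x - y\<bar>" "x + y"] by simp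
  also have "\<dots> = \<bar>(x - y) * (x + y)\<bar>" using xy by (simp add: abs_mult)
  also have "(x - y) * (x + y) = a * a - b * b" unfolding eq[symmetric] by (simp add: algebra_simps)
  also have "\<bar>a * a - b * b\<bar> \<le> a * a + b * b" using zero_le_square[of a] zero_le_square[of b] by linarith
  finally have "2 * int k + a + y \<le> a * a + b * b" by (simp add: x_def)
  moreover have "a * a \<le> int N * int N" "b * b \<le> int M * int M"
    using a0 by (auto simp: a_def b_def intro!: mult_mono)
  ultimately have "int k \<le> int N * int N + int M * int M" using a0 xy by linarith
  then show ?thesis by (metis of_nat_add of_nat_le_iff of_nat_mult)
qed

text \<open>An eigenvalue of the first quotient of degree \<open>K\<close>, just above the collision
  bound, or higher cannot belong to a sphere of another dimension, yet isospectrality makes it an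
  eigenvalue of the second quotient.\<close>

lemma isospectral_dim_eq:
  fixes G1 :: "(real ^ 'n1 ^ 'n1) set" and G2 :: "(real ^ 'n2 ^ 'n2) set"
  assumes G: "space_form_group G1" "space_form_group G2" and iso: "isospectral G1 G2"
  shows "CARD('n1) = CARD('n2)"
proof (rule ccontr)
  assume ne: "CARD('n1) \<noteq> CARD('n2)"
  define K where "K = Suc (CARD('n1) * CARD('n1) + CARD('n2) * CARD('n2))"
  obtain k where k: "k \<ge> K" "spectrum G1 (sph_eigenvalue CARD('n1) k) \<noteq> 0"
    using exists_large_eigenvalue[OF G(1)] by blast
  then have "spectrum G2 (sph_eigenvalue CARD('n1) k) \<noteq> 0" using iso by (simp add: isospectral_def)
  then have "\<exists>l. sph_eigenvalue CARD('n1) k = sph_eigenvalue CARD('n2) l"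
    using spectrum_not_eigenvalue[OF G(2), of "sph_eigenvalue CARD('n1) k"] by auto
  then obtain l where "sph_eigenvalue CARD('n1) k = sph_eigenvalue CARD('n2) l" ..
  moreover have "CARD('n1) \<ge> 2" "CARD('n2) \<ge> 2" using G by (simp_all add: space_form_group_def)
  ultimately have "k \<le> CARD('n1) * CARD('n1) + CARD('n2) * CARD('n2)"
    using sph_eigenvalue_collision_bound[OF ne] by blast
  then show False using k(1) by (simp add: K_def)
qed

lemma isospectral_inv_polys_dim_eq:
  fixes G1 :: "(real ^ 'n1 ^ 'n1) set" and G2 :: "(real ^ 'n2 ^ 'n2) set"
  assumes G: "space_form_group G1" "space_form_group G2" and iso: "isospectral G1 G2"
  shows "fun_dim (inv_polys G1 k) = fun_dim (inv_polys G2 k)"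
proof (induction k rule: less_induct)
  case (less k)
  have "spectrum G1 = spectrum G2" using iso by (simp add: isospectral_def)
  moreover have "CARD('n1) = CARD('n2)" using isospectral_dim_eq[OF assms] .
  ultimately show ?case
    using fun_dim_inv_polys_rec[OF G(1), of k] fun_dim_inv_polys_rec[OF G(2), of k] less.IH[of "k - 2"] by simp
qed

theorem theorem1p7:
  fixes G1 :: "(real ^ 'n1 ^ 'n1) set" and G2 :: "(real ^ 'n2 ^ 'n2) set"
    and d m n r1 :: nat
  assumes "space_form_group G1" and "space_form_group G2"
    and "isospectral G1 G2"
    and "type_I (as_group G1)"
    and "Gamma_params d m n r1" and "as_group G1 \<cong> Gamma_group m n r1"
  shows "type_I (as_group G2) \<and>
    (\<exists>r2. Gamma_params d m n r2 \<and> as_group G2 \<cong> Gamma_group m n r2 \<and>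
       (\<forall>c. c > 0 \<and> c dvd d \<longrightarrow> gcd (r1 ^ c - 1) m = gcd (r2 ^ c - 1) m))"
proof -
  note stat = order_statistics_if_same_inv_dims[OF assms(1,2) isospectral_dim_eq[OF assms(1-3)]
      isospectral_inv_polys_dim_eq[OF assms(1-3)]]
  show ?thesis
  proof (rule Gamma_group_order_statistics[OF _ _ _ _ _ assms(5,6)])
    show "group (as_group G1)" "group (as_group G2)"
      using group_as_group assms(1,2) by blast+
    show "finite (carrier (as_group G2))"
      using finite_space_form_group[OF assms(2)] by simp
    show "order (as_group G2) = order (as_group G1)"
      using stat(1) by (simp add: order_def)
    show "card {x \<in> carrier (as_group G2). group.ord (as_group G2) x = e} =
        card {x \<in> carrier (as_group G1). group.ord (as_group G1) x = e}" for e
      using stat(2)[of e] by simp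
  qed
qed

end
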